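(* Let $(u_0,u_1)\in\mathcal H(B^c)$ and let $u$ be the solution of the focusing equation $\partial_t^2u-\Delta u-u^5=0$ on $B^c$ with Neumann boundary condition $\partial_ru=0$ at $r=1$ and data $(u_0,u_1)$. Assume that $u$ is global and that $K=\{\vec u(t):t\in\mathbb R\}$ has compact closure in $\mathcal H(B^c)$. Then $u\equiv0$.
   Context: $B^c=\mathbb R^3\setminus B(0,1)$; $\mathcal H(B^c)$ is the space of radial pairs $(f,g)$ with $f\in L^6(B^c)$, $\nabla f\in L^2(B^c)$, $g\in L^2(B^c)$, normed by $(\int_{B^c}|\nabla f|^2+g^2)^{1/2}$. $\vec u=(u,\partial_tu)$. *)

theory Defs
  imports "HOL-Analysis.Analysis"
begin

text \<open>Radial reduction: a radial function on B^c = R^3 minus the open unit ball is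
  represented by its profile f :: real \<Rightarrow> real on r > 1 (values for r \<le> 1 are
  irrelevant); the volume element of R^3 becomes 4 pi r^2 dr.\<close>

definition smooth_fun :: "(real \<Rightarrow> real) \<Rightarrow> bool" where
  "smooth_fun \<phi> \<longleftrightarrow> (\<forall>k. \<forall>x. ((deriv ^^ k) \<phi>) differentiable (at x))"

definition test_fun :: "real set \<Rightarrow> (real \<Rightarrow> real) \<Rightarrow> bool" where
  "test_fun S \<phi> \<longleftrightarrow> smooth_fun \<phi> \<and>
     (\<exists>K. compact K \<and> K \<subseteq> S \<and> (\<forall>x. x \<notin> K \<longrightarrow> \<phi> x = 0))"

definition weak_deriv :: "(real \<Rightarrow> real) \<Rightarrow> (real \<Rightarrow> real) \<Rightarrow> bool" where
  "weak_deriv f df \<longleftrightarrow>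
     f \<in> borel_measurable lborel \<and> df \<in> borel_measurable lborel \<and>
     (\<forall>a b. 1 < a \<longrightarrow> set_integrable lborel {a..b} f \<and> set_integrable lborel {a..b} df) \<and>
     (\<forall>\<phi>. test_fun {1<..} \<phi> \<longrightarrow>
        (LINT r:{1<..}|lborel. f r * deriv \<phi> r) = - (LINT r:{1<..}|lborel. df r * \<phi> r))"

definition in_H :: "(real \<Rightarrow> real) \<Rightarrow> (real \<Rightarrow> real) \<Rightarrow> bool" where
  "in_H f g \<longleftrightarrow>
     f \<in> borel_measurable lborel \<and> g \<in> borel_measurable lborel \<and>
     set_integrable lborel {1<..} (\<lambda>r. \<bar>f r\<bar> ^ 6 * r\<^sup>2) \<and>
     (\<exists>df. weak_deriv f df \<and> set_integrable lborel {1<..} (\<lambda>r. (df r)\<^sup>2 * r\<^sup>2)) \<and>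
     set_integrable lborel {1<..} (\<lambda>r. (g r)\<^sup>2 * r\<^sup>2)"

text \<open>The (a.e. unique) weak radial derivative, i.e. the radial component of the gradient.\<close>
definition wderiv :: "(real \<Rightarrow> real) \<Rightarrow> real \<Rightarrow> real" where
  "wderiv f = (SOME df. weak_deriv f df \<and> set_integrable lborel {1<..} (\<lambda>r. (df r)\<^sup>2 * r\<^sup>2))"

definition H_dist :: "(real \<Rightarrow> real) \<times> (real \<Rightarrow> real) \<Rightarrow> (real \<Rightarrow> real) \<times> (real \<Rightarrow> real) \<Rightarrow> real" where
  "H_dist p q = sqrt (4 * pi *
     ((LINT r:{1<..}|lborel. (wderiv (fst p) r - wderiv (fst q) r)\<^sup>2 * r\<^sup>2) +
      (LINT r:{1<..}|lborel. (snd p r - snd q r)\<^sup>2 * r\<^sup>2)))"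

text \<open>Global (Strichartz-class, finite energy) solution of
  u_tt - Delta u - u^5 = 0 on B^c, Neumann condition d_r u = 0 at r = 1, with data (u0,u1).
  U0 t = u(t,.), U1 t = d_t u(t,.).  The equation and the Neumann condition are encoded by
  the weak formulation against test functions a(t) b(r), b NOT required to vanish at r = 1.\<close>
definition global_solution ::
  "(real \<Rightarrow> real) \<Rightarrow> (real \<Rightarrow> real) \<Rightarrow> (real \<Rightarrow> real \<Rightarrow> real) \<Rightarrow> (real \<Rightarrow> real \<Rightarrow> real) \<Rightarrow> bool" where
  "global_solution u0 u1 U0 U1 \<longleftrightarrow>
     (\<forall>t. in_H (U0 t) (U1 t)) \<and>
     (\<forall>t. ((\<lambda>s. H_dist (U0 s, U1 s) (U0 t, U1 t)) \<longlongrightarrow> 0) (at t)) \<and>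
     (AE r in lborel. r \<in> {1<..} \<longrightarrow> U0 0 r = u0 r \<and> U1 0 r = u1 r) \<and>
     (\<forall>T. (AE t in lborel. t \<in> {-T..T} \<longrightarrow>
              set_integrable lborel {1<..} (\<lambda>r. \<bar>U0 t r\<bar> ^ 10 * r\<^sup>2)) \<and>
          set_integrable lborel {-T..T}
              (\<lambda>t. sqrt (LINT r:{1<..}|lborel. \<bar>U0 t r\<bar> ^ 10 * r\<^sup>2))) \<and>
     (\<forall>a b. test_fun UNIV a \<longrightarrow> test_fun UNIV b \<longrightarrow>
        (LINT t|lborel. deriv a t * (LINT r:{1<..}|lborel. U0 t r * b r * r\<^sup>2)
                      + a t * (LINT r:{1<..}|lborel. U1 t r * b r * r\<^sup>2)) = 0 \<and>
        (LINT t|lborel. deriv a t * (LINT r:{1<..}|lborel. U1 t r * b r * r\<^sup>2)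
                      + a t * (LINT r:{1<..}|lborel.
                          (- wderiv (U0 t) r * deriv b r + (U0 t r) ^ 5 * b r) * r\<^sup>2)) = 0)"

text \<open>K = {vec u(t)} has compact closure in H: every sequence in K has a subsequence
  converging in H (H is a complete metric space).\<close>
definition precompact_traj :: "(real \<Rightarrow> real \<Rightarrow> real) \<Rightarrow> (real \<Rightarrow> real \<Rightarrow> real) \<Rightarrow> bool" where
  "precompact_traj U0 U1 \<longleftrightarrow>
     (\<forall>s :: nat \<Rightarrow> real. \<exists>\<sigma> f g. strict_mono \<sigma> \<and> in_H f g \<and>
        ((\<lambda>k. H_dist (U0 (s (\<sigma> k)), U1 (s (\<sigma> k))) (f, g)) \<longlonglongrightarrow> 0))"

end

theory Submission
  imports Defs
begin

text \<open>
  Put $v = r u$ and $F = r u^5 = v^5 / r^4$, so that $v_{tt} - v_{rr} = F$ on $r > 1$. Along an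
  outgoing characteristic, $v_t - v_r$ changes only through $F$, and precompactness of the
  trajectory forces it to vanish at infinity as $t \to +\infty$; likewise $v_t + v_r$ as
  $t \to -\infty$. Hence for every $t$
  \[ v_r(t,r) = \frac12 \int_{-\infty}^\infty F(t+s, r+|s|)\, ds \]
  with a similar formula for $v_t$. The latter bounds $d = v(t+h,\cdot) - v(t,\cdot)$ by
  $C |h| r^{-1/2}$. Feeding power bounds on $d$ into the difference of the formulas for $v_r$ halves
  them, first for large $r$, where $r^{1/2} |u|$ is uniformly small, and then, with a large power,
  on all of $r > 1$. So $u$ does not depend on $t$. The Pohozaev energy of the resulting
  Emden-Fowler profile is constant and vanishes at infinity, and under the Neumann condition
  it equals $u(1)^6 / 6$ at $r = 1$; thus $u(1) = u'(1) = 0$ and $u = 0$.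
\<close>

subsection \<open>Test functions\<close>

text \<open>The solution is given only weakly, tested against products \<open>a t * b r\<close>, and
  \<open>U1 t\<close> is merely an L^2 function, so nothing can be evaluated along a characteristic.
  Instead a test function is transported along it, and regularity is recovered afterwards:
  continuity of the trajectory in H makes the moments differentiable in t, and the formula for v_r
  shows that v is C^1 in r. As v_t is accessible only through pairings, stationarity is proved for
  finite time differences d. If r^(1/2) |u| <= M and |d| <= A r^(-k) at all times, the formula for
  v_r reproduces the bound with A multiplied by 5 M^4 / (k (k + 1)). This factor is small if M is
  small, which holds only far out, or if k is large; but a bound by a large power of 1/r is
  available only once d is known to vanish far out, which forces the order of the two stages. The
  Neumann condition must enter: the restriction to r > 1 of the ground state (1 + r^2/3)^(-1/2) on
  R^3 solves the stationary equation and has Pohozaev energy 0, but its derivative at r = 1 is not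
  0.\<close>

lemma smooth_fun_coinduct:
  assumes "f \<in> S"
    and step: "\<And>g. g \<in> S \<Longrightarrow> \<exists>g'\<in>S. \<forall>x. (g has_real_derivative g' x) (at x)"
  shows "smooth_fun f"
proof -
  have *: "(deriv ^^ k) f \<in> S" for k
  proof (induction k)
    case (Suc k)
    then obtain g' where g': "g' \<in> S" "\<forall>x. ((deriv ^^ k) f has_real_derivative g' x) (at x)"
      using step by blast
    then have "deriv ((deriv ^^ k) f) = g'"
      by (auto intro!: ext DERIV_imp_deriv)
    with g' show ?case by simp
  qed (use assms in auto)
  show ?thesis
    unfolding smooth_fun_def
  proof (intro allI)
    fix k x
    obtain g' where "\<forall>x. ((deriv ^^ k) f has_real_derivative g' x) (at x)"
      using step[OF *[of k]] by blast
    then show "(deriv ^^ k) f differentiable (at x)"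
      using real_differentiable_def by blast
  qed
qed

lemma smooth_fun_DERIV:
  assumes "smooth_fun f"
  shows "(f has_real_derivative deriv f x) (at x)"
  using assms[unfolded smooth_fun_def, rule_format, of 0 x]
  by (simp add: DERIV_deriv_iff_real_differentiable)

lemma smooth_fun_deriv: "smooth_fun f \<Longrightarrow> smooth_fun (deriv f)"
  unfolding smooth_fun_def
  by (metis comp_apply funpow_Suc_right)

lemma smooth_fun_continuous_on: "smooth_fun f \<Longrightarrow> continuous_on A f"
  by (meson DERIV_continuous_on has_field_derivative_at_within smooth_fun_DERIV)

lemma smooth_fun_measurable: "smooth_fun f \<Longrightarrow> f \<in> borel_measurable borel"
  by (simp add: borel_measurable_continuous_onI smooth_fun_continuous_on)

lemma DERIV_zero_on_open:
  assumes "open S" "x \<in> S" "\<And>y. y \<in> S \<Longrightarrow> f y = (0 :: real)"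
  shows "(f has_real_derivative 0) (at x)"
proof -
  have "\<forall>\<^sub>F y in nhds x. f y = 0"
    using assms by (auto simp: eventually_nhds)
  then show ?thesis
    by (subst DERIV_cong_ev[OF refl _ refl]) auto
qed

lemma smooth_fun_affine:
  assumes "smooth_fun f" shows "smooth_fun (\<lambda>x. f (m * x + d))"
proof (rule smooth_fun_coinduct[where S = "{\<lambda>x. k * g (m * x + d) | k g. smooth_fun g}"])
  show "(\<lambda>x. f (m * x + d)) \<in> {\<lambda>x. k * g (m * x + d) | k g. smooth_fun g}"
    using assms by (auto intro!: exI[of _ 1])
next
  fix h assume "h \<in> {\<lambda>x. k * g (m * x + d) | k g. smooth_fun g}"
  then obtain k g where h: "h = (\<lambda>x. k * g (m * x + d))" and g: "smooth_fun g" by auto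
  have "(h has_real_derivative (k * m) * deriv g (m * x + d)) (at x)" for x
    unfolding h
    by (auto intro!: derivative_eq_intros DERIV_chain'[OF _ smooth_fun_DERIV[OF g]])
  then show "\<exists>h'\<in>{\<lambda>x. k * g (m * x + d) | k g. smooth_fun g}. \<forall>x. (h has_real_derivative h' x) (at x)"
    using smooth_fun_deriv[OF g]
    by (intro bexI[of _ "\<lambda>x. (k * m) * deriv g (m * x + d)"]) auto
qed

lemma smooth_fun_shift: "smooth_fun f \<Longrightarrow> smooth_fun (\<lambda>x. f (x - d))"
  using smooth_fun_affine[of f 1 "- d"] by simp

text \<open>Finite sums of products of smooth functions: by the product rule this class is closed
  under differentiation, which is what \<open>smooth_fun_coinduct\<close> asks for.\<close>

inductive prod_sum :: "(real \<Rightarrow> real) \<Rightarrow> bool" where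
  prod: "smooth_fun f \<Longrightarrow> smooth_fun g \<Longrightarrow> prod_sum (\<lambda>x. f x * g x)"
| sum: "prod_sum f \<Longrightarrow> prod_sum g \<Longrightarrow> prod_sum (\<lambda>x. f x + g x)"

lemma prod_sum_smooth:
  assumes "prod_sum f" shows "smooth_fun f"
proof (rule smooth_fun_coinduct[where S = "Collect prod_sum"])
  fix g assume "g \<in> Collect prod_sum"
  then have "prod_sum g" by simp
  then show "\<exists>g'\<in>Collect prod_sum. \<forall>x. (g has_real_derivative g' x) (at x)"
  proof induction
    case (prod f g)
    have "((\<lambda>x. f x * g x) has_real_derivative f x * deriv g x + deriv f x * g x) (at x)" for x
      using DERIV_mult[OF smooth_fun_DERIV[OF prod(1)] smooth_fun_DERIV[OF prod(2)], of x]
      by (simp add: algebra_simps)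
    then show ?case
      using prod by (intro bexI[of _ "\<lambda>x. f x * deriv g x + deriv f x * g x"])
        (auto intro!: prod_sum.intros smooth_fun_deriv)
  next
    case (sum f g)
    then obtain f' g' where "prod_sum f'" "prod_sum g'"
      "\<forall>x. (f has_real_derivative f' x) (at x)" "\<forall>x. (g has_real_derivative g' x) (at x)"
      by auto
    then show ?case
      by (intro bexI[of _ "\<lambda>x. f' x + g' x"]) (auto intro!: prod_sum.intros derivative_eq_intros)
  qed
qed (use assms in auto)

lemma smooth_fun_mult: "smooth_fun f \<Longrightarrow> smooth_fun g \<Longrightarrow> smooth_fun (\<lambda>x. f x * g x)"
  by (rule prod_sum_smooth[OF prod_sum.prod])

lemma smooth_fun_const: "smooth_fun (\<lambda>x. c)"
  by (rule smooth_fun_coinduct[where S = "range (\<lambda>c x. c)"]) (auto intro!: derivative_eq_intros)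

lemma smooth_fun_primitive:
  assumes "\<And>x. (f has_real_derivative g x) (at x)" "smooth_fun g"
  shows "smooth_fun f"
proof (rule smooth_fun_coinduct[where S = "insert f (Collect smooth_fun)"])
  fix h assume "h \<in> insert f (Collect smooth_fun)"
  then show "\<exists>h'\<in>insert f (Collect smooth_fun). \<forall>x. (h has_real_derivative h' x) (at x)"
    using assms smooth_fun_DERIV smooth_fun_deriv by (elim insertE) blast+
qed simp

lemma smooth_fun_id: "smooth_fun (\<lambda>x. x)"
  by (rule smooth_fun_primitive[OF _ smooth_fun_const]) (auto intro!: derivative_eq_intros)

lemma smooth_fun_add: "smooth_fun f \<Longrightarrow> smooth_fun g \<Longrightarrow> smooth_fun (\<lambda>x. f x + g x)"
  using prod_sum_smooth[OF prod_sum.sum[OF prod_sum.prod[of "\<lambda>x. 1" f] prod_sum.prod[of "\<lambda>x. 1" g]]]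
  by (simp add: smooth_fun_const)

text \<open>Under y = 1/x this is the decay of a polynomial against an exponential. It supplies the
  right-hand limit of the difference quotients at 0 in \<open>exp_inv_smooth\<close>.\<close>

lemma poly_exp_inv_tendsto:
  fixes c :: real assumes "c > 0"
  shows "((\<lambda>x. poly p (1 / x) * exp (- c / x)) \<longlongrightarrow> 0) (at_right 0)"
proof -
  have 1: "((\<lambda>y. y ^ i / exp (c * y)) \<longlongrightarrow> 0) at_top" for i
  proof -
    have "((\<lambda>y. (1 / c ^ i) * ((c * y) ^ i / exp (c * y))) \<longlongrightarrow> (1 / c ^ i) * 0) at_top"
      by (intro tendsto_mult tendsto_const filterlim_compose[OF tendsto_power_div_exp_0]
        filterlim_tendsto_pos_mult_at_top[OF tendsto_const assms filterlim_ident])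
    then show ?thesis using assms by (simp add: power_mult_distrib)
  qed
  have "((\<lambda>y. \<Sum>i\<le>degree p. coeff p i * (y ^ i / exp (c * y))) \<longlongrightarrow> (\<Sum>i\<le>degree p. coeff p i * 0)) at_top"
    by (intro tendsto_sum tendsto_mult tendsto_const 1)
  then have "((\<lambda>y. poly p y * exp (- c * y)) \<longlongrightarrow> 0) at_top"
    by (simp add: poly_altdef sum_distrib_right exp_minus divide_inverse mult.assoc)
  then have "((\<lambda>x. poly p (inverse x) * exp (- c * inverse x)) \<longlongrightarrow> 0) (at_right 0)"
    by (rule filterlim_compose) (rule filterlim_inverse_at_top_right)
  then show ?thesis by (simp add: field_simps)
qed

text \<open>The classical flat function. The parameter \<open>c\<close> stays free because c -> 0
  turns it into the indicator of the positive half-line, which the cutoffs exploit.\<close>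

definition exp_inv :: "real \<Rightarrow> real \<Rightarrow> real" where
  "exp_inv c x = (if 0 < x then exp (- c / x) else 0)"

lemma exp_inv_smooth:
  assumes "c > 0" shows "smooth_fun (exp_inv c)"
proof -
  \<comment> \<open>The functions p(1/x) exp(-c/x), extended by 0, form a class closed under
    differentiation: the derivative belongs to the polynomial X^2 (c p - p'). At 0 every member has
    derivative 0.\<close>
  define h where "h p x = (if 0 < x then poly p (1 / x) * exp (- c / x) else 0)" for p and x :: real
  have der: "(h p has_real_derivative h ([:0, 0, 1:] * (smult c p - pderiv p)) x) (at x)" for p x
  proof (cases "x = 0")
    case True
    have "((\<lambda>y. (h p y - h p 0) / (y - 0)) \<longlongrightarrow> 0) (at_right 0)"
    proof (rule Lim_transform_eventually[OF poly_exp_inv_tendsto[OF assms, of "[:0, 1:] * p"]])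
      show "\<forall>\<^sub>F x in at_right 0. poly ([:0, 1:] * p) (1 / x) * exp (- c / x) = (h p x - h p 0) / (x - 0)"
        unfolding eventually_at_right_field by (auto simp: h_def field_simps intro!: exI[of _ 1])
    qed
    moreover have "((\<lambda>y. (h p y - h p 0) / (y - 0)) \<longlongrightarrow> 0) (at_left 0)"
      by (rule Lim_transform_eventually[of "\<lambda>_. 0"])
        (auto simp: h_def eventually_at_left_field intro!: exI[of _ "-1"])
    ultimately have "((\<lambda>y. (h p y - h p 0) / (y - 0)) \<longlongrightarrow> 0) (at 0)"
      by (simp add: filterlim_at_split)
    then show ?thesis using True by (simp add: has_field_derivative_iff h_def)
  next
    case False
    show ?thesis
    proof (cases "x > 0")
      case True
      have "((\<lambda>x. poly p (1 / x) * exp (- c / x)) has_real_derivative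
          poly p (1 / x) * (exp (- c / x) * (c / x\<^sup>2)) + poly (pderiv p) (1 / x) * (- 1 / x\<^sup>2) * exp (- c / x)) (at x)"
        using True
        by (auto intro!: derivative_eq_intros DERIV_chain'[where g = "poly p" and f = "\<lambda>x. 1 / x"]
            poly_DERIV simp: power2_eq_square)
      moreover have "\<forall>\<^sub>F y in nhds x. h p y = poly p (1 / y) * exp (- c / y)"
        using eventually_gt_at_top[of 0] True
        by (auto simp: eventually_nhds h_def intro!: exI[of _ "{0<..}"])
      ultimately show ?thesis
        using True by (subst DERIV_cong_ev[OF refl _ refl]) (auto simp: h_def power2_eq_square field_simps)
    next
      case F: False
      then have "\<forall>\<^sub>F y in nhds x. h p y = 0"
        using \<open>x \<noteq> 0\<close> by (auto simp: eventually_nhds h_def intro!: exI[of _ "{..<0}"])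
      then show ?thesis
        using F by (subst DERIV_cong_ev[OF refl _ refl]) (auto simp: h_def)
    qed
  qed
  have "exp_inv c = h 1" by (auto simp: exp_inv_def h_def)
  then show ?thesis
    by (intro smooth_fun_coinduct[where S = "range h"]) (use der in auto)
qed

section \<open>Test functions and cutoffs\<close>

lemma test_fun_smooth: "test_fun S f \<Longrightarrow> smooth_fun f"
  by (simp add: test_fun_def)

lemma test_fun_mono: "test_fun S f \<Longrightarrow> S \<subseteq> T \<Longrightarrow> test_fun T f"
  unfolding test_fun_def by blast

lemma test_fun_deriv:
  assumes "test_fun S f" shows "test_fun S (deriv f)"
proof -
  obtain K where K: "compact K" "K \<subseteq> S" "\<forall>x. x \<notin> K \<longrightarrow> f x = 0"
    using assms by (auto simp: test_fun_def)
  have "deriv f x = 0" if "x \<notin> K" for x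
    by (rule DERIV_imp_deriv, rule DERIV_zero_on_open[of "- K"])
      (use K that compact_imp_closed[OF K(1)] in auto)
  with K show ?thesis using assms smooth_fun_deriv by (auto simp: test_fun_def)
qed

lemma test_fun_mult_smooth:
  assumes "smooth_fun g" "test_fun S f" shows "test_fun S (\<lambda>x. g x * f x)"
proof -
  obtain K where "compact K" "K \<subseteq> S" "\<forall>x. x \<notin> K \<longrightarrow> f x = 0"
    using assms by (auto simp: test_fun_def)
  then show ?thesis
    using assms unfolding test_fun_def by (intro conjI exI[of _ K] smooth_fun_mult) auto
qed

lemma test_fun_cmult: "test_fun S f \<Longrightarrow> test_fun S (\<lambda>x. c * f x)"
  by (rule test_fun_mult_smooth[OF smooth_fun_const])

lemma test_fun_add:
  assumes "test_fun S f" "test_fun S g" shows "test_fun S (\<lambda>x. f x + g x)"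
proof -
  obtain K L where "compact K" "K \<subseteq> S" "\<forall>x. x \<notin> K \<longrightarrow> f x = 0" "compact L" "L \<subseteq> S" "\<forall>x. x \<notin> L \<longrightarrow> g x = 0"
    using assms by (auto simp: test_fun_def)
  then show ?thesis
    using assms unfolding test_fun_def
    by (intro conjI exI[of _ "K \<union> L"] smooth_fun_add) auto
qed

lemma test_fun_diff: "test_fun S f \<Longrightarrow> test_fun S g \<Longrightarrow> test_fun S (\<lambda>x. f x - g x)"
  using test_fun_add[OF _ test_fun_cmult[of S g "-1"]] by simp

lemma test_fun_shift:
  assumes "test_fun {l<..} f" "0 \<le> d" shows "test_fun {l<..} (\<lambda>x. f (x - d))"
proof -
  obtain K where K: "compact K" "K \<subseteq> {l<..}" "\<forall>x. x \<notin> K \<longrightarrow> f x = 0"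
    using assms by (auto simp: test_fun_def)
  have "compact ((\<lambda>x. x + d) ` K)" by (intro compact_continuous_image continuous_intros K)
  moreover have "(\<lambda>x. x + d) ` K \<subseteq> {l<..}" using K assms by force
  moreover have "f (x - d) = 0" if "x \<notin> (\<lambda>x. x + d) ` K" for x
    using K(3) that by (metis diff_add_cancel image_eqI)
  ultimately show ?thesis
    using assms smooth_fun_shift unfolding test_fun_def by blast
qed

lemma deriv_shift: "deriv (\<lambda>x. f (x - d)) x = deriv f (x - d)" for f :: "real \<Rightarrow> real"
proof -
  have "((\<lambda>x. f (x - d)) has_real_derivative D) (at x) \<longleftrightarrow> (f has_real_derivative D) (at (x - d))" for D
    using DERIV_shift[of f D x "- d"] by simp
  then show ?thesis by (simp add: deriv_def)
qed

text \<open>The function vanishes off the open interval, so in particular at both endpoints, as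
  integration by parts requires.\<close>

lemma test_fun_support:
  assumes "test_fun S f" "open S" "S \<noteq> {}" "is_interval S"
  obtains a b where "a < b" "{a..b} \<subseteq> S" "\<And>x. x \<notin> {a<..<b} \<Longrightarrow> f x = 0"
proof -
  obtain K where K: "compact K" "K \<subseteq> S" "\<forall>x. x \<notin> K \<longrightarrow> f x = 0"
    using assms by (auto simp: test_fun_def)
  obtain s where s: "s \<in> S" using assms by auto
  \<comment> \<open>The extra point keeps the set nonempty when \<open>K\<close> is empty, so that
    its extrema exist.\<close>
  define K' where "K' = insert s K"
  have K': "compact K'" "K' \<subseteq> S" "K' \<noteq> {}" using K s by (auto simp: K'_def)
  obtain m where m: "m \<in> K'" "\<forall>x\<in>K'. m \<le> x" using compact_attains_inf[OF K'(1,3)] by auto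
  obtain n where n: "n \<in> K'" "\<forall>x\<in>K'. x \<le> n" using compact_attains_sup[OF K'(1,3)] by auto
  obtain e where e: "e > 0" "ball m e \<subseteq> S" using assms(2) m K' by (meson openE subsetD)
  obtain d where d: "d > 0" "ball n d \<subseteq> S" using assms(2) n K' by (meson openE subsetD)
  have a: "m - e/2 \<in> S" using e by (auto simp: dist_real_def)
  have b: "n + d/2 \<in> S" using d by (auto simp: dist_real_def)
  show ?thesis
  proof (rule that[of "m - e/2" "n + d/2"])
    show "m - e/2 < n + d/2" using m n e d by (smt (verit) half_gt_zero)
    show "{m - e/2..n + d/2} \<subseteq> S"
      using mem_is_interval_1_I[OF assms(4) a b] by auto
    show "f x = 0" if "x \<notin> {m - e/2<..<n + d/2}" for x
    proof -
      have "x \<notin> K'" using that m n e d by (smt (verit) greaterThanLessThan_iff half_gt_zero)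
      then show ?thesis using K(3) by (auto simp: K'_def)
    qed
  qed
qed

lemma test_funI_support:
  assumes "smooth_fun f" "{a..b} \<subseteq> S" "\<And>x. x \<notin> {a..b} \<Longrightarrow> f x = 0"
  shows "test_fun S f"
  using assms unfolding test_fun_def by (intro conjI exI[of _ "{a..b}"]) auto

text \<open>Passage from a test function for the one-dimensional problem for v = r u to the
  three-dimensional one. The quotients g / x^k are closed under differentiation; the singularity at
  0 is invisible since g vanishes for x < 1.\<close>

lemma test_fun_divide:
  assumes "test_fun {1<..} f" shows "test_fun {1<..} (\<lambda>x. f x / x)"
proof -
  define S where "S = {\<lambda>x. g x / x ^ k | g (k::nat). test_fun {1<..} g}"
  have step: "\<exists>h'\<in>S. \<forall>x. (h has_real_derivative h' x) (at x)" if hS: "h \<in> S" for h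
  proof -
    obtain g and k :: nat where h: "h = (\<lambda>x. g x / x ^ k)" and g: "test_fun {1<..} g"
      using hS unfolding S_def by blast
    have tg: "test_fun {1<..} (\<lambda>x. x * deriv g x - real k * g x)"
      by (intro test_fun_diff test_fun_cmult test_fun_mult_smooth smooth_fun_id test_fun_deriv g)
    have "(h has_real_derivative (x * deriv g x - real k * g x) / x ^ Suc k) (at x)" for x
    proof (cases "x > 0")
      case True
      have "((\<lambda>x. g x / x ^ k) has_real_derivative
          (deriv g x * x ^ k - g x * (real k * x ^ (k - 1))) / (x ^ k * x ^ k)) (at x)"
        using True by (auto intro!: derivative_eq_intros smooth_fun_DERIV[OF test_fun_smooth[OF g]])
      moreover have "(deriv g x * x ^ k - g x * (real k * x ^ (k - 1))) / (x ^ k * x ^ k)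
         = (x * deriv g x - real k * g x) / x ^ Suc k"
        using True by (cases k) (auto simp: field_simps)
      ultimately show ?thesis using h by simp
    next
      case False
      have z: "g y = 0" if "y < 1" for y
        using g that unfolding test_fun_def by force
      have z': "deriv g y = 0" if "y < 1" for y
        using test_fun_deriv[OF g] that unfolding test_fun_def by force
      have "\<forall>\<^sub>F y in nhds x. h y = 0"
        using False z by (auto simp: eventually_nhds h intro!: exI[of _ "{..<1}"])
      then show ?thesis
        using False z z' by (subst DERIV_cong_ev[OF refl _ refl]) auto
    qed
    then show ?thesis
      using tg by (intro bexI[of _ "\<lambda>x. (x * deriv g x - real k * g x) / x ^ Suc k"])
        (auto simp: S_def simp del: power_Suc)
  qed
  have "(\<lambda>x. f x / x) \<in> S"
    unfolding S_def using assms by (auto intro!: exI[of _ f] exI[of _ "Suc 0"])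
  then have "smooth_fun (\<lambda>x. f x / x)" using step by (rule smooth_fun_coinduct)
  moreover obtain K where "compact K" "K \<subseteq> {1<..}" "\<forall>x. x \<notin> K \<longrightarrow> f x = 0"
    using assms by (auto simp: test_fun_def)
  ultimately show ?thesis unfolding test_fun_def by (intro conjI exI[of _ K]) auto
qed

text \<open>As n grows the flatness parameter tends to 0 and the bumps tend pointwise to the
  indicator of the open interval, so identities tested on bumps become identities for integrals over
  intervals.\<close>

definition cutoff :: "real \<Rightarrow> real \<Rightarrow> nat \<Rightarrow> real \<Rightarrow> real" where
  "cutoff a b n x = exp_inv (1 / real (Suc n)) (x - a) * exp_inv (1 / real (Suc n)) (b - x)"

lemma cutoff_test_fun: "{a..b} \<subseteq> S \<Longrightarrow> test_fun S (cutoff a b n)"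
proof (rule test_funI_support)
  have "smooth_fun (\<lambda>x. exp_inv (1 / real (Suc n)) (b - x))"
    using smooth_fun_affine[OF exp_inv_smooth[of "1 / real (Suc n)"], of "-1" b] by simp
  then show "smooth_fun (cutoff a b n)"
    unfolding cutoff_def by (intro smooth_fun_mult smooth_fun_shift exp_inv_smooth) simp
qed (auto simp: cutoff_def exp_inv_def)

lemma cutoff_bounds: "0 \<le> cutoff a b n x" "cutoff a b n x \<le> 1"
  unfolding cutoff_def exp_inv_def
  by (auto intro!: mult_le_one)

lemma cutoff_outside: "x \<notin> {a<..<b} \<Longrightarrow> cutoff a b n x = 0"
  by (auto simp: cutoff_def exp_inv_def)

lemma cutoff_pos: "x \<in> {a<..<b} \<Longrightarrow> 0 < cutoff a b n x"
  by (auto simp: cutoff_def exp_inv_def)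

lemma cutoff_tendsto: "(\<lambda>n. cutoff a b n x) \<longlonglongrightarrow> indicator {a<..<b} x"
proof (cases "x \<in> {a<..<b}")
  case True
  have "(\<lambda>n. exp (- (1 / real (Suc n)) / y)) \<longlonglongrightarrow> exp (- 0 / y)" if "y > 0" for y
    using that LIMSEQ_Suc[OF lim_1_over_n] by (intro tendsto_intros) auto
  from tendsto_mult[OF this[of "x - a"] this[of "b - x"]] show ?thesis
    using True by (simp add: cutoff_def exp_inv_def)
next
  case False
  then show ?thesis by (simp add: cutoff_outside)
qed

subsection \<open>Integration on intervals\<close>

lemma set_integral_support:
  fixes f :: "'a \<Rightarrow> real"
  assumes "A \<subseteq> S" "\<And>x. x \<in> S \<Longrightarrow> x \<notin> A \<Longrightarrow> f x = 0"
  shows "(LINT x:S|M. f x) = (LINT x:A|M. f x)"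
    and "set_integrable M S f \<longleftrightarrow> set_integrable M A f"
proof -
  have "(\<lambda>x. indicator S x *\<^sub>R f x) = (\<lambda>x. indicator A x *\<^sub>R f x)"
    using assms by (auto simp: indicator_def fun_eq_iff)
  then show "(LINT x:S|M. f x) = (LINT x:A|M. f x)"
    "set_integrable M S f \<longleftrightarrow> set_integrable M A f"
    by (simp_all add: set_lebesgue_integral_def set_integrable_def)
qed

lemma set_integrable_mult_bounded:
  fixes f g :: "real \<Rightarrow> real"
  assumes f: "set_integrable lborel A f" and g: "g \<in> borel_measurable borel"
    and B: "\<And>x. x \<in> A \<Longrightarrow> \<bar>g x\<bar> \<le> B"
  shows "set_integrable lborel A (\<lambda>x. f x * g x)"
  unfolding set_integrable_def
proof (rule Bochner_Integration.integrable_bound)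
  show "integrable lborel (\<lambda>x. B * (indicator A x *\<^sub>R f x))"
    using f by (simp add: set_integrable_def)
  have "(\<lambda>x. (indicator A x *\<^sub>R f x) * g x) \<in> borel_measurable lborel"
    using f g by (intro borel_measurable_times) (auto simp: set_integrable_def)
  then show "(\<lambda>x. indicator A x *\<^sub>R (f x * g x)) \<in> borel_measurable lborel"
    by (simp add: mult.assoc)
  show "AE x in lborel. norm (indicator A x *\<^sub>R (f x * g x)) \<le> norm (B * (indicator A x *\<^sub>R f x))"
  proof (intro AE_I2)
    fix x show "norm (indicator A x *\<^sub>R (f x * g x)) \<le> norm (B * (indicator A x *\<^sub>R f x))"
    proof (cases "x \<in> A")
      case True
      then have "\<bar>f x\<bar> * \<bar>g x\<bar> \<le> \<bar>f x\<bar> * \<bar>B\<bar>"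
        using B[OF True] by (intro mult_left_mono) auto
      then show ?thesis using True by (simp add: abs_mult mult.commute)
    qed simp
  qed
qed

lemma set_integrable_mult_continuous:
  fixes f g :: "real \<Rightarrow> real"
  assumes f: "set_integrable lborel {a..b} f" and g: "continuous_on UNIV g"
  shows "set_integrable lborel {a..b} (\<lambda>x. f x * g x)"
proof -
  have "compact (g ` {a..b})"
    using g by (intro compact_continuous_image continuous_on_subset[OF g]) auto
  then obtain B where "\<forall>y\<in>g ` {a..b}. norm y \<le> B"
    using compact_imp_bounded bounded_iff by metis
  then show ?thesis
    using g by (intro set_integrable_mult_bounded[OF f, where B = B] borel_measurable_continuous_onI) auto
qed

lemma set_integral_norm_le:
  fixes f g :: "real \<Rightarrow> real"
  assumes "set_integrable M A g" "set_integrable M A f" "\<And>x. x \<in> A \<Longrightarrow> \<bar>f x\<bar> \<le> g x"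
  shows "\<bar>LINT x:A|M. f x\<bar> \<le> (LINT x:A|M. g x)"
proof -
  have "\<bar>LINT x:A|M. f x\<bar> \<le> (LINT x:A|M. \<bar>f x\<bar>)"
    using integral_norm_bound[of M "\<lambda>x. indicator A x *\<^sub>R f x"]
    by (simp add: set_lebesgue_integral_def abs_mult)
  also have "\<dots> \<le> (LINT x:A|M. g x)"
    by (intro set_integral_mono set_integrable_abs assms)
  finally show ?thesis .
qed

lemma Cauchy_Schwarz_integral:
  fixes f g :: "'a \<Rightarrow> real"
  assumes [measurable]: "f \<in> borel_measurable M" "g \<in> borel_measurable M"
    and f: "integrable M (\<lambda>x. (f x)\<^sup>2)" and g: "integrable M (\<lambda>x. (g x)\<^sup>2)"
  shows "integrable M (\<lambda>x. f x * g x)"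
    and "\<bar>integral\<^sup>L M (\<lambda>x. f x * g x)\<bar> \<le> sqrt (integral\<^sup>L M (\<lambda>x. (f x)\<^sup>2)) * sqrt (integral\<^sup>L M (\<lambda>x. (g x)\<^sup>2))"
proof -
  show fg: "integrable M (\<lambda>x. f x * g x)"
  proof (rule Bochner_Integration.integrable_bound)
    show "integrable M (\<lambda>x. (f x)\<^sup>2 + (g x)\<^sup>2)" using f g by simp
    have "\<bar>s * t\<bar> \<le> \<bar>s\<^sup>2 + t\<^sup>2\<bar>" for s t :: real
    proof -
      have "2 * \<bar>s * t\<bar> \<le> s\<^sup>2 + t\<^sup>2"
        using zero_le_power2[of "\<bar>s\<bar> - \<bar>t\<bar>"] by (simp add: power2_diff abs_mult)
      then show ?thesis by linarith
    qed
    then show "AE x in M. norm (f x * g x) \<le> norm ((f x)\<^sup>2 + (g x)\<^sup>2)"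
      by simp
  qed measurable
  define a b c where "a = (\<integral>x. (f x)\<^sup>2 \<partial>M)" and "b = (\<integral>x. f x * g x \<partial>M)" and "c = (\<integral>x. (g x)\<^sup>2 \<partial>M)"
  have q: "0 \<le> s\<^sup>2 * a - 2 * s * t * b + t\<^sup>2 * c" for s t
  proof -
    have "0 \<le> (\<integral>x. (s * f x - t * g x)\<^sup>2 \<partial>M)" by simp
    also have "\<dots> = (\<integral>x. s\<^sup>2 * (f x)\<^sup>2 - 2 * s * t * (f x * g x) + t\<^sup>2 * (g x)\<^sup>2 \<partial>M)"
      by (intro Bochner_Integration.integral_cong) (auto simp: power2_eq_square algebra_simps)
    also have "\<dots> = s\<^sup>2 * a - 2 * s * t * b + t\<^sup>2 * c"
      using f g fg by (simp add: a_def b_def c_def)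
    finally show ?thesis .
  qed
  have ac: "0 \<le> a" "0 \<le> c" by (simp_all add: a_def c_def)
  have "b\<^sup>2 \<le> a * c"
  proof (cases "c = 0")
    case True
    have "b = 0"
    proof (rule ccontr)
      assume "b \<noteq> 0"
      then show False using q[of 1 "(a + 1) / (2 * b)"] True ac by simp
    qed
    then show ?thesis using True by simp
  next
    case False
    have "0 \<le> c * (a * c - b\<^sup>2)" using q[of c b] by (simp add: power2_eq_square algebra_simps)
    then show ?thesis using False ac by (simp add: zero_le_mult_iff)
  qed
  then have "\<bar>b\<bar> \<le> sqrt (a * c)" by (metis real_sqrt_abs real_sqrt_le_mono)
  then show "\<bar>integral\<^sup>L M (\<lambda>x. f x * g x)\<bar> \<le> sqrt (integral\<^sup>L M (\<lambda>x. (f x)\<^sup>2)) * sqrt (integral\<^sup>L M (\<lambda>x. (g x)\<^sup>2))"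
    by (simp add: a_def b_def c_def real_sqrt_mult)
qed

lemma set_Cauchy_Schwarz:
  fixes f g :: "real \<Rightarrow> real"
  assumes [measurable]: "f \<in> borel_measurable borel" "g \<in> borel_measurable borel" "A \<in> sets borel"
    and f: "set_integrable lborel A (\<lambda>x. (f x)\<^sup>2)" and g: "set_integrable lborel A (\<lambda>x. (g x)\<^sup>2)"
  shows "set_integrable lborel A (\<lambda>x. f x * g x)"
    and "\<bar>LBINT x:A. f x * g x\<bar> \<le> sqrt (LBINT x:A. (f x)\<^sup>2) * sqrt (LBINT x:A. (g x)\<^sup>2)"
proof -
  have eq: "(indicator A x * f x) * (indicator A x * g x) = indicator A x *\<^sub>R (f x * g x)"
    "(indicator A x * f x)\<^sup>2 = indicator A x *\<^sub>R (f x)\<^sup>2" for f g :: "real \<Rightarrow> real" and x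
    by (auto simp: indicator_def)
  have "integrable lborel (\<lambda>x. (indicator A x * f x)\<^sup>2)" "integrable lborel (\<lambda>x. (indicator A x * g x)\<^sup>2)"
    using f g unfolding eq set_integrable_def by auto
  from Cauchy_Schwarz_integral[OF _ _ this]
  show "set_integrable lborel A (\<lambda>x. f x * g x)"
    "\<bar>LBINT x:A. f x * g x\<bar> \<le> sqrt (LBINT x:A. (f x)\<^sup>2) * sqrt (LBINT x:A. (g x)\<^sup>2)"
    unfolding eq set_integrable_def set_lebesgue_integral_def by simp_all
qed

lemma set_integral_Icc_Ioc:
  fixes f :: "real \<Rightarrow> real"
  shows "(LBINT x:{a..b}. f x) = (LBINT x:{a<..b}. f x)"
    "(LBINT x:{a..b}. f x) = (LBINT x:{a<..<b}. f x)"
  unfolding set_lebesgue_integral_def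
  by (rule integral_discrete_difference[of "{a, b}"]; auto simp: indicator_def)+

text \<open>The positive and negative parts of the function, taken as densities, define finite
  measures with the same mass on every half-line \<open>{t<..}\<close>; such measures coincide, and
  then so do their densities almost everywhere.\<close>

lemma AE_zero_of_interval_integrals:
  fixes h :: "real \<Rightarrow> real"
  assumes h: "set_integrable lborel {a..b} h"
    and z: "\<And>c d. a \<le> c \<Longrightarrow> c \<le> d \<Longrightarrow> d \<le> b \<Longrightarrow> (LBINT x:{c..d}. h x) = 0"
  shows "AE x in lborel. x \<in> {a..b} \<longrightarrow> h x = 0"
proof -
  define H where "H x = indicator {a..b} x * h x" for x
  have H: "integrable lborel H" using h by (simp add: H_def[abs_def] set_integrable_def)
  then have [measurable]: "H \<in> borel_measurable borel" by auto
  let ?P = "\<lambda>x. max 0 (H x)" and ?N = "\<lambda>x. max 0 (- H x)"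
  have P: "integrable lborel ?P" and N: "integrable lborel ?N" using H by auto
  have em: "emeasure (density lborel (\<lambda>x. ennreal (f x))) {t<..} = ennreal (LBINT x:{t<..}. f x)"
    if f: "integrable lborel f" "\<And>x. f x \<ge> 0" for f :: "real \<Rightarrow> real" and t
  proof -
    have [measurable]: "f \<in> borel_measurable borel" using f by auto
    have "emeasure (density lborel (\<lambda>x. ennreal (f x))) {t<..} = (\<integral>\<^sup>+x. ennreal (indicator {t<..} x * f x) \<partial>lborel)"
      by (subst emeasure_density) (auto intro!: nn_integral_cong simp: indicator_def)
    also have "\<dots> = ennreal (\<integral>x. indicator {t<..} x * f x \<partial>lborel)"
      using f integrable_mult_indicator[of "{t<..}" lborel f] by (intro nn_integral_eq_integral) auto
    finally show ?thesis by (simp add: set_lebesgue_integral_def)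
  qed
  have "(LBINT x:{t<..}. H x) = 0" for t
  proof -
    have "(LBINT x:{t<..}. H x) = (LBINT x:{t<..} \<inter> {a..b}. h x)"
      unfolding set_lebesgue_integral_def by (intro Bochner_Integration.integral_cong) (auto simp: H_def indicator_def)
    also have "\<dots> = 0"
    proof (cases "t < a \<or> b \<le> t")
      case True
      then have "{t<..} \<inter> {a..b} = {} \<or> {t<..} \<inter> {a..b} = {a..b}" by auto
      moreover have "(LBINT x:{a..b}. h x) = 0"
        using z[of a b] by (cases "a \<le> b") (simp_all add: set_lebesgue_integral_def)
      ultimately show ?thesis by (elim disjE) (simp_all add: set_lebesgue_integral_def)
    next
      case False
      then have "{t<..} \<inter> {a..b} = {t<..b}" by auto
      then show ?thesis using z[of t b] False by (simp add: set_integral_Icc_Ioc)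
    qed
    finally show ?thesis .
  qed
  moreover have "(LBINT x:{t<..}. H x) = (LBINT x:{t<..}. ?P x) - (LBINT x:{t<..}. ?N x)" for t
  proof -
    have "set_integrable lborel {t<..} ?P" "set_integrable lborel {t<..} ?N"
      unfolding set_integrable_def by (intro integrable_mult_indicator P N; simp)+
    then have "(LBINT x:{t<..}. ?P x - ?N x) = (LBINT x:{t<..}. ?P x) - (LBINT x:{t<..}. ?N x)"
      by (rule set_integral_diff(2))
    moreover have "?P x - ?N x = H x" for x by auto
    ultimately show ?thesis by simp
  qed
  ultimately have eq: "(LBINT x:{t<..}. ?P x) = (LBINT x:{t<..}. ?N x)" for t by simp
  have "density lborel (\<lambda>x. ennreal (?P x)) = density lborel (\<lambda>x. ennreal (?N x))"
  proof (rule measure_eqI_lessThan)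
    show "emeasure (density lborel (\<lambda>x. ennreal (?P x))) {x<..} < \<infinity>" for x
      using em[OF P] by simp
    show "emeasure (density lborel (\<lambda>x. ennreal (?P x))) {x<..} = emeasure (density lborel (\<lambda>x. ennreal (?N x))) {x<..}" for x
      using em[OF P] em[OF N] eq by simp
  qed auto
  then have "AE x in lborel. ennreal (?P x) = ennreal (?N x)"
    by (subst (asm) sigma_finite_measure.density_unique_iff[OF sigma_finite_lborel]) auto
  then show ?thesis
  proof eventually_elim
    case (elim x)
    then have "?P x = ?N x" by (subst (asm) ennreal_inj) auto
    then show ?case by (auto simp: H_def max_def split: if_splits)
  qed
qed

lemma cutoff_integral_tendsto:
  assumes f: "set_integrable lborel {a..b} f" and S: "{a..b} \<subseteq> S"
  shows "(\<lambda>n. LBINT x:S. f x * cutoff a b n x) \<longlonglongrightarrow> (LBINT x:{a..b}. f x)"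
proof -
  have cm [measurable]: "cutoff a b n \<in> borel_measurable borel" for n
    using cutoff_test_fun[of a b UNIV n] by (auto intro: smooth_fun_measurable simp: test_fun_def)
  have "(\<lambda>n. LBINT x:{a..b}. f x * cutoff a b n x) \<longlonglongrightarrow> (LBINT x:{a..b}. f x * indicator {a<..<b} x)"
    unfolding set_lebesgue_integral_def
  proof (rule integral_dominated_convergence)
    have m: "(\<lambda>x. indicator {a..b} x *\<^sub>R f x) \<in> borel_measurable lborel"
      using f by (auto simp: set_integrable_def)
    have "(\<lambda>x. (indicator {a..b} x *\<^sub>R f x) * indicator {a<..<b} x) \<in> borel_measurable lborel"
      using m by (intro borel_measurable_times) auto
    then show "(\<lambda>x. indicator {a..b} x *\<^sub>R (f x * indicator {a<..<b} x)) \<in> borel_measurable lborel"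
      by (simp add: mult.assoc)
    have "(\<lambda>x. (indicator {a..b} x *\<^sub>R f x) * cutoff a b n x) \<in> borel_measurable lborel" for n
      using m cm by (intro borel_measurable_times) auto
    then show "(\<lambda>x. indicator {a..b} x *\<^sub>R (f x * cutoff a b n x)) \<in> borel_measurable lborel" for n
      by (simp add: mult.assoc)
    show "integrable lborel (\<lambda>x. \<bar>indicator {a..b} x *\<^sub>R f x\<bar>)"
      using f unfolding set_integrable_def by (rule integrable_abs)
    show "AE x in lborel. (\<lambda>n. indicator {a..b} x *\<^sub>R (f x * cutoff a b n x)) \<longlonglongrightarrow> indicator {a..b} x *\<^sub>R (f x * indicator {a<..<b} x)"
      by (intro AE_I2 tendsto_intros cutoff_tendsto)
    show "AE x in lborel. norm (indicator {a..b} x *\<^sub>R (f x * cutoff a b n x)) \<le> \<bar>indicator {a..b} x *\<^sub>R f x\<bar>" for n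
      using cutoff_bounds[of a b n]
      by (intro AE_I2) (auto simp: abs_mult indicator_def mult_left_le)
  qed
  moreover have "(LBINT x:{a..b}. f x * indicator {a<..<b} x) = (LBINT x:{a..b}. f x)"
    by (subst set_integral_Icc_Ioc(2))
      (auto simp: set_lebesgue_integral_def indicator_def set_integral_Icc_Ioc(2) intro!: Bochner_Integration.integral_cong)
  moreover have "(LBINT x:S. f x * cutoff a b n x) = (LBINT x:{a..b}. f x * cutoff a b n x)" for n
    using S by (intro set_integral_support) (auto simp: cutoff_outside)
  ultimately show ?thesis by simp
qed

lemma weak_zero_interval:
  assumes "set_integrable lborel {a..b} f" "{a..b} \<subseteq> S"
    and "\<And>\<phi>. test_fun S \<phi> \<Longrightarrow> (LBINT x:S. f x * \<phi> x) = 0"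
  shows "(LBINT x:{a..b}. f x) = 0"
  using cutoff_integral_tendsto[OF assms(1,2)] assms(3)[OF cutoff_test_fun[OF assms(2)]]
  by (simp add: LIMSEQ_const_iff)

lemma set_integral_deriv:
  assumes "smooth_fun f" "a \<le> b"
  shows "(LBINT x:{a..b}. deriv f x) = f b - f a"
  using integral_FTC_atLeastAtMost[of a b f "deriv f"] assms
    smooth_fun_continuous_on[OF smooth_fun_deriv] smooth_fun_DERIV[OF assms(1)]
  by (simp add: set_lebesgue_integral_def has_real_derivative_iff_has_vector_derivative
      has_vector_derivative_at_within)

lemma set_integrable_continuous: "continuous_on UNIV (f :: real \<Rightarrow> real) \<Longrightarrow> set_integrable lborel {a..b} f"
  using borel_integrable_compact[of "{a..b}" f] continuous_on_subset[of UNIV f "{a..b}"]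
  by (auto simp: set_integrable_def)

text \<open>An antiderivative is constant on either side of the support; the zero integral makes the
  two constants equal, and subtracting the common value gives compact support.\<close>

lemma test_fun_primitive:
  assumes "test_fun S \<xi>" "{a..b} \<subseteq> S" "a < b" "\<And>x. x \<notin> {a<..<b} \<Longrightarrow> \<xi> x = 0"
    and "(LBINT x:{a..b}. \<xi> x) = 0"
  shows "\<exists>\<Phi>. test_fun S \<Phi> \<and> deriv \<Phi> = \<xi>"
proof -
  have sm: "smooth_fun \<xi>" using assms by (simp add: test_fun_def)
  obtain F where F: "\<And>x. (F has_real_derivative \<xi> x) (at x)"
    using einterval_antiderivative[of "-\<infinity>" "\<infinity>" \<xi>] smooth_fun_continuous_on[OF sm, of UNIV]
    by (auto simp: continuous_on_eq_continuous_at has_real_derivative_iff_has_vector_derivative)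
  have sF: "smooth_fun F" by (rule smooth_fun_primitive[OF F sm])
  have dF: "deriv F = \<xi>" using F by (auto intro!: ext DERIV_imp_deriv)
  have left: "F x = F a" if "x < a" for x
    using MVT2[OF that F] assms(4) by force
  have right: "F x = F b" if "b < x" for x
    using MVT2[OF that F] assms(4) by force
  have ab: "F b = F a" using set_integral_deriv[OF sF, of a b] assms dF by simp
  define \<Phi> where "\<Phi> x = F x + (- F a)" for x
  have "smooth_fun \<Phi>" unfolding \<Phi>_def by (intro smooth_fun_add sF smooth_fun_const)
  moreover have "\<Phi> x = 0" if "x \<notin> {a..b}" for x
    using that left[of x] right[of x] ab by (cases "x < a") (auto simp: \<Phi>_def)
  moreover have "(\<Phi> has_real_derivative \<xi> x) (at x)" for x
    using F unfolding \<Phi>_def by (auto intro!: derivative_eq_intros)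
  ultimately show ?thesis
    using test_funI_support[OF _ assms(2), of \<Phi>] by (intro exI[of _ \<Phi>]) (auto intro!: ext DERIV_imp_deriv)
qed

lemma set_integrable_test:
  fixes h :: "real \<Rightarrow> real"
  assumes "\<And>a b. {a..b} \<subseteq> S \<Longrightarrow> set_integrable lborel {a..b} h"
    and "test_fun S \<phi>" "open S" "S \<noteq> {}" "is_interval S"
  shows "set_integrable lborel S (\<lambda>x. h x * \<phi> x)"
proof -
  obtain a b where ab: "a < b" "{a..b} \<subseteq> S" "\<And>x. x \<notin> {a<..<b} \<Longrightarrow> \<phi> x = 0"
    using test_fun_support[OF assms(2-5)] by metis
  have "set_integrable lborel {a..b} (\<lambda>x. h x * \<phi> x)"
    using assms ab by (intro set_integrable_mult_continuous smooth_fun_continuous_on test_fun_smooth)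
  then show ?thesis
    using ab by (subst set_integral_support(2)[of "{a..b}"]) auto
qed

text \<open>Every test function is the derivative of a test function plus a multiple of one fixed
  bump \<open>\<phi>0\<close>, so pairing with \<open>h\<close> is determined by its value on that
  bump, which fixes the constant. The integral form of the conclusion serves continuous
  \<open>h\<close>, where it yields equality at every point; the almost-everywhere form serves
  \<open>h\<close> that is merely integrable.\<close>

lemma du_Bois_Reymond:
  fixes h :: "real \<Rightarrow> real"
  assumes S: "open S" "S \<noteq> {}" "is_interval S"
    and h: "\<And>a b. {a..b} \<subseteq> S \<Longrightarrow> set_integrable lborel {a..b} h"
    and z: "\<And>\<phi>. test_fun S \<phi> \<Longrightarrow> (LBINT x:S. h x * deriv \<phi> x) = 0"
  shows "\<exists>c. \<forall>a b. {a..b} \<subseteq> S \<longrightarrow> (LBINT x:{a..b}. h x - c) = 0 \<and>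
    (AE x in lborel. x \<in> {a..b} \<longrightarrow> h x = c)"
proof -
  obtain s e where se: "e > 0" "ball s e \<subseteq> S" using S by (meson openE equals0I)
  define c0 d0 where "c0 = s - e/2" and "d0 = s + e/2"
  have cd: "c0 < d0" "{c0..d0} \<subseteq> S"
    using se by (auto simp: c0_def d0_def subset_iff dist_real_def abs_real_def split: if_splits)
  define \<phi>0 where "\<phi>0 = cutoff c0 d0 0"
  have t0: "test_fun S \<phi>0" unfolding \<phi>0_def by (rule cutoff_test_fun[OF cd(2)])
  define m where "m = (LBINT x:S. \<phi>0 x)"
  have one: "set_integrable lborel {a..b} (\<lambda>x. 1 :: real)" for a b :: real
    by (rule set_integrable_continuous) auto
  note intt = set_integrable_test[OF _ _ S]
  have m: "m \<noteq> 0"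
  proof
    assume "m = 0"
    moreover have "set_integrable lborel S \<phi>0" using intt[OF one t0] by simp
    ultimately have "AE x in lborel. indicator S x * \<phi>0 x = 0"
      using integral_nonneg_eq_0_iff_AE[of lborel "\<lambda>x. indicator S x * \<phi>0 x"] cutoff_bounds
      by (simp add: m_def set_lebesgue_integral_def set_integrable_def \<phi>0_def)
    then have "AE x in lborel. x \<notin> {c0<..<d0}"
    proof eventually_elim
      case (elim x)
      have "0 < \<phi>0 x \<and> x \<in> S" if "x \<in> {c0<..<d0}"
        using cutoff_pos[OF that, of 0] cd(2) that by (auto simp: \<phi>0_def)
      with elim show ?case by (auto simp: indicator_def)
    qed
    then have "emeasure lborel {c0<..<d0} = 0"
      by (subst (asm) AE_iff_measurable[of "{c0<..<d0}"]) auto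
    then show False using cd by simp
  qed
  define c where "c = (LBINT x:S. h x * \<phi>0 x) / m"
  have hc: "set_integrable lborel {a..b} (\<lambda>x. h x - c)" if "{a..b} \<subseteq> S" for a b
    by (intro set_integral_diff(1) h that set_integrable_continuous) auto
  have tz: "(LBINT x:S. (h x - c) * \<psi> x) = 0" if \<psi>: "test_fun S \<psi>" for \<psi>
  proof -
    \<comment> \<open>This multiple of the bump gives \<xi> integral 0, which makes \<xi> the
      derivative of a test function.\<close>
    define k where "k = (LBINT x:S. \<psi> x) / m"
    define \<xi> where "\<xi> x = \<psi> x - k * \<phi>0 x" for x
    have t\<xi>: "test_fun S \<xi>" unfolding \<xi>_def by (intro test_fun_diff test_fun_cmult \<psi> t0)
    obtain a b where ab: "a < b" "{a..b} \<subseteq> S" "\<And>x. x \<notin> {a<..<b} \<Longrightarrow> \<xi> x = 0"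
      using test_fun_support[OF t\<xi> S] by metis
    have i1: "set_integrable lborel S \<psi>" "set_integrable lborel S \<phi>0"
      using intt[OF one \<psi>] intt[OF one t0] by simp_all
    have "(LBINT x:{a..b}. \<xi> x) = (LBINT x:S. \<xi> x)"
      using ab by (intro set_integral_support(1)[symmetric]) auto
    also have "\<dots> = 0"
      using i1 m unfolding \<xi>_def by (simp add: k_def m_def)
    finally obtain \<Phi> where \<Phi>: "test_fun S \<Phi>" "deriv \<Phi> = \<xi>"
      using test_fun_primitive[OF t\<xi> ab(2,1,3)] by blast
    have i2: "set_integrable lborel S (\<lambda>x. h x * \<psi> x)" "set_integrable lborel S (\<lambda>x. h x * \<phi>0 x)"
      by (intro intt h \<psi> t0; simp)+
    have "0 = (LBINT x:S. h x * \<psi> x - k * (h x * \<phi>0 x))"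
      using z[OF \<Phi>(1)] \<Phi>(2) by (simp add: \<xi>_def algebra_simps)
    also have "\<dots> = (LBINT x:S. h x * \<psi> x) - k * (LBINT x:S. h x * \<phi>0 x)"
      using i2 by simp
    also have "\<dots> = (LBINT x:S. h x * \<psi> x) - c * (LBINT x:S. \<psi> x)"
      by (simp add: k_def c_def)
    also have "\<dots> = (LBINT x:S. (h x - c) * \<psi> x)"
      using i1 i2 by (simp add: left_diff_distrib)
    finally show ?thesis by simp
  qed
  have zero: "(LBINT x:{a..b}. h x - c) = 0" if "{a..b} \<subseteq> S" for a b
    by (rule weak_zero_interval[OF hc[OF that] that tz])
  show ?thesis
  proof (intro exI[of _ c] allI impI conjI zero)
    fix a b :: real assume ab: "{a..b} \<subseteq> S"
    have "AE x in lborel. x \<in> {a..b} \<longrightarrow> h x - c = 0"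
      using ab by (intro AE_zero_of_interval_integrals hc zero) auto
    then show "AE x in lborel. x \<in> {a..b} \<longrightarrow> h x = c" by simp
  qed
qed

text \<open>Fubini on the triangle a <= x <= r <= b, since \<open>w\<close> is only integrable. The
  condition on \<phi> sits at b, as the primitive itself vanishes at a; thus nothing has to be
  arranged at the boundary r = 1 when this is used in \<open>Neumann\<close>.\<close>

lemma integral_primitive_by_parts:
  fixes w :: "real \<Rightarrow> real"
  assumes w: "set_integrable lborel {a..b} w" and \<phi>: "smooth_fun \<phi>" "\<phi> b = 0" and ab: "a \<le> b"
  shows "set_integrable lborel {a..b} (\<lambda>r. (LBINT x:{a..r}. w x) * deriv \<phi> r)"
    and "(LBINT r:{a..b}. (LBINT x:{a..r}. w x) * deriv \<phi> r) = - (LBINT x:{a..b}. w x * \<phi> x)"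
proof -
  define W where "W x = indicator {a..b} x * w x" for x
  define D where "D r = indicator {a..b} r * deriv \<phi> r" for r
  have W: "integrable lborel W" using w by (simp add: W_def[abs_def] set_integrable_def)
  have D: "integrable lborel D"
    using set_integrable_continuous[OF smooth_fun_continuous_on[OF smooth_fun_deriv[OF \<phi>(1)]], of a b]
    by (simp add: D_def[abs_def] set_integrable_def)
  have [measurable]: "W \<in> borel_measurable borel" "D \<in> borel_measurable borel"
    using W D by auto
  have intg: "integrable (lborel \<Otimes>\<^sub>M lborel) (\<lambda>(r, x). D r * W x * indicator {p. snd p \<le> fst p} (r, x))"
  proof (rule Bochner_Integration.integrable_bound)
    show "integrable (lborel \<Otimes>\<^sub>M lborel) (\<lambda>(r, x). D r * W x)"
      using lborel_pair.Fubini_integrable[of "\<lambda>(r, x). D r * W x"] D W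
      by (simp add: abs_mult)
    show "AE p in lborel \<Otimes>\<^sub>M lborel. norm (case p of (r, x) \<Rightarrow> D r * W x * indicator {p. snd p \<le> fst p} (r, x))
        \<le> norm (case p of (r, x) \<Rightarrow> D r * W x)"
      by (intro AE_I2) (auto simp: indicator_def)
  qed measurable
  have inner1: "(\<integral>x. D r * W x * indicator {p. snd p \<le> fst p} (r, x) \<partial>lborel)
      = indicator {a..b} r *\<^sub>R ((LBINT x:{a..r}. w x) * deriv \<phi> r)" for r
  proof (cases "r \<in> {a..b}")
    case True
    have "(\<integral>x. D r * W x * indicator {p. snd p \<le> fst p} (r, x) \<partial>lborel) = (\<integral>x. D r * (indicator {a..r} x * w x) \<partial>lborel)"
      using True by (intro Bochner_Integration.integral_cong) (auto simp: W_def indicator_def)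
    then show ?thesis using True by (simp add: D_def set_lebesgue_integral_def)
  qed (simp add: D_def)
  have inner2: "(\<integral>r. D r * W x * indicator {p. snd p \<le> fst p} (r, x) \<partial>lborel)
      = - (indicator {a..b} x *\<^sub>R (w x * \<phi> x))" for x
  proof (cases "x \<in> {a..b}")
    case True
    have "(\<integral>r. D r * W x * indicator {p. snd p \<le> fst p} (r, x) \<partial>lborel) = (\<integral>r. W x * (indicator {x..b} r * deriv \<phi> r) \<partial>lborel)"
      using True by (intro Bochner_Integration.integral_cong) (auto simp: D_def indicator_def)
    also have "\<dots> = W x * (LBINT r:{x..b}. deriv \<phi> r)" by (simp add: set_lebesgue_integral_def)
    also have "\<dots> = - (w x * \<phi> x)"
      using set_integral_deriv[OF \<phi>(1), of x b] True \<phi>(2) by (simp add: W_def)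
    finally show ?thesis using True by simp
  qed (simp add: W_def)
  show "set_integrable lborel {a..b} (\<lambda>r. (LBINT x:{a..r}. w x) * deriv \<phi> r)"
    using lborel_pair.integrable_fst'[OF intg] by (simp add: inner1 set_integrable_def)
  show "(LBINT r:{a..b}. (LBINT x:{a..r}. w x) * deriv \<phi> r) = - (LBINT x:{a..b}. w x * \<phi> x)"
    using lborel_pair.Fubini_integral[OF intg]
    by (simp add: inner1 inner2 set_lebesgue_integral_def)
qed

subsection \<open>Radial profiles of finite energy\<close>

lemma powr_tail:
  fixes a p :: real
  assumes "a > 0" "p > 1"
  shows "set_integrable lborel {a<..} (\<lambda>x. x powr - p)"
    and "(LBINT x:{a<..}. x powr - p) = a powr (1 - p) / (p - 1)"
proof -
  have lim: "((\<lambda>x. - (x powr (1 - p)) / (p - 1)) \<longlongrightarrow> - 0 / (p - 1)) at_top"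
    using assms by (intro tendsto_intros tendsto_neg_powr filterlim_ident) auto
  have nn: "(\<integral>\<^sup>+x. ennreal (x powr - p) * indicator {a..} x \<partial>lborel) = ennreal (- 0 / (p - 1) - - (a powr (1 - p)) / (p - 1))"
  proof (rule nn_integral_FTC_atLeast[OF _ _ _ lim])
    fix x :: real assume "a \<le> x"
    then have "x > 0" using assms by simp
    then have "((\<lambda>x. - (x powr (1 - p)) / (p - 1)) has_real_derivative - ((1 - p) * x powr (1 - p - 1)) / (p - 1)) (at x)"
      using assms by (auto intro!: derivative_eq_intros)
    moreover have "- ((1 - p) * x powr (1 - p - 1)) / (p - 1) = x powr - p"
      using assms by (simp add: field_simps)
    ultimately show "((\<lambda>x. - (x powr (1 - p)) / (p - 1)) has_real_derivative x powr - p) (at x)" by simp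
  qed auto
  have "has_bochner_integral lborel (\<lambda>x. indicator {a..} x *\<^sub>R x powr - p) (a powr (1 - p) / (p - 1))"
  proof (rule has_bochner_integral_nn_integral)
    show "(\<integral>\<^sup>+x. ennreal (indicator {a..} x *\<^sub>R x powr - p) \<partial>lborel) = ennreal (a powr (1 - p) / (p - 1))"
      using nn by (simp add: indicator_mult_ennreal mult.commute) 
  qed (use assms in auto)
  then have "set_integrable lborel {a..} (\<lambda>x. x powr - p)" "(LBINT x:{a..}. x powr - p) = a powr (1 - p) / (p - 1)"
    by (auto simp: set_integrable_def set_lebesgue_integral_def has_bochner_integral_iff)
  moreover have "{a..} - {a<..} \<union> ({a<..} - {a..}) \<subseteq> {a}" by auto
  ultimately show "set_integrable lborel {a<..} (\<lambda>x. x powr - p)"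
    and "(LBINT x:{a<..}. x powr - p) = a powr (1 - p) / (p - 1)"
    using set_integrable_discrete_difference[of "{a}" "{a..}" "{a<..}" lborel "\<lambda>x. x powr - p"]
      set_integral_discrete_difference[of "{a}" "{a..}" "{a<..}" lborel "\<lambda>x. x powr - p"] by simp_all
qed

lemma inverse_square_tail:
  fixes a :: real assumes "a > 0"
  shows "set_integrable lborel {a<..} (\<lambda>x. (1 / x)\<^sup>2)"
    and "(LBINT x:{a<..}. (1 / x)\<^sup>2) = 1 / a"
proof -
  have eq: "(1 / x)\<^sup>2 = x powr - 2" if "x \<in> {a<..}" for x
    using that assms by (simp add: powr_minus power_one_over divide_simps)
  show "set_integrable lborel {a<..} (\<lambda>x. (1 / x)\<^sup>2)"
    using powr_tail(1)[OF assms, of 2] eq by (subst set_integrable_cong[OF refl refl eq]) auto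
  have "(LBINT x:{a<..}. (1 / x)\<^sup>2) = (LBINT x:{a<..}. x powr - 2)"
    using eq by (intro set_lebesgue_integral_cong) auto
  then show "(LBINT x:{a<..}. (1 / x)\<^sup>2) = 1 / a"
    using powr_tail(2)[OF assms, of 2] assms by (simp add: powr_minus divide_simps)
qed

section \<open>Weighted L^2 tails of radial functions\<close>

definition rad_sq :: "real \<Rightarrow> (real \<Rightarrow> real) \<Rightarrow> real" where
  "rad_sq R q = (LBINT r:{R<..}. (q r)\<^sup>2 * r\<^sup>2)"

definition rad_L2 :: "(real \<Rightarrow> real) \<Rightarrow> bool" where
  "rad_L2 q \<longleftrightarrow> q \<in> borel_measurable borel \<and> set_integrable lborel {1<..} (\<lambda>r. (q r)\<^sup>2 * r\<^sup>2)"

lemma rad_L2_integrable: "rad_L2 q \<Longrightarrow> 1 \<le> R \<Longrightarrow> set_integrable lborel {R<..} (\<lambda>r. (q r)\<^sup>2 * r\<^sup>2)"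
  unfolding rad_L2_def by (auto elim: set_integrable_subset)

lemma rad_sq_nonneg [simp]: "0 \<le> rad_sq R q"
  unfolding rad_sq_def set_lebesgue_integral_def by (rule integral_nonneg_AE) auto

lemma rad_sq_antimono:
  assumes "rad_L2 q" "1 \<le> R" "R \<le> R'"
  shows "rad_sq R' q \<le> rad_sq R q"
  unfolding rad_sq_def set_lebesgue_integral_def
  using rad_L2_integrable[OF assms(1), of R] rad_L2_integrable[OF assms(1), of R'] assms
  by (intro integral_mono) (auto simp: set_integrable_def indicator_def)

lemma rad_L2_diff:
  assumes "rad_L2 p" "rad_L2 q" shows "rad_L2 (\<lambda>r. p r - q r)"
  unfolding rad_L2_def
proof
  have [measurable]: "p \<in> borel_measurable borel" "q \<in> borel_measurable borel"
    using assms by (auto simp: rad_L2_def)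
  show "(\<lambda>r. p r - q r) \<in> borel_measurable borel" by measurable
  show "set_integrable lborel {1<..} (\<lambda>r. (p r - q r)\<^sup>2 * r\<^sup>2)"
    unfolding set_integrable_def
  proof (rule Bochner_Integration.integrable_bound)
    show "integrable lborel (\<lambda>x. 2 * (indicator {1<..} x *\<^sub>R ((p x)\<^sup>2 * x\<^sup>2)) + 2 * (indicator {1<..} x *\<^sub>R ((q x)\<^sup>2 * x\<^sup>2)))"
      using assms by (auto simp: rad_L2_def set_integrable_def)
    have "(p x - q x)\<^sup>2 * x\<^sup>2 \<le> 2 * ((p x)\<^sup>2 * x\<^sup>2) + 2 * ((q x)\<^sup>2 * x\<^sup>2)" for x
    proof -
      have "(p x - q x)\<^sup>2 \<le> 2 * (p x)\<^sup>2 + 2 * (q x)\<^sup>2"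
        using zero_le_power2[of "p x + q x"] by (simp add: power2_eq_square algebra_simps)
      from mult_right_mono[OF this, of "x\<^sup>2"] show ?thesis by (simp add: algebra_simps)
    qed
    then show "AE x in lborel. norm (indicator {1<..} x *\<^sub>R ((p x - q x)\<^sup>2 * x\<^sup>2))
        \<le> norm (2 * (indicator {1<..} x *\<^sub>R ((p x)\<^sup>2 * x\<^sup>2)) + 2 * (indicator {1<..} x *\<^sub>R ((q x)\<^sup>2 * x\<^sup>2)))"
      by (intro AE_I2) (auto simp: indicator_def)
  qed measurable
qed

lemma rad_sq_triangle:
  assumes "rad_L2 p" "rad_L2 q" "1 \<le> R"
  shows "rad_sq R p \<le> 2 * rad_sq R (\<lambda>r. p r - q r) + 2 * rad_sq R q"
proof -
  note i = rad_L2_integrable[OF rad_L2_diff[OF assms(1,2)] assms(3)] rad_L2_integrable[OF assms(1,3)] rad_L2_integrable[OF assms(2,3)]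
  have "rad_sq R p \<le> (LBINT r:{R<..}. 2 * ((p r - q r)\<^sup>2 * r\<^sup>2) + 2 * ((q r)\<^sup>2 * r\<^sup>2))"
    unfolding rad_sq_def
  proof (intro set_integral_mono i set_integral_add set_integrable_mult_right)
    fix x
    have "(p x)\<^sup>2 \<le> 2 * (p x - q x)\<^sup>2 + 2 * (q x)\<^sup>2"
      using zero_le_power2[of "p x - 2 * q x"] by (simp add: power2_eq_square algebra_simps)
    from mult_right_mono[OF this, of "x\<^sup>2"]
    show "(p x)\<^sup>2 * x\<^sup>2 \<le> 2 * ((p x - q x)\<^sup>2 * x\<^sup>2) + 2 * ((q x)\<^sup>2 * x\<^sup>2)" by (simp add: algebra_simps)
  qed
  also have "\<dots> = 2 * rad_sq R (\<lambda>r. p r - q r) + 2 * rad_sq R q"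
    using i unfolding rad_sq_def by (subst set_integral_add(2)) auto
  finally show ?thesis .
qed

lemma rad_sq_tendsto_0:
  assumes "rad_L2 q" shows "(\<lambda>n. rad_sq (real n + 1) q) \<longlonglongrightarrow> 0"
proof -
  have "(\<lambda>n. LBINT r:{real n + 1<..}. (q r)\<^sup>2 * r\<^sup>2) \<longlonglongrightarrow> (LBINT r:(\<Inter>n. {real n + 1<..}). (q r)\<^sup>2 * r\<^sup>2)"
    using rad_L2_integrable[OF assms, of 1] by (intro set_integral_cont_down) (auto simp: decseq_def)
  moreover have "(\<Inter>n. {real n + 1<..}) = {}"
  proof -
    have "\<exists>n. \<not> real n + 1 < x" for x :: real
    proof -
      obtain n where "x \<le> real n" using real_arch_simple by blast
      then show ?thesis by (intro exI[of _ n]) simp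
    qed
    then show ?thesis by auto
  qed
  ultimately show ?thesis by (simp add: rad_sq_def set_lebesgue_integral_def)
qed

lemma rad_L2_mult:
  assumes "rad_L2 q" and [measurable]: "m \<in> borel_measurable borel"
    and m: "set_integrable lborel {R<..} (\<lambda>r. (m r)\<^sup>2)" and R: "1 \<le> R"
  shows "set_integrable lborel {R<..} (\<lambda>r. q r * r * m r)"
    and "\<bar>LBINT r:{R<..}. q r * r * m r\<bar> \<le> sqrt (rad_sq R q) * sqrt (LBINT r:{R<..}. (m r)\<^sup>2)"
proof -
  have [measurable]: "q \<in> borel_measurable borel" using assms by (auto simp: rad_L2_def)
  have eq: "(q r)\<^sup>2 * r\<^sup>2 = (q r * r)\<^sup>2" for r by (simp add: power_mult_distrib)
  have i: "set_integrable lborel {R<..} (\<lambda>r. (q r * r)\<^sup>2)"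
    using rad_L2_integrable[OF assms(1) R] by (simp add: eq)
  show "set_integrable lborel {R<..} (\<lambda>r. q r * r * m r)"
    "\<bar>LBINT r:{R<..}. q r * r * m r\<bar> \<le> sqrt (rad_sq R q) * sqrt (LBINT r:{R<..}. (m r)\<^sup>2)"
    using set_Cauchy_Schwarz[OF _ _ _ i m] by (simp_all add: rad_sq_def eq)
qed

text \<open>Cauchy-Schwarz for q r against 1/r, whose squared norm on (R, infinity) is 1/R. Applied
  to the radial derivative this is the Strauss decay r^(-1/2) of finite energy profiles.\<close>

lemma rad_L2_tail:
  assumes "rad_L2 q" and R: "1 \<le> R"
  shows "set_integrable lborel {R<..} q"
    and "\<bar>LBINT r:{R<..}. q r\<bar> \<le> sqrt (rad_sq R q) / sqrt R"
proof -
  have eq: "q r * r * (1 / r) = q r" if "r \<in> {R<..}" for r using that R by simp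
  have "set_integrable lborel {R<..} (\<lambda>r. q r * r * (1 / r))"
    "\<bar>LBINT r:{R<..}. q r * r * (1 / r)\<bar> \<le> sqrt (rad_sq R q) * sqrt (1 / R)"
    using rad_L2_mult[OF assms(1) _ inverse_square_tail(1) R] R inverse_square_tail(2)[of R] by simp_all
  moreover have "(LBINT r:{R<..}. q r * r * (1 / r)) = (LBINT r:{R<..}. q r)"
    using eq by (intro set_lebesgue_integral_cong) auto
  moreover have "set_integrable lborel {R<..} (\<lambda>r. q r * r * (1 / r)) \<longleftrightarrow> set_integrable lborel {R<..} q"
    by (rule set_integrable_cong[OF refl refl eq])
  ultimately show "set_integrable lborel {R<..} q"
    "\<bar>LBINT r:{R<..}. q r\<bar> \<le> sqrt (rad_sq R q) / sqrt R"
    by (simp_all add: real_sqrt_divide)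
qed

lemma rad_L2_interval:
  assumes "rad_L2 q" "1 \<le> a"
  shows "set_integrable lborel {a..b} q"
proof -
  have "set_integrable lborel {a<..b} q"
    using rad_L2_tail(1)[OF assms] by (rule set_integrable_subset) auto
  moreover have "{a<..b} - {a..b} \<union> ({a..b} - {a<..b}) \<subseteq> {a}" by auto
  ultimately show ?thesis
    using set_integrable_discrete_difference[of "{a}" "{a<..b}" "{a..b}" lborel q] by simp
qed

lemma in_H_wderiv:
  assumes "in_H f g"
  shows "weak_deriv f (wderiv f)" "rad_L2 (wderiv f)" "rad_L2 g"
proof -
  obtain df where "weak_deriv f df \<and> set_integrable lborel {1<..} (\<lambda>r. (df r)\<^sup>2 * r\<^sup>2)"
    using assms by (auto simp: in_H_def)
  from someI[where P = "\<lambda>df. weak_deriv f df \<and> set_integrable lborel {1<..} (\<lambda>r. (df r)\<^sup>2 * r\<^sup>2)", OF this]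
  have *: "weak_deriv f (wderiv f) \<and> set_integrable lborel {1<..} (\<lambda>r. (wderiv f r)\<^sup>2 * r\<^sup>2)"
    unfolding wderiv_def .
  then show "weak_deriv f (wderiv f)" "rad_L2 (wderiv f)"
    by (auto simp: rad_L2_def weak_deriv_def)
  show "rad_L2 g" using assms by (auto simp: in_H_def rad_L2_def)
qed

text \<open>The representative of a finite-energy profile that is continuous and vanishes at infinity.\<close>

definition prof :: "(real \<Rightarrow> real) \<Rightarrow> real \<Rightarrow> real" where
  "prof f r = - (LBINT x:{r<..}. wderiv f x)"

lemma prof_split:
  assumes "rad_L2 (wderiv f)" "1 \<le> a" "a \<le> b"
  shows "prof f b = prof f a + (LBINT x:{a..b}. wderiv f x)"
proof -
  have "{a<..} = {a<..b} \<union> {b<..}" using assms by auto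
  moreover have "(LBINT x:{a<..b} \<union> {b<..}. wderiv f x) = (LBINT x:{a<..b}. wderiv f x) + (LBINT x:{b<..}. wderiv f x)"
  proof (rule set_integral_Un)
    show "set_integrable lborel {a<..b} (wderiv f)"
      using rad_L2_tail(1)[OF assms(1,2)] by (rule set_integrable_subset) auto
    show "set_integrable lborel {b<..} (wderiv f)"
      using rad_L2_tail(1)[OF assms(1)] assms by auto
  qed auto
  ultimately show ?thesis by (simp add: prof_def set_integral_Icc_Ioc(1))
qed

lemma prof_continuous:
  assumes "rad_L2 (wderiv f)" shows "continuous_on {1..} (prof f)"
proof -
  have "continuous_on {1..b} (prof f)" for b
  proof (rule continuous_on_eq)
    have "wderiv f integrable_on {1..b}"
      using set_borel_integral_eq_integral(1)[OF rad_L2_interval[OF assms]] by simp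
    then show "continuous_on {1..b} (\<lambda>r. prof f 1 + integral {1..r} (wderiv f))"
      by (intro continuous_intros indefinite_integral_continuous_1)
    show "prof f 1 + integral {1..r} (wderiv f) = prof f r" if "r \<in> {1..b}" for r
      using prof_split[OF assms, of 1 r] that set_borel_integral_eq_integral(2)[OF rad_L2_interval[OF assms, of 1 r]]
      by simp
  qed
  note c = this
  show ?thesis
    unfolding continuous_on_eq_continuous_within
  proof
    fix x :: real assume x: "x \<in> {1..}"
    have "at x within {1..} = at x within {1..x + 1}"
      by (rule at_within_nhd[of _ "{..<x + 1}"]) auto
    then show "continuous (at x within {1..}) (prof f)"
      using c[of "x + 1"] x unfolding continuous_on_eq_continuous_within by auto
  qed
qed

lemma prof_bound:
  assumes "rad_L2 (wderiv f)" "1 \<le> r"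
  shows "\<bar>prof f r\<bar> \<le> sqrt (rad_sq r (wderiv f)) / sqrt r"
  using rad_L2_tail(2)[OF assms] by (simp add: prof_def)

lemma AE_Ioi_1:
  fixes P :: "real \<Rightarrow> bool"
  assumes "\<And>a b. 1 < a \<Longrightarrow> AE x in lborel. x \<in> {a..b} \<longrightarrow> P x"
  shows "AE x in lborel. x \<in> {1<..} \<longrightarrow> P x"
proof -
  have "AE x in lborel. \<forall>n. x \<in> {1 + 1 / real (Suc n)..real n} \<longrightarrow> P x"
    unfolding AE_all_countable by (intro allI assms) simp
  then show ?thesis
  proof eventually_elim
    case (elim x)
    show ?case
    proof
      assume x: "x \<in> {1<..}"
      obtain n1 where n1: "1 / real (Suc n1) < x - 1" using x nat_approx_posE[of "x - 1"] by auto
      obtain n2 where n2: "x \<le> real n2" using real_arch_simple by blast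
      have "1 / real (Suc (max n1 n2)) \<le> 1 / real (Suc n1)" by (simp add: frac_le)
      then have "x \<in> {1 + 1 / real (Suc (max n1 n2))..real (max n1 n2)}" using n1 n2 by auto
      then show "P x" using elim by blast
    qed
  qed
qed

lemma Icc_subset_Ioi: "{a..b} \<subseteq> {l<..} \<longleftrightarrow> b < a \<or> l < (a::real)"
  by (cases "b < a") (auto simp: subset_iff)

lemma set_integrable_Icc_Ioi:
  fixes h :: "real \<Rightarrow> real"
  assumes "\<And>a b. l < a \<Longrightarrow> set_integrable lborel {a..b} h" "{a..b} \<subseteq> {l<..}"
  shows "set_integrable lborel {a..b} h"
  using assms by (cases "b < a") (auto simp: Icc_subset_Ioi)

lemma Ioi_interval: "open {l::real<..}" "{l::real<..} \<noteq> {}" "is_interval {l::real<..}"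
  by (auto simp: is_interval_1 gt_ex ex_in_conv[symmetric])

text \<open>\<open>f\<close> and \<open>prof f\<close> have the same weak derivative, so
  \<open>du_Bois_Reymond\<close> makes their difference constant.\<close>

lemma in_H_prof_aux:
  assumes fg: "in_H f g"
  obtains c where "\<And>a b. 1 < a \<Longrightarrow> AE x in lborel. x \<in> {a..b} \<longrightarrow> f x = c + prof f x"
proof -
  note wd = in_H_wderiv(1,2)[OF fg]
  have f: "set_integrable lborel {a..b} f" if "1 < a" for a b
    using wd(1) that by (auto simp: weak_deriv_def)
  have p: "set_integrable lborel {a..b} (prof f)" if "1 < a" for a b
    using that by (intro borel_integrable_atLeastAtMost' continuous_on_subset[OF prof_continuous[OF wd(2)]]) auto
  have z: "(LBINT x:{1<..}. (f x - prof f x) * deriv \<phi> x) = 0" if \<phi>: "test_fun {1<..} \<phi>" for \<phi>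
  proof -
    obtain a b where ab: "a < b" "{a..b} \<subseteq> {1<..}" "\<And>x. x \<notin> {a<..<b} \<Longrightarrow> \<phi> x = 0"
      using test_fun_support[OF \<phi> Ioi_interval] by metis
    have a: "1 < a" using ab by (auto simp: Icc_subset_Ioi)
    have d0: "deriv \<phi> x = 0" if "x \<notin> {a..b}" for x
      by (rule DERIV_imp_deriv, rule DERIV_zero_on_open[of "- {a..b}"]) (use that ab(3) in auto)
    have sm: "smooth_fun \<phi>" using \<phi> by (simp add: test_fun_def)
    have \<phi>ab: "\<phi> a = 0" "\<phi> b = 0" using ab by auto
    have sd: "set_integrable lborel {a..b} (deriv \<phi>)"
      by (intro set_integrable_continuous smooth_fun_continuous_on smooth_fun_deriv sm)
    have "1 \<le> a" "a \<le> b" using a ab by simp_all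
    note parts = integral_primitive_by_parts[OF rad_L2_interval[OF wd(2) \<open>1 \<le> a\<close>] sm \<phi>ab(2) \<open>a \<le> b\<close>]
    have "(LBINT x:{1<..}. prof f x * deriv \<phi> x) = (LBINT x:{a..b}. prof f x * deriv \<phi> x)"
      using ab d0 by (intro set_integral_support) auto
    also have "\<dots> = (LBINT r:{a..b}. prof f a * deriv \<phi> r + (LBINT x:{a..r}. wderiv f x) * deriv \<phi> r)"
    proof (intro set_lebesgue_integral_cong allI impI)
      fix r assume "r \<in> {a..b}"
      then have "prof f r = prof f a + (LBINT x:{a..r}. wderiv f x)"
        using a by (intro prof_split[OF wd(2)]) auto
      then show "prof f r * deriv \<phi> r = prof f a * deriv \<phi> r + (LBINT x:{a..r}. wderiv f x) * deriv \<phi> r"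
        by (simp add: distrib_right)
    qed simp
    also have "\<dots> = prof f a * (LBINT r:{a..b}. deriv \<phi> r) - (LBINT x:{a..b}. wderiv f x * \<phi> x)"
      by (subst set_integral_add(2)[OF set_integrable_mult_right[OF sd] parts(1)]) (simp add: parts(2))
    also have "\<dots> = - (LBINT x:{a..b}. wderiv f x * \<phi> x)"
      using set_integral_deriv[OF sm \<open>a \<le> b\<close>] \<phi>ab by simp
    also have "\<dots> = - (LBINT x:{1<..}. wderiv f x * \<phi> x)"
      using ab by (subst set_integral_support(1)[of "{a..b}" "{1<..}"]) auto
    also have "\<dots> = (LBINT x:{1<..}. f x * deriv \<phi> x)"
      using wd(1) \<phi> by (simp add: weak_deriv_def)
    finally have eq: "(LBINT x:{1<..}. prof f x * deriv \<phi> x) = (LBINT x:{1<..}. f x * deriv \<phi> x)" .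
    have "set_integrable lborel {1<..} (\<lambda>x. f x * deriv \<phi> x)" "set_integrable lborel {1<..} (\<lambda>x. prof f x * deriv \<phi> x)"
      by (rule set_integrable_test[OF set_integrable_Icc_Ioi[OF f] test_fun_deriv[OF \<phi>] Ioi_interval] 
          set_integrable_test[OF set_integrable_Icc_Ioi[OF p] test_fun_deriv[OF \<phi>] Ioi_interval]; simp)+
    then show ?thesis using eq by (simp add: left_diff_distrib)
  qed
  have i: "set_integrable lborel {a..b} (\<lambda>x. f x - prof f x)" if "{a..b} \<subseteq> {1<..}" for a b
    using set_integrable_Icc_Ioi[OF f that] set_integrable_Icc_Ioi[OF p that] by simp
  obtain c where c: "\<And>a b. {a..b} \<subseteq> {1<..} \<Longrightarrow> AE x in lborel. x \<in> {a..b} \<longrightarrow> f x - prof f x = c"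
    using du_Bois_Reymond[OF Ioi_interval i z] by blast
  show ?thesis
  proof (rule that)
    fix a b :: real assume "1 < a"
    then have "{a..b} \<subseteq> {1<..}" by auto
    from c[OF this] show "AE x in lborel. x \<in> {a..b} \<longrightarrow> f x = c + prof f x"
      by eventually_elim auto
  qed
qed

text \<open>The constant left by \<open>in_H_prof_aux\<close> is 0: since \<open>prof f\<close>
  vanishes at infinity, |f| would otherwise stay above |c|/2 far out, against the L^6 condition in
  \<open>in_H\<close>.\<close>

lemma in_H_prof:
  assumes fg: "in_H f g"
  shows "AE x in lborel. x \<in> {1<..} \<longrightarrow> f x = prof f x"
proof -
  obtain c where c: "\<And>a b. 1 < a \<Longrightarrow> AE x in lborel. x \<in> {a..b} \<longrightarrow> f x = c + prof f x"
    using in_H_prof_aux[OF fg] by metis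
  note wd = in_H_wderiv(1,2)[OF fg]
  have "c = 0"
  proof (rule ccontr)
    assume c0: "c \<noteq> 0"
    define E where "E = rad_sq 1 (wderiv f)"
    \<comment> \<open>Beyond this radius E / x <= c^2 / 4, that is, the decay bound of
      \<open>prof f\<close> is at most |c| / 2; the summand 2 keeps the radius inside the
      domain.\<close>
    define R where "R = 2 + 4 * E / c\<^sup>2"
    have R: "R \<ge> 2" by (simp add: R_def E_def)
    have small: "\<bar>prof f x\<bar> \<le> \<bar>c\<bar> / 2" if "R \<le> x" for x
    proof -
      have x: "1 \<le> x" using that R by simp
      have "\<bar>prof f x\<bar>\<^sup>2 \<le> (sqrt (rad_sq x (wderiv f)) / sqrt x)\<^sup>2"
        using prof_bound[OF wd(2) x] by (intro power_mono) auto
      also have "\<dots> = rad_sq x (wderiv f) / x" using x by (simp add: power_divide)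
      also have "\<dots> \<le> E / x" using rad_sq_antimono[OF wd(2) _ x] x by (auto simp: E_def intro!: divide_right_mono)
      also have "\<dots> \<le> c\<^sup>2 / 4"
      proof -
        have "4 * E / c\<^sup>2 \<le> x" using that by (simp add: R_def)
        then show ?thesis using c0 x by (simp add: field_simps)
      qed
      also have "\<dots> = (\<bar>c\<bar> / 2)\<^sup>2" by (simp add: power_divide)
      finally show ?thesis by (rule power2_le_imp_le) simp
    qed
    define I where "I = (LBINT r:{1<..}. \<bar>f r\<bar> ^ 6 * r\<^sup>2)"
    have f6: "set_integrable lborel {1<..} (\<lambda>r. \<bar>f r\<bar> ^ 6 * r\<^sup>2)" using fg by (simp add: in_H_def)
    have "(\<bar>c\<bar> / 2) ^ 6 * real n \<le> I" for n
    proof -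
      have "(\<bar>c\<bar> / 2) ^ 6 * real n = (LBINT r:{R..R + real n}. (\<bar>c\<bar> / 2) ^ 6)"
        by (simp add: set_integral_const)
      also have "\<dots> = (\<integral>r. indicator {R..R + real n} r *\<^sub>R ((\<bar>c\<bar> / 2) ^ 6) \<partial>lborel)"
        by (simp add: set_lebesgue_integral_def)
      also have "\<dots> \<le> I"
        unfolding I_def set_lebesgue_integral_def
      proof (rule integral_mono_AE)
        show "integrable lborel (\<lambda>r. indicator {R..R + real n} r *\<^sub>R ((\<bar>c\<bar> / 2) ^ 6))" by auto
        show "integrable lborel (\<lambda>r. indicator {1<..} r *\<^sub>R (\<bar>f r\<bar> ^ 6 * r\<^sup>2))"
          using f6 by (simp add: set_integrable_def)
        have "AE r in lborel. r \<in> {R..R + real n} \<longrightarrow> f r = c + prof f r" using R by (intro c) simp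
        then show "AE r in lborel. indicator {R..R + real n} r *\<^sub>R ((\<bar>c\<bar> / 2) ^ 6) \<le> indicator {1<..} r *\<^sub>R (\<bar>f r\<bar> ^ 6 * r\<^sup>2)"
        proof eventually_elim
          case (elim r)
          show ?case
          proof (cases "r \<in> {R..R + real n}")
            case True
            then have "\<bar>c\<bar> / 2 \<le> \<bar>f r\<bar>" using elim small[of r] by (auto simp: abs_if split: if_splits)
            then have "(\<bar>c\<bar> / 2) ^ 6 * 1 \<le> \<bar>f r\<bar> ^ 6 * r\<^sup>2"
              using True R by (intro mult_mono power_mono one_le_power) auto
            then show ?thesis using True R by simp
          qed auto
        qed
      qed
      finally show ?thesis .
    qed
    moreover obtain n where "I / (\<bar>c\<bar> / 2) ^ 6 < real n" using reals_Archimedean2 by blast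
    ultimately show False using c0 by (simp add: field_simps not_le[symmetric])
  qed
  then show ?thesis using c by (intro AE_Ioi_1) simp
qed

lemma H_dist_bounds:
  assumes "in_H f g" "in_H f' g'"
  shows "sqrt (rad_sq 1 (\<lambda>r. wderiv f r - wderiv f' r)) \<le> H_dist (f, g) (f', g')"
    and "sqrt (rad_sq 1 (\<lambda>r. g r - g' r)) \<le> H_dist (f, g) (f', g')"
proof -
  have eq: "H_dist (f, g) (f', g') = sqrt (4 * pi * (rad_sq 1 (\<lambda>r. wderiv f r - wderiv f' r) + rad_sq 1 (\<lambda>r. g r - g' r)))"
    by (simp add: H_dist_def rad_sq_def)
  have "1 * (a + b) \<le> 4 * pi * (a + b)" if "0 \<le> a" "0 \<le> b" for a b :: real
    using that pi_gt3 by (intro mult_right_mono) auto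
  then have "rad_sq 1 (\<lambda>r. wderiv f r - wderiv f' r) + rad_sq 1 (\<lambda>r. g r - g' r)
      \<le> 4 * pi * (rad_sq 1 (\<lambda>r. wderiv f r - wderiv f' r) + rad_sq 1 (\<lambda>r. g r - g' r))"
    by simp
  then show "sqrt (rad_sq 1 (\<lambda>r. wderiv f r - wderiv f' r)) \<le> H_dist (f, g) (f', g')"
    "sqrt (rad_sq 1 (\<lambda>r. g r - g' r)) \<le> H_dist (f, g) (f', g')"
    unfolding eq real_sqrt_le_iff
    using rad_sq_nonneg[of 1 "\<lambda>r. wderiv f r - wderiv f' r"] rad_sq_nonneg[of 1 "\<lambda>r. g r - g' r"] by linarith+
qed

text \<open>Closeness in H is uniform closeness of the continuous representatives, with decay
  r^(-1/2). The proof integrates the difference of \<open>wderiv f\<close> and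
  \<open>wderiv f'\<close>, because these representatives, chosen by \<open>SOME\<close>, are what
  \<open>H_dist\<close> subtracts.\<close>

lemma prof_diff_bound:
  assumes "in_H f g" "in_H f' g'" "1 \<le> r"
  shows "\<bar>prof f r - prof f' r\<bar> \<le> H_dist (f, g) (f', g') / sqrt r"
proof -
  note wd = in_H_wderiv(2)[OF assms(1)] in_H_wderiv(2)[OF assms(2)]
  note d = rad_L2_diff[OF wd]
  have "prof f r - prof f' r = - (LBINT x:{r<..}. wderiv f x - wderiv f' x)"
    using rad_L2_tail(1)[OF wd(1) assms(3)] rad_L2_tail(1)[OF wd(2) assms(3)] by (simp add: prof_def)
  then have "\<bar>prof f r - prof f' r\<bar> \<le> sqrt (rad_sq r (\<lambda>x. wderiv f x - wderiv f' x)) / sqrt r"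
    using rad_L2_tail(2)[OF d assms(3)] by simp
  also have "\<dots> \<le> H_dist (f, g) (f', g') / sqrt r"
    using H_dist_bounds(1)[OF assms(1,2)] rad_sq_antimono[OF d _ assms(3)] assms(3)
    by (intro divide_right_mono) (auto intro: order_trans real_sqrt_le_mono)
  finally show ?thesis .
qed

section \<open>From weak to classical derivatives\<close>

lemma zero_of_interval_integrals:
  fixes g :: "real \<Rightarrow> real"
  assumes g: "continuous_on {a..b} g" and z: "\<And>x. x \<in> {a..b} \<Longrightarrow> (LBINT y:{a..x}. g y) = 0"
    and t: "t \<in> {a<..<b}"
  shows "g t = 0"
proof -
  have "((\<lambda>x. integral {a..x} g) has_real_derivative g t) (at t within {a..b})"
    using g t by (intro integral_has_real_derivative) auto
  then have "((\<lambda>x. integral {a..x} g) has_real_derivative g t) (at t)"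
    using t at_within_Icc_at[of a t b] by simp
  moreover have "\<forall>\<^sub>F x in nhds t. integral {a..x} g = 0"
  proof -
    have "integral {a..x} g = 0" if "x \<in> {a<..<b}" for x
    proof -
      have "set_integrable lborel {a..x} g"
        using that by (intro borel_integrable_atLeastAtMost' continuous_on_subset[OF g]) auto
      from set_borel_integral_eq_integral(2)[OF this] z[of x] that show ?thesis by simp
    qed
    then show ?thesis using t by (auto simp: eventually_nhds intro!: exI[of _ "{a<..<b}"])
  qed
  ultimately have "((\<lambda>x. 0) has_real_derivative g t) (at t)"
    by (subst (asm) DERIV_cong_ev[OF refl _ refl]) auto
  then show ?thesis using DERIV_unique[OF _ DERIV_const] by blast
qed

text \<open>On a small interval \<open>f\<close> minus a primitive of \<open>w\<close> has weak
  derivative 0, hence is constant, and the primitive is differentiable because \<open>w\<close> is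
  continuous. This is applied in t to the moments and in r to v = r u.\<close>

lemma weak_derivative_classical:
  fixes f w :: "real \<Rightarrow> real"
  assumes S: "open S" "is_interval S" and t: "t \<in> S"
    and f: "continuous_on S f" and w: "continuous_on S w"
    and weak: "\<And>\<phi>. test_fun S \<phi> \<Longrightarrow> (LBINT x:S. f x * deriv \<phi> x) = - (LBINT x:S. w x * \<phi> x)"
  shows "(f has_real_derivative w t) (at t)"
proof -
  obtain e where e: "e > 0" "cball t e \<subseteq> S" using S(1) t by (meson open_contains_cball)
  define a b where "a = t - e" and "b = t + e"
  have ab: "a < t" "t < b" "{a..b} \<subseteq> S" using e by (auto simp: a_def b_def cball_eq_atLeastAtMost)
  have fab: "continuous_on {a..b} f" and wab: "continuous_on {a..b} w"
    using f w ab(3) continuous_on_subset by blast+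
  have wi: "set_integrable lborel {a..x} w" if "x \<le> b" for x
    using that by (intro borel_integrable_atLeastAtMost' continuous_on_subset[OF wab]) auto
  define W where "W x = (LBINT y:{a..x}. w y)" for x
  have Weq: "W x = integral {a..x} w" if "x \<le> b" for x
    using set_borel_integral_eq_integral(2)[OF wi[OF that]] by (simp add: W_def)
  have Wc: "continuous_on {a..b} W"
    by (rule continuous_on_eq[OF indefinite_integral_continuous_1[OF integrable_continuous_interval[OF wab]]])
      (auto simp: Weq)
  have Wd: "(W has_real_derivative w x) (at x)" if x: "x \<in> {a<..<b}" for x
  proof -
    have "((\<lambda>x. integral {a..x} w) has_real_derivative w x) (at x within {a..b})"
      using wab x by (intro integral_has_real_derivative) auto
    then have "((\<lambda>x. integral {a..x} w) has_real_derivative w x) (at x)"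
      using x at_within_Icc_at[of a x b] by simp
    moreover have "\<forall>\<^sub>F y in nhds x. integral {a..y} w = W y"
      using x Weq by (auto simp: eventually_nhds intro!: exI[of _ "{a<..<b}"])
    ultimately show ?thesis by (subst (asm) DERIV_cong_ev[OF refl _ refl]) auto
  qed
  define h where "h x = f x - W x" for x
  have hc: "continuous_on {a..b} h" unfolding h_def by (intro continuous_intros fab Wc)
  have T: "open {a<..<b}" "{a<..<b} \<noteq> {}" "is_interval {a<..<b}"
    using ab by (auto simp: is_interval_1)
  have hi: "set_integrable lborel {x..y} h" if "{x..y} \<subseteq> {a<..<b}" for x y
    using that by (intro borel_integrable_atLeastAtMost' continuous_on_subset[OF hc]) auto
  have hz: "(LBINT x:{a<..<b}. h x * deriv \<phi> x) = 0" if \<phi>: "test_fun {a<..<b} \<phi>" for \<phi>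
  proof -
    have sm: "smooth_fun \<phi>" and \<phi>S: "test_fun S \<phi>"
      using test_fun_smooth[OF \<phi>] test_fun_mono[OF \<phi> order_trans[OF _ ab(3)]]
      by (auto simp: greaterThanLessThan_subseteq_atLeastAtMost_iff)
    obtain K where K: "K \<subseteq> {a<..<b}" "\<forall>x. x \<notin> K \<longrightarrow> deriv \<phi> x = 0"
      using test_fun_deriv[OF \<phi>] by (auto simp: test_fun_def)
    obtain L where L: "L \<subseteq> {a<..<b}" "\<forall>x. x \<notin> L \<longrightarrow> \<phi> x = 0"
      using \<phi> by (auto simp: test_fun_def)
    have \<phi>b: "\<phi> b = 0" using L by auto
    have "a \<le> b" using ab by simp
    note parts = integral_primitive_by_parts[OF wi[OF order_refl] sm \<phi>b \<open>a \<le> b\<close>, folded W_def]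
    have fi: "set_integrable lborel {a..b} (\<lambda>x. f x * deriv \<phi> x)"
      by (intro borel_integrable_atLeastAtMost' continuous_intros fab smooth_fun_continuous_on smooth_fun_deriv sm)
    have "(LBINT x:{a<..<b}. h x * deriv \<phi> x) = (LBINT x:{a..b}. h x * deriv \<phi> x)"
      by (rule set_integral_Icc_Ioc(2)[symmetric])
    also have "\<dots> = (LBINT x:{a..b}. f x * deriv \<phi> x) - (LBINT x:{a..b}. W x * deriv \<phi> x)"
      unfolding h_def left_diff_distrib by (rule set_integral_diff(2)[OF fi parts(1)])
    also have "(LBINT x:{a..b}. f x * deriv \<phi> x) = (LBINT x:S. f x * deriv \<phi> x)"
      using K ab by (intro set_integral_support(1)[symmetric]) auto
    also have "\<dots> = - (LBINT x:S. w x * \<phi> x)" by (rule weak[OF \<phi>S])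
    also have "(LBINT x:S. w x * \<phi> x) = (LBINT x:{a..b}. w x * \<phi> x)"
      using L ab by (intro set_integral_support(1)) auto
    finally show ?thesis using parts(2) by simp
  qed
  obtain c where c: "\<And>x y. {x..y} \<subseteq> {a<..<b} \<Longrightarrow> (LBINT r:{x..y}. h r - c) = 0"
    using du_Bois_Reymond[OF T hi hz] by blast
  have hcst: "h x = c" if x: "x \<in> {a<..<b}" for x
  proof -
    define l r where "l = (a + x) / 2" and "r = (x + b) / 2"
    have lr: "a < l" "l < x" "x < r" "r < b" using x by (auto simp: l_def r_def)
    have "h x - c = 0"
    proof (rule zero_of_interval_integrals[of l r "\<lambda>x. h x - c" x])
      show "continuous_on {l..r} (\<lambda>x. h x - c)"
        using lr by (intro continuous_intros continuous_on_subset[OF hc]) auto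
      show "(LBINT y:{l..z}. h y - c) = 0" if "z \<in> {l..r}" for z
        using lr that by (intro c) auto
    qed (use lr in auto)
    then show ?thesis by simp
  qed
  have "((\<lambda>x. c + W x) has_real_derivative w t) (at t)"
    using Wd[of t] ab by (auto intro!: derivative_eq_intros)
  moreover have "\<forall>\<^sub>F x in nhds t. f x = c + W x"
    using hcst ab by (auto simp: eventually_nhds h_def algebra_simps intro!: exI[of _ "{a<..<b}"])
  ultimately show ?thesis by (subst DERIV_cong_ev[OF refl _ refl]) auto
qed

lemma Ioi_integrable_compact:
  fixes f :: "real \<Rightarrow> real"
  assumes "continuous_on {1..} f" "\<And>x. b < x \<Longrightarrow> f x = 0"
  shows "set_integrable lborel {1<..} f"
proof -
  have "set_integrable lborel {1..b} f"
    by (intro borel_integrable_atLeastAtMost' continuous_on_subset[OF assms(1)]) auto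
  then have 1: "set_integrable lborel {1<..b} f" by (rule set_integrable_subset) auto
  have "(\<lambda>x. indicator {1<..} x *\<^sub>R f x) = (\<lambda>x. indicator {1<..b} x *\<^sub>R f x)"
    using assms(2) by (auto simp: indicator_def fun_eq_iff)
  with 1 show ?thesis by (simp add: set_integrable_def)
qed

lemma test_fun_bound:
  assumes "test_fun S \<phi>"
  obtains b where "1 < b" "\<And>x. b < x \<Longrightarrow> \<phi> x = 0" "\<And>x. x < - b \<Longrightarrow> \<phi> x = 0"
proof -
  obtain K where K: "compact K" "\<forall>x. x \<notin> K \<longrightarrow> \<phi> x = 0" using assms by (auto simp: test_fun_def)
  obtain b where b: "\<forall>x\<in>K. \<bar>x\<bar> \<le> b" using compact_imp_bounded[OF K(1)] by (auto simp: bounded_iff)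
  have *: "\<phi> x = 0" if "max b 2 < \<bar>x\<bar>" for x using that b K(2) by (metis max.strict_boundedE not_le)
  show ?thesis
  proof (rule that[of "max b 2"])
    show "\<phi> x = 0" if "max b 2 < x" for x using that by (intro *) linarith
    show "\<phi> x = 0" if "x < - max b 2" for x using that by (intro *) linarith
  qed simp
qed

lemma abs_power5_diff:
  fixes x y M :: real
  assumes "\<bar>x\<bar> \<le> M" "\<bar>y\<bar> \<le> M"
  shows "\<bar>x ^ 5 - y ^ 5\<bar> \<le> 5 * M ^ 4 * \<bar>x - y\<bar>"
proof -
  have "x ^ 5 - y ^ 5 = (x - y) * (\<Sum>i<5. y ^ (5 - Suc i) * x ^ i)"
    by (rule power_diff_sumr2)
  moreover have "\<bar>\<Sum>i<5. y ^ (5 - Suc i) * x ^ i\<bar> \<le> (\<Sum>i<5::nat. M ^ 4)"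
  proof (rule order_trans[OF sum_abs sum_mono])
    fix i :: nat assume "i \<in> {..<5}"
    then have "M ^ 4 = M ^ (5 - Suc i) * M ^ i" by (simp flip: power_add)
    then show "\<bar>y ^ (5 - Suc i) * x ^ i\<bar> \<le> M ^ 4"
      using assms by (auto simp: abs_mult power_abs intro!: mult_mono power_mono)
  qed
  ultimately show ?thesis
    by (simp add: abs_mult) (metis abs_ge_zero mult.commute mult_left_mono)
qed

subsection \<open>Solutions with precompact trajectory\<close>

locale compact_solution =
  fixes u0 u1 :: "real \<Rightarrow> real" and U0 U1 :: "real \<Rightarrow> real \<Rightarrow> real"
  assumes sol: "global_solution u0 u1 U0 U1" and precomp: "precompact_traj U0 U1"
begin

abbreviation ur :: "real \<Rightarrow> real \<Rightarrow> real" where "ur t \<equiv> wderiv (U0 t)"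

definition u :: "real \<Rightarrow> real \<Rightarrow> real" where "u t = prof (U0 t)"

definition tail :: "real \<Rightarrow> real \<Rightarrow> real" where "tail t R = rad_sq R (ur t) + rad_sq R (U1 t)"

definition dH :: "real \<Rightarrow> real \<Rightarrow> real" where "dH s t = H_dist (U0 s, U1 s) (U0 t, U1 t)"

lemma inH: "in_H (U0 t) (U1 t)"
  using sol by (simp add: global_solution_def)

lemmas radL2 = in_H_wderiv(2,3)[OF inH]

lemma u_AE: "AE r in lborel. r \<in> {1<..} \<longrightarrow> U0 t r = u t r"
  unfolding u_def by (rule in_H_prof[OF inH])

lemma dH_tendsto: "((\<lambda>s. dH s t) \<longlongrightarrow> 0) (at t)"
  using sol by (simp add: global_solution_def dH_def)

lemma dH_nonneg: "0 \<le> dH s t"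
  using H_dist_bounds(1)[OF inH[of s] inH[of t]] unfolding dH_def
  by (meson order_trans rad_sq_nonneg real_sqrt_ge_zero)

text \<open>All continuity in time comes from continuity of the trajectory in H, through bounds of
  this shape.\<close>

lemma continuous_of_dH_bound:
  assumes "\<And>s t. \<bar>f s - f t\<bar> \<le> K * dH s t"
  shows "continuous_on UNIV (f :: real \<Rightarrow> real)"
  unfolding continuous_on_eq_continuous_at[OF open_UNIV] isCont_def
proof
  fix t
  have "((\<lambda>s. f s - f t) \<longlongrightarrow> 0) (at t)"
  proof (rule Lim_null_comparison)
    show "\<forall>\<^sub>F s in at t. norm (f s - f t) \<le> K * dH s t" using assms by simp
    show "((\<lambda>s. K * dH s t) \<longlongrightarrow> 0) (at t)" using tendsto_mult_right_zero[OF dH_tendsto] by simp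
  qed
  then show "f \<midarrow>t\<rightarrow> f t" by (simp add: LIM_zero_iff)
qed

lemma u_continuous: "continuous_on {1..} (u t)"
  unfolding u_def by (rule prof_continuous[OF radL2(1)])

lemma tail_nonneg: "0 \<le> tail t R"
  by (simp add: tail_def)

lemma tail_antimono: "1 \<le> R \<Longrightarrow> R \<le> R' \<Longrightarrow> tail t R' \<le> tail t R"
  unfolding tail_def by (intro add_mono rad_sq_antimono radL2)

lemma u_bound:
  assumes "1 \<le> r" shows "\<bar>u t r\<bar> \<le> sqrt (tail t r) / sqrt r"
proof -
  have "\<bar>u t r\<bar> \<le> sqrt (rad_sq r (ur t)) / sqrt r"
    unfolding u_def by (rule prof_bound[OF radL2(1) assms])
  also have "\<dots> \<le> sqrt (tail t r) / sqrt r"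
    using assms by (intro divide_right_mono real_sqrt_le_mono) (auto simp: tail_def)
  finally show ?thesis .
qed

lemma u_diff_bound: "1 \<le> r \<Longrightarrow> \<bar>u s r - u t r\<bar> \<le> dH s t / sqrt r"
  unfolding u_def dH_def by (rule prof_diff_bound[OF inH inH])

text \<open>The triangle inequality, squared at the cost of a factor 2, transfers smallness of the
  tails of one fixed limit profile to all points of the trajectory near it.\<close>

lemma tail_le_limit:
  assumes "in_H f g" "1 \<le> R"
  shows "tail t R \<le> 4 * (H_dist (U0 t, U1 t) (f, g))\<^sup>2 + 2 * (rad_sq R (wderiv f) + rad_sq R g)"
proof -
  note fg = in_H_wderiv(2,3)[OF assms(1)]
  have *: "rad_sq R q \<le> d\<^sup>2" if "sqrt (rad_sq 1 q) \<le> d" "rad_L2 q" for q d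
  proof -
    have "rad_sq R q \<le> rad_sq 1 q" using rad_sq_antimono[OF that(2) _ assms(2)] by simp
    also have "\<dots> \<le> d\<^sup>2" by (rule sqrt_le_D[OF that(1)])
    finally show ?thesis .
  qed
  have "rad_sq R (\<lambda>r. ur t r - wderiv f r) \<le> (H_dist (U0 t, U1 t) (f, g))\<^sup>2"
    "rad_sq R (\<lambda>r. U1 t r - g r) \<le> (H_dist (U0 t, U1 t) (f, g))\<^sup>2"
    by (intro * H_dist_bounds[OF inH assms(1)] rad_L2_diff radL2 fg)+
  moreover have "rad_sq R (ur t) \<le> 2 * rad_sq R (\<lambda>r. ur t r - wderiv f r) + 2 * rad_sq R (wderiv f)"
    "rad_sq R (U1 t) \<le> 2 * rad_sq R (\<lambda>r. U1 t r - g r) + 2 * rad_sq R g"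
    by (intro rad_sq_triangle radL2 fg assms)+
  moreover have "a \<le> 2 * x + 2 * p \<Longrightarrow> b \<le> 2 * y + 2 * q \<Longrightarrow> x \<le> h \<Longrightarrow> y \<le> h \<Longrightarrow> a + b \<le> 4 * h + 2 * (p + q)"
    for a b x y p q h :: real by argo
  ultimately show ?thesis unfolding tail_def by blast
qed

section \<open>Uniform energy bounds from precompactness\<close>

lemma subsequence_limit:
  fixes s :: "nat \<Rightarrow> real"
  obtains \<sigma> f g where "strict_mono \<sigma>" "in_H f g"
    "(\<lambda>k. (H_dist (U0 (s (\<sigma> k)), U1 (s (\<sigma> k))) (f, g))\<^sup>2) \<longlonglongrightarrow> 0"
proof -
  obtain \<sigma> f g where *: "strict_mono \<sigma>" "in_H f g"
    "(\<lambda>k. H_dist (U0 (s (\<sigma> k)), U1 (s (\<sigma> k))) (f, g)) \<longlonglongrightarrow> 0"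
    using precomp[unfolded precompact_traj_def, rule_format, of s] by blast
  have "(\<lambda>k. (H_dist (U0 (s (\<sigma> k)), U1 (s (\<sigma> k))) (f, g))\<^sup>2) \<longlonglongrightarrow> 0"
    using tendsto_power[OF *(3), of 2] by simp
  with * show ?thesis by (intro that)
qed

lemma tail_bounded: obtains C where "C > 0" "\<And>t r. 1 \<le> r \<Longrightarrow> tail t r \<le> C"
proof -
  have "\<exists>C. \<forall>t. tail t 1 \<le> C"
  proof (rule ccontr)
    assume "\<nexists>C. \<forall>t. tail t 1 \<le> C"
    then have "\<forall>n::nat. \<exists>t. real n < tail t 1" by (meson not_le)
    then obtain s where s: "\<And>n::nat. real n < tail (s n) 1" by metis
    obtain \<sigma> f g where \<sigma>: "strict_mono \<sigma>" "in_H f g"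
      "(\<lambda>k. (H_dist (U0 (s (\<sigma> k)), U1 (s (\<sigma> k))) (f, g))\<^sup>2) \<longlonglongrightarrow> 0"
      by (rule subsequence_limit)
    define D where "D = 2 * (rad_sq 1 (wderiv f) + rad_sq 1 g)"
    have "\<forall>\<^sub>F k in sequentially. (H_dist (U0 (s (\<sigma> k)), U1 (s (\<sigma> k))) (f, g))\<^sup>2 < 1"
      using order_tendstoD(2)[OF \<sigma>(3)] by simp
    moreover have "\<forall>\<^sub>F k in sequentially. 4 + D \<le> real k"
      using filterlim_real_sequentially unfolding filterlim_at_top by blast
    ultimately have "\<forall>\<^sub>F k in sequentially. False"
    proof eventually_elim
      case (elim k)
      have "real k \<le> real (\<sigma> k)" using \<sigma>(1) by (simp add: seq_suble)
      also have "\<dots> < tail (s (\<sigma> k)) 1" by (rule s)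
      also have "\<dots> \<le> 4 * (H_dist (U0 (s (\<sigma> k)), U1 (s (\<sigma> k))) (f, g))\<^sup>2 + D"
        unfolding D_def by (rule tail_le_limit[OF \<sigma>(2)]) simp
      finally show False using elim by linarith
    qed
    then show False by simp
  qed
  then obtain C where C: "\<And>t. tail t 1 \<le> C" by blast
  show ?thesis
  proof (rule that[of "\<bar>C\<bar> + 1"])
    fix t r :: real assume "1 \<le> r"
    then show "tail t r \<le> \<bar>C\<bar> + 1" using tail_antimono[of 1 r t] C[of t] by linarith
  qed simp
qed

text \<open>Were the tails not uniformly small, there would be times \<open>s n\<close> with energy
  above \<epsilon> beyond radius n + 1; along a convergent subsequence these are dominated by the
  tails of the limit profile, which tend to 0.\<close>

lemma tail_uniform:
  assumes "\<epsilon> > 0" obtains R where "R \<ge> 1" "\<And>t r. R \<le> r \<Longrightarrow> tail t r \<le> \<epsilon>"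
proof -
  have "\<exists>R\<ge>1. \<forall>t. tail t R \<le> \<epsilon>"
  proof (rule ccontr)
    assume "\<not> (\<exists>R\<ge>1. \<forall>t. tail t R \<le> \<epsilon>)"
    then have "\<exists>t. \<epsilon> < tail t (real n + 1)" for n :: nat
      by (metis le_add_same_cancel2 not_le of_nat_0_le_iff)
    then obtain s where s: "\<And>n::nat. \<epsilon> < tail (s n) (real n + 1)" by metis
    obtain \<sigma> f g where \<sigma>: "strict_mono \<sigma>" "in_H f g"
      "(\<lambda>k. (H_dist (U0 (s (\<sigma> k)), U1 (s (\<sigma> k))) (f, g))\<^sup>2) \<longlonglongrightarrow> 0"
      by (rule subsequence_limit)
    note fg = in_H_wderiv(2,3)[OF \<sigma>(2)]
    let ?X = "\<lambda>k. 4 * (H_dist (U0 (s (\<sigma> k)), U1 (s (\<sigma> k))) (f, g))\<^sup>2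
       + 2 * (rad_sq (real (\<sigma> k) + 1) (wderiv f) + rad_sq (real (\<sigma> k) + 1) g)"
    have "?X \<longlonglongrightarrow> 4 * 0 + 2 * (0 + 0)"
      using LIMSEQ_subseq_LIMSEQ[OF rad_sq_tendsto_0[OF fg(1)] \<sigma>(1)]
        LIMSEQ_subseq_LIMSEQ[OF rad_sq_tendsto_0[OF fg(2)] \<sigma>(1)]
      by (intro tendsto_intros \<sigma>(3)) (simp_all add: comp_def)
    then have "\<forall>\<^sub>F k in sequentially. ?X k < \<epsilon>"
      using order_tendstoD(2)[of ?X _ sequentially \<epsilon>] assms by simp
    then obtain k where "?X k < \<epsilon>" using eventually_happens by fastforce
    moreover have "tail (s (\<sigma> k)) (real (\<sigma> k) + 1) \<le> ?X k" by (rule tail_le_limit[OF \<sigma>(2)]) simp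
    ultimately show False using s[of "\<sigma> k"] by linarith
  qed
  then obtain R where "R \<ge> 1" "\<And>t. tail t R \<le> \<epsilon>" by blast
  then show ?thesis by (intro that[of R]) (auto intro: order_trans[OF tail_antimono])
qed

lemma u_bounded: obtains C where "C > 0" "\<And>t r. 1 \<le> r \<Longrightarrow> \<bar>u t r\<bar> \<le> C / sqrt r"
proof -
  obtain C where C: "C > 0" "\<And>t r. 1 \<le> r \<Longrightarrow> tail t r \<le> C" by (rule tail_bounded) blast
  show ?thesis
  proof (rule that[of "sqrt C"])
    fix t r :: real assume r: "1 \<le> r"
    show "\<bar>u t r\<bar> \<le> sqrt C / sqrt r"
      using r C by (intro order_trans[OF u_bound[OF r]] divide_right_mono real_sqrt_le_mono) auto
  qed (use C in simp)
qed

lemma u_small: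
  assumes "\<epsilon> > 0" obtains R where "R \<ge> 1" "\<And>t r. R \<le> r \<Longrightarrow> \<bar>u t r\<bar> \<le> \<epsilon> / sqrt r"
proof -
  obtain R where R: "R \<ge> 1" "\<And>t r. R \<le> r \<Longrightarrow> tail t r \<le> \<epsilon>\<^sup>2"
    using tail_uniform[of "\<epsilon>\<^sup>2"] assms by auto
  show ?thesis
  proof (rule that[OF R(1)])
    fix t r :: real assume r: "R \<le> r"
    then have r1: "1 \<le> r" using R by simp
    show "\<bar>u t r\<bar> \<le> \<epsilon> / sqrt r"
      using r1 R(2)[OF r, of t] assms
      by (intro order_trans[OF u_bound[OF r1]] divide_right_mono) (auto intro: real_le_lsqrt)
  qed
qed

subsection \<open>Time derivatives of the moments\<close>

text \<open>\<open>mA\<close>, \<open>mB\<close> and \<open>mN\<close> are the spatial integrals in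
  the weak formulation of \<open>global_solution\<close>, with \<open>b\<close> free at r = 1; the
  Neumann condition is hidden in \<open>mN\<close>.\<close>

definition mA :: "(real \<Rightarrow> real) \<Rightarrow> real \<Rightarrow> real" where
  "mA b t = (LBINT r:{1<..}. U0 t r * b r * r\<^sup>2)"
definition mB :: "(real \<Rightarrow> real) \<Rightarrow> real \<Rightarrow> real" where
  "mB b t = (LBINT r:{1<..}. U1 t r * b r * r\<^sup>2)"
definition mN :: "(real \<Rightarrow> real) \<Rightarrow> real \<Rightarrow> real" where
  "mN b t = (LBINT r:{1<..}. (- ur t r * deriv b r + (U0 t r) ^ 5 * b r) * r\<^sup>2)"

end

lemma set_integral_translate:
  fixes f :: "real \<Rightarrow> real"
  shows "(LBINT r:{c + T<..}. f (r - T)) = (LBINT r:{c<..}. f r)"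
    and "set_integrable lborel {c + T<..} (\<lambda>r. f (r - T)) \<longleftrightarrow> set_integrable lborel {c<..} f"
proof -
  have eq: "indicator {c + T<..} (T + 1 * r) *\<^sub>R f (T + 1 * r - T) = indicator {c<..} r *\<^sub>R f r" for r
    by (auto simp: indicator_def)
  show "(LBINT r:{c + T<..}. f (r - T)) = (LBINT r:{c<..}. f r)"
    unfolding set_lebesgue_integral_def
    by (subst lborel_integral_real_affine[where c = 1 and t = T]) (auto intro!: Bochner_Integration.integral_cong simp: indicator_def)
  show "set_integrable lborel {c + T<..} (\<lambda>r. f (r - T)) \<longleftrightarrow> set_integrable lborel {c<..} f"
    unfolding set_integrable_def
    by (subst lborel_integrable_real_affine_iff[where c = 1 and t = T, symmetric]) (simp, simp only: eq)
qed

context compact_solution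
begin

lemma set_integral_AE_u:
  assumes "(\<lambda>r. indicator {1<..} r *\<^sub>R f r (U0 t r)) \<in> borel_measurable lborel"
    and "set_integrable lborel {1<..} (\<lambda>r. f r (u t r) :: real)"
  shows "(LBINT r:{1<..}. f r (U0 t r)) = (LBINT r:{1<..}. f r (u t r))"
    and "set_integrable lborel {1<..} (\<lambda>r. f r (U0 t r))"
proof -
  have ae: "AE r in lborel. indicator {1<..} r *\<^sub>R f r (u t r) = indicator {1<..} r *\<^sub>R f r (U0 t r)"
    using u_AE[of t] by eventually_elim (auto simp: indicator_def)
  show "(LBINT r:{1<..}. f r (U0 t r)) = (LBINT r:{1<..}. f r (u t r))"
    unfolding set_lebesgue_integral_def using ae assms
    by (intro integral_cong_AE) (auto simp: set_integrable_def elim: AE_mp)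
  show "set_integrable lborel {1<..} (\<lambda>r. f r (U0 t r))"
    using integrable_cong_AE_imp[OF _ assms(1) ae] assms(2) by (simp add: set_integrable_def)
qed

lemma U0_measurable: "U0 t \<in> borel_measurable borel"
  using inH[of t] by (simp add: in_H_def)

lemma continuous_on_u_mult:
  assumes "continuous_on UNIV m"
  shows "continuous_on {1..} (\<lambda>r. (u t r) ^ k * m r)"
  by (intro continuous_intros u_continuous continuous_on_subset[OF assms]) auto

lemma moment_u:
  fixes m :: "real \<Rightarrow> real"
  assumes m: "continuous_on UNIV m" "\<And>r. b < r \<Longrightarrow> m r = 0"
  shows "set_integrable lborel {1<..} (\<lambda>r. (u t r) ^ k * m r)"
    and "set_integrable lborel {1<..} (\<lambda>r. (U0 t r) ^ k * m r)"
    and "(LBINT r:{1<..}. (U0 t r) ^ k * m r) = (LBINT r:{1<..}. (u t r) ^ k * m r)"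
proof -
  show i: "set_integrable lborel {1<..} (\<lambda>r. (u t r) ^ k * m r)"
    using m by (intro Ioi_integrable_compact[where b = b] continuous_on_u_mult) auto
  have [measurable]: "U0 t \<in> borel_measurable borel" "m \<in> borel_measurable borel"
    using U0_measurable borel_measurable_continuous_onI[OF m(1)] by auto
  have "(\<lambda>r. indicator {1<..} r *\<^sub>R ((U0 t r) ^ k * m r)) \<in> borel_measurable lborel"
    by measurable
  from set_integral_AE_u[of "\<lambda>r x. x ^ k * m r", OF this i]
  show "set_integrable lborel {1<..} (\<lambda>r. (U0 t r) ^ k * m r)"
    "(LBINT r:{1<..}. (U0 t r) ^ k * m r) = (LBINT r:{1<..}. (u t r) ^ k * m r)"
    by simp_all
qed

lemma moment_L2:
  fixes m :: "real \<Rightarrow> real"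
  assumes q: "rad_L2 q" and m: "continuous_on UNIV m" "\<And>r. b < r \<Longrightarrow> m r = 0" and R: "1 \<le> R"
  shows "set_integrable lborel {R<..} (\<lambda>r. q r * r * m r)"
    and "\<bar>LBINT r:{R<..}. q r * r * m r\<bar> \<le> sqrt (rad_sq R q) * sqrt (LBINT r:{R<..}. (m r)\<^sup>2)"
proof -
  have "continuous_on {1..} (\<lambda>r. (m r)\<^sup>2)"
    by (intro continuous_intros continuous_on_subset[OF m(1)]) auto
  then have "set_integrable lborel {1<..} (\<lambda>r. (m r)\<^sup>2)"
    using m(2) by (intro Ioi_integrable_compact[where b = b]) auto
  then have "set_integrable lborel {R<..} (\<lambda>r. (m r)\<^sup>2)"
    using R by (auto elim: set_integrable_subset)
  from rad_L2_mult[OF q borel_measurable_continuous_onI[OF m(1)] this R]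
  show "set_integrable lborel {R<..} (\<lambda>r. q r * r * m r)"
    "\<bar>LBINT r:{R<..}. q r * r * m r\<bar> \<le> sqrt (rad_sq R q) * sqrt (LBINT r:{R<..}. (m r)\<^sup>2)" .
qed

lemma moment_L2_diff:
  fixes m :: "real \<Rightarrow> real"
  assumes m: "continuous_on UNIV m" "\<And>r. b < r \<Longrightarrow> m r = 0"
  shows "\<bar>(LBINT r:{1<..}. U1 s r * r * m r) - (LBINT r:{1<..}. U1 t r * r * m r)\<bar>
      \<le> sqrt (LBINT r:{1<..}. (m r)\<^sup>2) * dH s t"
    and "\<bar>(LBINT r:{1<..}. ur s r * r * m r) - (LBINT r:{1<..}. ur t r * r * m r)\<bar>
      \<le> sqrt (LBINT r:{1<..}. (m r)\<^sup>2) * dH s t"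
proof -
  have *: "\<bar>(LBINT r:{1<..}. p r * r * m r) - (LBINT r:{1<..}. q r * r * m r)\<bar>
      \<le> sqrt (LBINT r:{1<..}. (m r)\<^sup>2) * d"
    if pq: "rad_L2 p" "rad_L2 q" and d: "sqrt (rad_sq 1 (\<lambda>r. p r - q r)) \<le> d" for p q d
  proof -
    have "\<bar>(LBINT r:{1<..}. p r * r * m r) - (LBINT r:{1<..}. q r * r * m r)\<bar>
      = \<bar>LBINT r:{1<..}. p r * r * m r - q r * r * m r\<bar>"
      by (simp only: set_integral_diff(2)[OF moment_L2(1)[OF pq(1) m order_refl] moment_L2(1)[OF pq(2) m order_refl]])
    also have "\<dots> = \<bar>LBINT r:{1<..}. (p r - q r) * r * m r\<bar>" by (simp add: left_diff_distrib)
    also have "\<dots> \<le> sqrt (rad_sq 1 (\<lambda>r. p r - q r)) * sqrt (LBINT r:{1<..}. (m r)\<^sup>2)"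
      by (rule moment_L2(2)[OF rad_L2_diff[OF pq] m order_refl])
    also have "\<dots> \<le> d * sqrt (LBINT r:{1<..}. (m r)\<^sup>2)"
      using d by (intro mult_right_mono) (auto simp: set_lebesgue_integral_def intro!: integral_nonneg_AE)
    finally show ?thesis by (simp add: mult.commute)
  qed
  show "\<bar>(LBINT r:{1<..}. U1 s r * r * m r) - (LBINT r:{1<..}. U1 t r * r * m r)\<bar>
      \<le> sqrt (LBINT r:{1<..}. (m r)\<^sup>2) * dH s t"
    "\<bar>(LBINT r:{1<..}. ur s r * r * m r) - (LBINT r:{1<..}. ur t r * r * m r)\<bar>
      \<le> sqrt (LBINT r:{1<..}. (m r)\<^sup>2) * dH s t"
    unfolding dH_def by (intro * radL2 H_dist_bounds[OF inH inH])+
qed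

lemma moment_u_diff:
  fixes m :: "real \<Rightarrow> real"
  assumes m: "continuous_on UNIV m" "\<And>r. b < r \<Longrightarrow> m r = 0"
    and K: "\<And>r. 1 \<le> r \<Longrightarrow> \<bar>(u s r) ^ k - (u t r) ^ k\<bar> \<le> K * dH s t"
  shows "\<bar>(LBINT r:{1<..}. (u s r) ^ k * m r) - (LBINT r:{1<..}. (u t r) ^ k * m r)\<bar>
      \<le> K * (LBINT r:{1<..}. \<bar>m r\<bar>) * dH s t"
proof -
  note i = moment_u(1)[OF m, where k = k]
  have c: "continuous_on {1..} (\<lambda>r. \<bar>m r\<bar>)"
    by (intro continuous_intros continuous_on_subset[OF m(1)]) auto
  have mi: "set_integrable lborel {1<..} (\<lambda>r. \<bar>m r\<bar>)"
    using m(2) by (intro Ioi_integrable_compact[where b = b] c) auto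
  have "\<bar>(LBINT r:{1<..}. (u s r) ^ k * m r) - (LBINT r:{1<..}. (u t r) ^ k * m r)\<bar>
     = \<bar>LBINT r:{1<..}. (u s r) ^ k * m r - (u t r) ^ k * m r\<bar>"
    by (simp only: set_integral_diff(2)[OF i i])
  also have "\<dots> \<le> (LBINT r:{1<..}. (K * dH s t) * \<bar>m r\<bar>)"
  proof (rule set_integral_norm_le)
    show "set_integrable lborel {1<..} (\<lambda>r. (K * dH s t) * \<bar>m r\<bar>)" by (rule set_integrable_mult_right[OF mi])
    show "set_integrable lborel {1<..} (\<lambda>r. (u s r) ^ k * m r - (u t r) ^ k * m r)"
      by (rule set_integral_diff(1)[OF i i])
    fix r :: real assume "r \<in> {1<..}"
    then show "\<bar>(u s r) ^ k * m r - (u t r) ^ k * m r\<bar> \<le> (K * dH s t) * \<bar>m r\<bar>"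
      unfolding left_diff_distrib[symmetric] abs_mult by (intro mult_right_mono K) auto
  qed
  also have "\<dots> = (K * dH s t) * (LBINT r:{1<..}. \<bar>m r\<bar>)" by (rule set_integral_mult_right)
  also have "\<dots> = K * (LBINT r:{1<..}. \<bar>m r\<bar>) * dH s t" by algebra
  finally show ?thesis .
qed

lemma u_pow_diff:
  obtains K where "\<And>s t r. 1 \<le> r \<Longrightarrow> \<bar>(u s r) ^ 5 - (u t r) ^ 5\<bar> \<le> K * dH s t"
proof -
  obtain C where C: "C > 0" "\<And>t r. 1 \<le> r \<Longrightarrow> \<bar>u t r\<bar> \<le> C / sqrt r" by (rule u_bounded) blast
  have C1: "\<bar>u t r\<bar> \<le> C" if "1 \<le> r" for t r
  proof -
    have "C / sqrt r \<le> C / 1" using C that by (intro divide_left_mono) auto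
    then show ?thesis using C(2)[OF that, of t] by simp
  qed
  show ?thesis
  proof (rule that)
    fix s t r :: real assume r: "1 \<le> r"
    have "\<bar>(u s r) ^ 5 - (u t r) ^ 5\<bar> \<le> 5 * C ^ 4 * \<bar>u s r - u t r\<bar>"
      by (rule abs_power5_diff[OF C1[OF r] C1[OF r]])
    also have "\<bar>u s r - u t r\<bar> \<le> dH s t"
    proof -
      have "dH s t / sqrt r \<le> dH s t / 1" using r dH_nonneg[of s t] by (intro divide_left_mono) auto
      then show ?thesis using u_diff_bound[OF r, of s t] by simp
    qed
    finally show "\<bar>(u s r) ^ 5 - (u t r) ^ 5\<bar> \<le> (5 * C ^ 4) * dH s t"
      using C by (simp add: mult_left_mono)
  qed
qed

lemma u_diff_dH: "1 \<le> r \<Longrightarrow> \<bar>(u s r) ^ 1 - (u t r) ^ 1\<bar> \<le> 1 * dH s t"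
proof -
  assume r: "1 \<le> r"
  have "dH s t / sqrt r \<le> dH s t / 1" using r dH_nonneg[of s t] by (intro divide_left_mono) auto
  then show ?thesis using u_diff_bound[OF r, of s t] by simp
qed

lemma moments_eq:
  assumes b: "test_fun S b"
  shows "mA b t = (LBINT r:{1<..}. (u t r) ^ 1 * (b r * r\<^sup>2))"
    and "mB b t = (LBINT r:{1<..}. U1 t r * r * (b r * r))"
    and "mN b t = - (LBINT r:{1<..}. ur t r * r * (deriv b r * r)) + (LBINT r:{1<..}. (u t r) ^ 5 * (b r * r\<^sup>2))"
proof -
  have sm: "smooth_fun b" "smooth_fun (deriv b)"
    using test_fun_smooth[OF b] test_fun_smooth[OF test_fun_deriv[OF b]] by auto
  obtain c where c: "\<And>x. c < x \<Longrightarrow> b x = 0" using test_fun_bound[OF b] by metis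
  obtain c' where c': "\<And>x. c' < x \<Longrightarrow> deriv b x = 0" using test_fun_bound[OF test_fun_deriv[OF b]] by metis
  have m: "continuous_on UNIV (\<lambda>r. b r * r\<^sup>2)" "continuous_on UNIV (\<lambda>r. deriv b r * r)"
    by (intro continuous_intros smooth_fun_continuous_on sm)+
  have m0: "\<And>r. c < r \<Longrightarrow> b r * r\<^sup>2 = 0" "\<And>r. c' < r \<Longrightarrow> deriv b r * r = 0" using c c' by auto
  show "mA b t = (LBINT r:{1<..}. (u t r) ^ 1 * (b r * r\<^sup>2))"
    using moment_u(3)[OF m(1) m0(1), where t = t and k = 1] by (simp add: mA_def mult.assoc)
  show "mB b t = (LBINT r:{1<..}. U1 t r * r * (b r * r))"
    by (simp add: mB_def power2_eq_square mult_ac)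
  have "mN b t = (LBINT r:{1<..}. - (ur t r * r * (deriv b r * r)) + (U0 t r) ^ 5 * (b r * r\<^sup>2))"
    by (simp add: mN_def power2_eq_square algebra_simps)
  also have "\<dots> = (LBINT r:{1<..}. - (ur t r * r * (deriv b r * r))) + (LBINT r:{1<..}. (U0 t r) ^ 5 * (b r * r\<^sup>2))"
    using moment_L2(1)[OF radL2(1)[of t] m(2) m0(2) order_refl] moment_u(2)[OF m(1) m0(1), where t = t and k = 5]
    by (intro set_integral_add(2)) (auto simp: set_integrable_def)
  also have "\<dots> = - (LBINT r:{1<..}. ur t r * r * (deriv b r * r)) + (LBINT r:{1<..}. (u t r) ^ 5 * (b r * r\<^sup>2))"
    using moment_L2(1)[OF radL2(1)[of t] m(2) m0(2) order_refl] moment_u(3)[OF m(1) m0(1), where t = t and k = 5]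
    by (simp add: set_integral_uminus)
  finally show "mN b t = - (LBINT r:{1<..}. ur t r * r * (deriv b r * r)) + (LBINT r:{1<..}. (u t r) ^ 5 * (b r * r\<^sup>2))" .
qed

lemma moments_continuous:
  assumes b: "test_fun S b"
  shows "continuous_on UNIV (mA b)" "continuous_on UNIV (mB b)" "continuous_on UNIV (mN b)"
proof -
  have sm: "smooth_fun b" "smooth_fun (deriv b)"
    using test_fun_smooth[OF b] test_fun_smooth[OF test_fun_deriv[OF b]] by auto
  obtain c where c: "\<And>x. c < x \<Longrightarrow> b x = 0" using test_fun_bound[OF b] by metis
  obtain c' where c': "\<And>x. c' < x \<Longrightarrow> deriv b x = 0" using test_fun_bound[OF test_fun_deriv[OF b]] by metis
  have m: "continuous_on UNIV (\<lambda>r. b r * r\<^sup>2)" "continuous_on UNIV (\<lambda>r. deriv b r * r)" "continuous_on UNIV (\<lambda>r. b r * r)"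
    by (intro continuous_intros smooth_fun_continuous_on sm)+
  have m0: "\<And>r. c < r \<Longrightarrow> b r * r\<^sup>2 = 0" "\<And>r. c' < r \<Longrightarrow> deriv b r * r = 0" "\<And>r. c < r \<Longrightarrow> b r * r = 0"
    using c c' by auto
  obtain K where K: "\<And>s t r. 1 \<le> r \<Longrightarrow> \<bar>(u s r) ^ 5 - (u t r) ^ 5\<bar> \<le> K * dH s t"
    by (rule u_pow_diff) blast
  show "continuous_on UNIV (mA b)"
    unfolding moments_eq(1)[OF b, abs_def]
    by (rule continuous_of_dH_bound, rule moment_u_diff[OF m(1) m0(1) u_diff_dH])
  show "continuous_on UNIV (mB b)"
    unfolding moments_eq(2)[OF b, abs_def]
    by (rule continuous_of_dH_bound, rule moment_L2_diff(1)[OF m(3) m0(3)])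
  have "continuous_on UNIV (\<lambda>t. LBINT r:{1<..}. ur t r * r * (deriv b r * r))"
    by (rule continuous_of_dH_bound, rule moment_L2_diff(2)[OF m(2) m0(2)])
  moreover have "continuous_on UNIV (\<lambda>t. LBINT r:{1<..}. (u t r) ^ 5 * (b r * r\<^sup>2))"
    by (rule continuous_of_dH_bound, rule moment_u_diff[OF m(1) m0(1) K])
  ultimately show "continuous_on UNIV (mN b)"
    unfolding moments_eq(3)[OF b, abs_def] by (intro continuous_intros)
qed

lemma UNIV_interval: "open (UNIV :: real set)" "(UNIV :: real set) \<noteq> {}" "is_interval (UNIV :: real set)"
  by auto

text \<open>For fixed \<open>b\<close> the weak formulation is an equation in t alone, and the
  moments are continuous in t, so the weak time derivatives are classical ones.\<close>

lemma moments_deriv: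
  assumes b: "test_fun S b"
  shows "(mA b has_real_derivative mB b t) (at t)" and "(mB b has_real_derivative mN b t) (at t)"
proof -
  have b': "test_fun UNIV b" by (rule test_fun_mono[OF b]) simp
  have *: "(f has_real_derivative g t) (at t)"
    if f: "continuous_on UNIV f" and g: "continuous_on UNIV g"
      and eq: "\<And>a. test_fun UNIV a \<Longrightarrow> (LINT t|lborel. deriv a t * f t + a t * g t) = 0" for f g
  proof (rule weak_derivative_classical[OF UNIV_interval(1,3) UNIV_I f g])
    fix a assume a: "test_fun UNIV a"
    have fi: "set_integrable lborel UNIV (\<lambda>t. f t * deriv a t)"
      by (rule set_integrable_test[OF set_integrable_continuous[OF f] test_fun_deriv[OF a] UNIV_interval])
    have gi: "set_integrable lborel UNIV (\<lambda>t. g t * a t)"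
      by (rule set_integrable_test[OF set_integrable_continuous[OF g] a UNIV_interval])
    have "0 = (LBINT t:UNIV. f t * deriv a t + g t * a t)"
      using eq[OF a] by (simp add: set_lebesgue_integral_def mult.commute)
    also have "\<dots> = (LBINT t:UNIV. f t * deriv a t) + (LBINT t:UNIV. g t * a t)"
      by (rule set_integral_add(2)[OF fi gi])
    finally show "(LBINT t:UNIV. f t * deriv a t) = - (LBINT t:UNIV. g t * a t)" by simp
  qed
  show "(mA b has_real_derivative mB b t) (at t)"
    using sol b' by (intro * moments_continuous[OF b]) (auto simp: global_solution_def mA_def mB_def)
  show "(mB b has_real_derivative mN b t) (at t)"
    using sol b' by (intro * moments_continuous[OF b]) (auto simp: global_solution_def mN_def mB_def)
qed

text \<open>In terms of $v = r u$ these are the pairings of $v$, $v_t$ and $v^5 / r^4$ with a function of $r$.\<close>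

definition al :: "(real \<Rightarrow> real) \<Rightarrow> real \<Rightarrow> real" where
  "al \<phi> t = (LBINT r:{1<..}. u t r * r * \<phi> r)"
definition be :: "(real \<Rightarrow> real) \<Rightarrow> real \<Rightarrow> real" where
  "be \<phi> t = (LBINT r:{1<..}. U1 t r * r * \<phi> r)"
definition ga :: "(real \<Rightarrow> real) \<Rightarrow> real \<Rightarrow> real" where
  "ga \<phi> t = (LBINT r:{1<..}. (u t r) ^ 5 * r * \<phi> r)"

lemma weak_ur:
  assumes \<zeta>: "test_fun {1<..} \<zeta>"
  shows "(LBINT r:{1<..}. u t r * deriv \<zeta> r) = - (LBINT r:{1<..}. ur t r * \<zeta> r)"
proof -
  note t = test_fun_deriv[OF \<zeta>]
  obtain c where c: "\<And>x. c < x \<Longrightarrow> deriv \<zeta> x = 0" using test_fun_bound[OF t] by metis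
  show ?thesis
    using in_H_wderiv(1)[OF inH, of t] \<zeta>
      moment_u(3)[OF smooth_fun_continuous_on[OF test_fun_smooth[OF t]] c, where t = t and k = 1]
    by (simp add: weak_deriv_def)
qed

text \<open>The equation v_tt = v_rr + r u^5 for v = r u, tested with \<phi> = r b. Since \<phi>
  vanishes near r = 1, the boundary condition enters only later, in \<open>Neumann\<close>.\<close>

lemma al_be_deriv:
  assumes \<phi>: "test_fun {1<..} \<phi>"
  shows "(al \<phi> has_real_derivative be \<phi> t) (at t)"
    and "(be \<phi> has_real_derivative al (deriv (deriv \<phi>)) t + ga \<phi> t) (at t)"
proof -
  define b where "b = (\<lambda>r. \<phi> r / r)"
  have b: "test_fun {1<..} b" unfolding b_def by (rule test_fun_divide[OF \<phi>])
  note sm = test_fun_smooth[OF \<phi>] test_fun_smooth[OF test_fun_deriv[OF \<phi>]]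
  have A: "al \<phi> = mA b" unfolding moments_eq(1)[OF b, abs_def] al_def[abs_def]
    by (intro ext set_lebesgue_integral_cong) (auto simp: b_def power2_eq_square)
  have B: "be \<phi> = mB b" unfolding moments_eq(2)[OF b, abs_def] be_def[abs_def]
    by (intro ext set_lebesgue_integral_cong) (auto simp: b_def)
  have G: "ga \<phi> t = (LBINT r:{1<..}. (u t r) ^ 5 * (b r * r\<^sup>2))" unfolding ga_def
    by (intro set_lebesgue_integral_cong) (auto simp: b_def power2_eq_square)
  \<comment> \<open>This is r^2 b', and its derivative is r \<phi>''. Integrating \<open>ur\<close>
    by parts against it therefore yields the pairing of r u with \<phi>''.\<close>
  define \<zeta> where "\<zeta> = (\<lambda>r. r * deriv \<phi> r - \<phi> r)"
  have \<zeta>: "test_fun {1<..} \<zeta>" unfolding \<zeta>_def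
    by (intro test_fun_diff test_fun_mult_smooth smooth_fun_id test_fun_deriv \<phi>)
  have d\<zeta>: "deriv \<zeta> r = r * deriv (deriv \<phi>) r" for r
    unfolding \<zeta>_def by (rule DERIV_imp_deriv)
      (auto intro!: derivative_eq_intros smooth_fun_DERIV[OF sm(1)] smooth_fun_DERIV[OF sm(2)])
  have db: "deriv b r * r * r = \<zeta> r" if "r > 1" for r
  proof -
    have "(b has_real_derivative (deriv \<phi> r * r - \<phi> r * 1) / (r * r)) (at r)"
      unfolding b_def using that by (auto intro!: derivative_eq_intros smooth_fun_DERIV[OF sm(1)])
    then show ?thesis using that by (simp add: DERIV_imp_deriv \<zeta>_def field_simps)
  qed
  have "(LBINT r:{1<..}. ur t r * r * (deriv b r * r)) = (LBINT r:{1<..}. ur t r * \<zeta> r)"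
    by (intro set_lebesgue_integral_cong) (auto simp flip: db)
  also have "\<dots> = - al (deriv (deriv \<phi>)) t"
    using weak_ur[OF \<zeta>, of t] by (simp add: al_def d\<zeta> mult.assoc)
  finally have N: "mN b t = al (deriv (deriv \<phi>)) t + ga \<phi> t"
    unfolding moments_eq(3)[OF b] G by simp
  show "(al \<phi> has_real_derivative be \<phi> t) (at t)" "(be \<phi> has_real_derivative al (deriv (deriv \<phi>)) t + ga \<phi> t) (at t)"
    using moments_deriv[OF b, of t] unfolding A B N by simp_all
qed

text \<open>This is v_r = r u_r + u: the pairing of v with \<phi>' is expressed by quantities that
  the energy tail controls, for use in \<open>char_bound\<close>.\<close>

lemma al_deriv_eq:
  assumes \<phi>: "test_fun {1<..} \<phi>"
  shows "al (deriv \<phi>) t = - (LBINT r:{1<..}. ur t r * r * \<phi> r) - (LBINT r:{1<..}. u t r * \<phi> r)"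
proof -
  note sm = test_fun_smooth[OF \<phi>]
  have \<zeta>: "test_fun {1<..} (\<lambda>r. r * \<phi> r)" by (intro test_fun_mult_smooth smooth_fun_id \<phi>)
  have d: "deriv (\<lambda>r. r * \<phi> r) r = \<phi> r + r * deriv \<phi> r" for r
    by (rule DERIV_imp_deriv) (auto intro!: derivative_eq_intros smooth_fun_DERIV[OF sm])
  obtain c where c: "\<And>x. c < x \<Longrightarrow> \<phi> x = 0" using test_fun_bound[OF \<phi>] by metis
  obtain c' where c': "\<And>x. c' < x \<Longrightarrow> deriv \<phi> x = 0" using test_fun_bound[OF test_fun_deriv[OF \<phi>]] by metis
  have cont: "continuous_on UNIV (\<lambda>r. r * deriv \<phi> r)"
    by (intro continuous_intros smooth_fun_continuous_on test_fun_smooth[OF test_fun_deriv[OF \<phi>]])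
  have i1: "set_integrable lborel {1<..} (\<lambda>r. u t r * \<phi> r)"
    using moment_u(1)[OF smooth_fun_continuous_on[OF sm] c, where t = t and k = 1] by simp
  have i2: "set_integrable lborel {1<..} (\<lambda>r. u t r * (r * deriv \<phi> r))"
    using moment_u(1)[OF cont, of c', where t = t and k = 1] c' by simp
  have "- (LBINT r:{1<..}. ur t r * r * \<phi> r) = (LBINT r:{1<..}. u t r * \<phi> r + u t r * (r * deriv \<phi> r))"
    using weak_ur[OF \<zeta>, of t] by (simp add: d distrib_left mult.assoc)
  also have "\<dots> = (LBINT r:{1<..}. u t r * \<phi> r) + al (deriv \<phi>) t"
    unfolding al_def using set_integral_add(2)[OF i1 i2] by (simp add: mult.assoc)
  finally show ?thesis by simp
qed

end

subsection \<open>Transport along characteristics\<close>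

lemma test_fun_taylor:
  assumes \<phi>: "test_fun S \<phi>"
  obtains M where "0 \<le> M" "\<And>x h. \<bar>\<phi> (x + h) - \<phi> x - h * deriv \<phi> x\<bar> \<le> M * h\<^sup>2"
proof -
  define \<psi> where "\<psi> = deriv \<phi>"
  note t1 = test_fun_deriv[OF \<phi>, folded \<psi>_def]
  note t2 = test_fun_deriv[OF t1]
  obtain K where K: "compact K" "\<forall>x. x \<notin> K \<longrightarrow> deriv \<psi> x = 0" using t2 by (auto simp: test_fun_def)
  have "compact (deriv \<psi> ` K)"
    by (intro compact_continuous_image smooth_fun_continuous_on test_fun_smooth[OF t2] K)
  then obtain B where B: "\<forall>y\<in>deriv \<psi> ` K. norm y \<le> B" using compact_imp_bounded bounded_iff by metis
  define M where "M = max B 0"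
  have M: "norm (deriv \<psi> x) \<le> M" for x
    using B K(2) by (cases "x \<in> K") (auto simp: M_def max_def)
  have lip: "norm (\<psi> x - \<psi> y) \<le> M * norm (x - y)" for x y
    by (rule field_differentiable_bound[of UNIV \<psi> "deriv \<psi>"])
      (use M in \<open>auto intro!: smooth_fun_DERIV test_fun_smooth[OF t1]\<close>)
  show ?thesis
  proof (rule that)
    fix x h
    have "norm ((\<lambda>y. \<phi> y - y * \<psi> x) (x + h) - (\<lambda>y. \<phi> y - y * \<psi> x) x) \<le> (M * \<bar>h\<bar>) * norm (x + h - x)"
    proof (rule field_differentiable_bound[of "{x - \<bar>h\<bar>..x + \<bar>h\<bar>}" _ "\<lambda>y. \<psi> y - \<psi> x"])
      show "((\<lambda>y. \<phi> y - y * \<psi> x) has_field_derivative \<psi> z - \<psi> x) (at z within {x - \<bar>h\<bar>..x + \<bar>h\<bar>})" for z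
        unfolding \<psi>_def
        by (auto intro!: derivative_eq_intros has_field_derivative_at_within[OF smooth_fun_DERIV[OF test_fun_smooth[OF \<phi>]]])
      show "norm (\<psi> z - \<psi> x) \<le> M * \<bar>h\<bar>" if "z \<in> {x - \<bar>h\<bar>..x + \<bar>h\<bar>}" for z
      proof -
        have "M * norm (z - x) \<le> M * \<bar>h\<bar>" using that by (intro mult_left_mono) (auto simp: M_def)
        then show ?thesis using lip[of z x] by linarith
      qed
    qed (auto simp: abs_if)
    moreover have "(M * \<bar>h\<bar>) * norm (x + h - x) = M * h\<^sup>2" by (simp add: power2_eq_square)
    ultimately show "\<bar>\<phi> (x + h) - \<phi> x - h * deriv \<phi> x\<bar> \<le> M * h\<^sup>2"
      by (simp add: \<psi>_def algebra_simps power2_eq_square)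
  qed (simp add: M_def)
qed

text \<open>First-order expansion of a pairing in the shift of the test function; the linear term
  carries a plus sign because the derivative of \<phi> (r - s) in s is negative. The error depends
  on \<open>w\<close> only through a local L^1 norm, hence can be made uniform along the
  trajectory.\<close>

lemma translate_expansion:
  fixes w :: "real \<Rightarrow> real"
  assumes w: "set_integrable lborel {1<..B} w" and \<phi>: "test_fun S \<phi>"
    and M: "\<And>x h. \<bar>\<phi> (x + h) - \<phi> x - h * deriv \<phi> x\<bar> \<le> M * h\<^sup>2"
    and b: "\<And>x. b < x \<Longrightarrow> \<phi> x = 0" "\<And>x. b < x \<Longrightarrow> deriv \<phi> x = 0"
    and B: "b + s + 1 \<le> B" and h: "\<bar>h\<bar> \<le> 1"
  shows "\<bar>(LBINT r:{1<..}. w r * \<phi> (r - (s + h))) - (LBINT r:{1<..}. w r * \<phi> (r - s))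
      + h * (LBINT r:{1<..}. w r * deriv \<phi> (r - s))\<bar> \<le> M * h\<^sup>2 * (LBINT r:{1<..B}. \<bar>w r\<bar>)"
proof -
  have bdd: "\<exists>C. \<forall>x. \<bar>\<psi> x\<bar> \<le> C" if t: "test_fun S \<psi>" for \<psi>
  proof -
    obtain K where K: "compact K" "\<forall>x. x \<notin> K \<longrightarrow> \<psi> x = 0" using t by (auto simp: test_fun_def)
    have "compact (\<psi> ` K)"
      by (intro compact_continuous_image smooth_fun_continuous_on test_fun_smooth[OF t] K)
    then obtain C where C: "\<forall>y\<in>\<psi> ` K. norm y \<le> C" using compact_imp_bounded bounded_iff by metis
    have "\<bar>\<psi> x\<bar> \<le> max C 0" for x using C K(2) by (cases "x \<in> K") (auto simp: max_def)
    then show ?thesis by blast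
  qed
  have int: "set_integrable lborel {1<..B} (\<lambda>r. w r * \<psi> (r - d))" if t: "test_fun S \<psi>" for \<psi> d
  proof -
    obtain C where "\<forall>x. \<bar>\<psi> x\<bar> \<le> C" using bdd[OF t] by blast
    then show ?thesis
      by (intro set_integrable_mult_bounded[OF w, where B = C] smooth_fun_measurable smooth_fun_shift test_fun_smooth[OF t]) auto
  qed
  have supp: "(LBINT r:{1<..}. w r * \<phi> (r - (s + h))) = (LBINT r:{1<..B}. w r * \<phi> (r - (s + h)))"
    "(LBINT r:{1<..}. w r * \<phi> (r - s)) = (LBINT r:{1<..B}. w r * \<phi> (r - s))"
    "(LBINT r:{1<..}. w r * deriv \<phi> (r - s)) = (LBINT r:{1<..B}. w r * deriv \<phi> (r - s))"
    using B h by (intro set_integral_support; auto intro!: b)+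
  note i = int[OF \<phi>] int[OF test_fun_deriv[OF \<phi>]]
  have "(LBINT r:{1<..B}. w r * \<phi> (r - (s + h))) - (LBINT r:{1<..B}. w r * \<phi> (r - s))
      + h * (LBINT r:{1<..B}. w r * deriv \<phi> (r - s))
    = (LBINT r:{1<..B}. w r * \<phi> (r - (s + h)) - w r * \<phi> (r - s) + h * (w r * deriv \<phi> (r - s)))"
    using i by simp
  moreover have "\<bar>LBINT r:{1<..B}. w r * \<phi> (r - (s + h)) - w r * \<phi> (r - s) + h * (w r * deriv \<phi> (r - s))\<bar>
    \<le> (LBINT r:{1<..B}. (M * h\<^sup>2) * \<bar>w r\<bar>)"
  proof (rule set_integral_norm_le)
    show "set_integrable lborel {1<..B} (\<lambda>r. (M * h\<^sup>2) * \<bar>w r\<bar>)"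
      by (intro set_integrable_mult_right set_integrable_abs w)
    show "set_integrable lborel {1<..B} (\<lambda>r. w r * \<phi> (r - (s + h)) - w r * \<phi> (r - s) + h * (w r * deriv \<phi> (r - s)))"
      by (intro set_integral_add(1) set_integral_diff(1) set_integrable_mult_right i)
    fix r
    have "w r * \<phi> (r - (s + h)) - w r * \<phi> (r - s) + h * (w r * deriv \<phi> (r - s))
       = w r * (\<phi> ((r - s) + (- h)) - \<phi> (r - s) - (- h) * deriv \<phi> (r - s))"
      by (simp add: algebra_simps)
    then show "\<bar>w r * \<phi> (r - (s + h)) - w r * \<phi> (r - s) + h * (w r * deriv \<phi> (r - s))\<bar> \<le> (M * h\<^sup>2) * \<bar>w r\<bar>"
      using mult_left_mono[OF M[of "r - s" "- h"], of "\<bar>w r\<bar>"] by (simp add: abs_mult mult.commute)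
  qed
  ultimately show ?thesis unfolding supp by simp
qed

text \<open>A total derivative under weak regularity: the expansion in the second variable is
  uniform in the first, so the increment in the second variable can be compared with
  \<open>D\<close> at the moving point, and continuity of \<open>D\<close> finishes the
  argument.\<close>

lemma diagonal_derivative:
  fixes H :: "real \<Rightarrow> real \<Rightarrow> real"
  assumes exp: "\<And>x h. \<bar>h\<bar> \<le> 1 \<Longrightarrow> \<bar>H x (s + h) - H x s - h * D x\<bar> \<le> K * h\<^sup>2"
    and D: "isCont D s" and L: "((\<lambda>x. H x s) has_real_derivative L) (at s)"
  shows "((\<lambda>x. H x x) has_real_derivative L + D s) (at s)"
proof -
  have "((\<lambda>h. (H (s + h) (s + h) - H (s + h) s) / h - D (s + h)) \<longlongrightarrow> 0) (at 0)"
  proof (rule Lim_null_comparison)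
    show "\<forall>\<^sub>F h in at 0. norm ((H (s + h) (s + h) - H (s + h) s) / h - D (s + h)) \<le> K * \<bar>h\<bar>"
      unfolding eventually_at
    proof (intro exI[of _ 1] conjI ballI impI)
      fix h :: real assume "h \<noteq> 0 \<and> dist h 0 < 1"
      then have h: "h \<noteq> 0" "\<bar>h\<bar> \<le> 1" by auto
      have "\<bar>(H (s + h) (s + h) - H (s + h) s) / h - D (s + h)\<bar> = \<bar>H (s + h) (s + h) - H (s + h) s - h * D (s + h)\<bar> / \<bar>h\<bar>"
        using h by (simp add: diff_divide_distrib flip: abs_divide)
      also have "\<dots> \<le> K * h\<^sup>2 / \<bar>h\<bar>" by (intro divide_right_mono exp h) simp
      also have "\<dots> = K * \<bar>h\<bar>" using h by (simp add: power2_eq_square abs_if)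
      finally show "norm ((H (s + h) (s + h) - H (s + h) s) / h - D (s + h)) \<le> K * \<bar>h\<bar>" by simp
    qed simp
    show "((\<lambda>h. K * \<bar>h\<bar>) \<longlongrightarrow> 0) (at 0)" by (auto intro!: tendsto_eq_intros)
  qed
  moreover have "((\<lambda>h. D (s + h)) \<longlongrightarrow> D s) (at 0)" using D by (simp add: isCont_iff)
  moreover have "((\<lambda>h. (H (s + h) s - H s s) / h) \<longlongrightarrow> L) (at 0)" using L by (simp add: DERIV_def)
  ultimately have "((\<lambda>h. ((H (s + h) (s + h) - H (s + h) s) / h - D (s + h)) + D (s + h) + (H (s + h) s - H s s) / h) \<longlongrightarrow> 0 + D s + L) (at 0)"
    by (intro tendsto_add)
  moreover have "((H (s + h) (s + h) - H (s + h) s) / h - D (s + h)) + D (s + h) + (H (s + h) s - H s s) / h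
     = (H (s + h) (s + h) - H s s) / h" for h by (simp add: diff_divide_distrib)
  ultimately show ?thesis by (simp add: DERIV_def add.commute)
qed

context compact_solution
begin

text \<open>The inequality |x| <= 1 + x^2 bounds the local L^1 norm by the energy, uniformly in
  time, as the expansion in the shift requires.\<close>

lemma U1_L1:
  "\<exists>K. \<forall>t. set_integrable lborel {1<..B} (\<lambda>r. U1 t r * r) \<and> (LBINT r:{1<..B}. \<bar>U1 t r * r\<bar>) \<le> K"
proof -
  obtain C where C: "C > 0" "\<And>t r. 1 \<le> r \<Longrightarrow> tail t r \<le> C" by (rule tail_bounded) blast
  have one: "set_integrable lborel {1<..B} (\<lambda>r. 1 :: real)"
    by (rule set_integrable_subset[OF set_integrable_continuous[of "\<lambda>r. 1" 1 B]]) auto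
  have "set_integrable lborel {1<..B} (\<lambda>r. U1 t r * r) \<and> (LBINT r:{1<..B}. \<bar>U1 t r * r\<bar>) \<le> measure lborel {1<..B} + C" for t
  proof -
    have sq: "set_integrable lborel {1<..B} (\<lambda>r. (U1 t r)\<^sup>2 * r\<^sup>2)"
      using rad_L2_integrable[OF radL2(2) order_refl] by (rule set_integrable_subset) auto
    have le: "\<bar>U1 t r * r\<bar> \<le> 1 + (U1 t r)\<^sup>2 * r\<^sup>2" for r
    proof -
      have "2 * \<bar>U1 t r * r\<bar> \<le> 1 + (U1 t r * r)\<^sup>2"
        using zero_le_power2[of "\<bar>U1 t r * r\<bar> - 1"] by (simp add: power2_diff)
      then have "\<bar>U1 t r * r\<bar> \<le> 1 + (U1 t r * r)\<^sup>2" by linarith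
      then show ?thesis by (simp add: power_mult_distrib)
    qed
    have [measurable]: "U1 t \<in> borel_measurable borel" using radL2(2)[of t] by (simp add: rad_L2_def)
    have i: "set_integrable lborel {1<..B} (\<lambda>r. U1 t r * r)"
    proof (rule set_integrable_bound[OF set_integral_add(1)[OF one sq]])
      show "set_borel_measurable lborel {1<..B} (\<lambda>r. U1 t r * r)"
        unfolding set_borel_measurable_def by measurable
      show "AE r in lborel. r \<in> {1<..B} \<longrightarrow> norm (U1 t r * r) \<le> norm (1 + (U1 t r)\<^sup>2 * r\<^sup>2)"
        using le by (intro AE_I2 impI) (metis abs_ge_self order_trans real_norm_def)
    qed
    have "(LBINT r:{1<..B}. \<bar>U1 t r * r\<bar>) \<le> (LBINT r:{1<..B}. 1 + (U1 t r)\<^sup>2 * r\<^sup>2)"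
      by (intro set_integral_mono set_integrable_abs i set_integral_add(1) one sq le)
    also have "\<dots> = measure lborel {1<..B} + (LBINT r:{1<..B}. (U1 t r)\<^sup>2 * r\<^sup>2)"
      by (subst set_integral_add(2)[OF one sq]) (simp add: set_lebesgue_integral_def)
    also have "(LBINT r:{1<..B}. (U1 t r)\<^sup>2 * r\<^sup>2) \<le> rad_sq 1 (U1 t)"
      unfolding rad_sq_def set_lebesgue_integral_def
      using sq rad_L2_integrable[OF radL2(2)[of t] order_refl]
      by (intro integral_mono) (auto simp: set_integrable_def indicator_def)
    also have "rad_sq 1 (U1 t) \<le> C" using C(2)[OF order_refl, of t] rad_sq_nonneg[of 1 "ur t"] unfolding tail_def by linarith
    finally show ?thesis using i by simp
  qed
  then show ?thesis by blast
qed

lemma u_L1: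
  "\<exists>K. \<forall>t. set_integrable lborel {1<..B} (\<lambda>r. u t r * r) \<and> (LBINT r:{1<..B}. \<bar>u t r * r\<bar>) \<le> K"
proof -
  obtain C where C: "C > 0" "\<And>t r. 1 \<le> r \<Longrightarrow> \<bar>u t r\<bar> \<le> C / sqrt r" by (rule u_bounded) blast
  have i: "set_integrable lborel {1<..B} (\<lambda>r. u t r * r)" for t
    by (rule set_integrable_subset[of _ "{1..B}"])
      (auto intro!: borel_integrable_atLeastAtMost' continuous_intros continuous_on_subset[OF u_continuous])
  have lin: "set_integrable lborel {1<..B} (\<lambda>r. C * r)"
    by (rule set_integrable_subset[OF set_integrable_continuous[of "\<lambda>r. C * r" 1 B]])
      (auto intro!: continuous_intros)
  have le: "\<bar>u t r * r\<bar> \<le> C * r" if "r \<in> {1<..B}" for t r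
  proof -
    have "C / sqrt r \<le> C / 1" using C that by (intro divide_left_mono) auto
    then have "\<bar>u t r\<bar> \<le> C" using C(2)[of r t] that by auto
    then show ?thesis using that by (simp add: abs_mult)
  qed
  have "(LBINT r:{1<..B}. \<bar>u t r * r\<bar>) \<le> (LBINT r:{1<..B}. C * r)" for t
    by (intro set_integral_mono set_integrable_abs i lin le)
  then show ?thesis using i by blast
qed

definition shft :: "(real \<Rightarrow> real) \<Rightarrow> real \<Rightarrow> real \<Rightarrow> real" where
  "shft \<phi> s = (\<lambda>r. \<phi> (r - s))"

lemma shft_test: "test_fun {1<..} \<phi> \<Longrightarrow> 0 \<le> s \<Longrightarrow> test_fun {1<..} (shft \<phi> s)"
  unfolding shft_def by (rule test_fun_shift)

lemma shft_deriv: "deriv (shft \<phi> s) = shft (deriv \<phi>) s"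
  unfolding shft_def by (rule ext) (rule deriv_shift)

lemma pairing_expansion:
  fixes w :: "real \<Rightarrow> real \<Rightarrow> real"
  defines "I \<equiv> \<lambda>\<psi> t. LBINT r:{1<..}. w t r * \<psi> r"
  assumes \<phi>: "test_fun S \<phi>"
    and w: "\<And>B. \<exists>K. \<forall>t. set_integrable lborel {1<..B} (w t) \<and> (LBINT r:{1<..B}. \<bar>w t r\<bar>) \<le> K"
  obtains K where "\<And>t h. \<bar>h\<bar> \<le> 1 \<Longrightarrow> \<bar>I (shft \<phi> (s + h)) t - I (shft \<phi> s) t + h * I (shft (deriv \<phi>) s) t\<bar> \<le> K * h\<^sup>2"
proof -
  obtain b where b: "\<And>x. b < x \<Longrightarrow> \<phi> x = 0" using test_fun_bound[OF \<phi>] by metis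
  obtain b' where b': "\<And>x. b' < x \<Longrightarrow> deriv \<phi> x = 0" using test_fun_bound[OF test_fun_deriv[OF \<phi>]] by metis
  obtain M where M: "0 \<le> M" "\<And>x h. \<bar>\<phi> (x + h) - \<phi> x - h * deriv \<phi> x\<bar> \<le> M * h\<^sup>2"
    by (rule test_fun_taylor[OF \<phi>]) blast
  define B where "B = max b b' + s + 1"
  obtain K where K: "\<And>t. set_integrable lborel {1<..B} (w t)" "\<And>t. (LBINT r:{1<..B}. \<bar>w t r\<bar>) \<le> K"
    using w[of B] by blast
  have bb: "\<And>x. max b b' < x \<Longrightarrow> \<phi> x = 0" "\<And>x. max b b' < x \<Longrightarrow> deriv \<phi> x = 0" using b b' by auto
  show ?thesis
  proof (rule that)
    fix t h :: real assume h: "\<bar>h\<bar> \<le> 1"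
    have "\<bar>I (shft \<phi> (s + h)) t - I (shft \<phi> s) t + h * I (shft (deriv \<phi>) s) t\<bar> \<le> M * h\<^sup>2 * (LBINT r:{1<..B}. \<bar>w t r\<bar>)"
      unfolding I_def shft_def
      by (rule translate_expansion[OF K(1) \<phi> M(2), where b = "max b b'"]) (use bb h in \<open>auto simp: B_def\<close>)
    also have "\<dots> \<le> M * h\<^sup>2 * K" using K(2)[of t] M(1) by (intro mult_left_mono) auto
    finally show "\<bar>I (shft \<phi> (s + h)) t - I (shft \<phi> s) t + h * I (shft (deriv \<phi>) s) t\<bar> \<le> (M * K) * h\<^sup>2"
      by (simp add: mult_ac)
  qed
qed

lemma be_expansion:
  assumes \<phi>: "test_fun S \<phi>"
  obtains K where "\<And>t h. \<bar>h\<bar> \<le> 1 \<Longrightarrow> \<bar>be (shft \<phi> (s + h)) t - be (shft \<phi> s) t + h * be (shft (deriv \<phi>) s) t\<bar> \<le> K * h\<^sup>2"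
  unfolding be_def by (rule pairing_expansion[OF \<phi> U1_L1]) blast

lemma al_expansion:
  assumes \<phi>: "test_fun S \<phi>"
  obtains K where "\<And>t h. \<bar>h\<bar> \<le> 1 \<Longrightarrow> \<bar>al (shft \<phi> (s + h)) t - al (shft \<phi> s) t + h * al (shft (deriv \<phi>) s) t\<bar> \<le> K * h\<^sup>2"
  unfolding al_def by (rule pairing_expansion[OF \<phi> u_L1]) blast

text \<open>With $\sigma = \pm 1$, the pairing of $\sigma v_t - v_r$ with a function
  transported along the characteristic $(t + \sigma s, r + s)$.\<close>

definition char_pairing :: "real \<Rightarrow> (real \<Rightarrow> real) \<Rightarrow> real \<Rightarrow> real \<Rightarrow> real \<Rightarrow> real" where
  "char_pairing \<sigma> \<phi> t x s = \<sigma> * be (shft \<phi> s) (t + \<sigma> * x) + al (shft (deriv \<phi>) s) (t + \<sigma> * x)"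

text \<open>Moving in time produces the pairings of v with \<phi>'', of the nonlinearity with \<phi>
  (both with factor \<sigma>^2 = 1) and of v_t with \<phi>'; moving the test function outward
  removes the terms in \<phi>' and \<phi>'', and only the nonlinearity survives.\<close>

lemma char_deriv:
  assumes \<phi>: "test_fun {1<..} \<phi>" and \<sigma>: "\<sigma> * \<sigma> = 1" and s: "0 \<le> s"
  shows "((\<lambda>x. char_pairing \<sigma> \<phi> t x x) has_real_derivative ga (shft \<phi> s) (t + \<sigma> * s)) (at s)"
proof -
  note \<phi>' = test_fun_deriv[OF \<phi>]
  note \<phi>'' = test_fun_deriv[OF \<phi>']
  note ts = shft_test[OF \<phi> s] shft_test[OF \<phi>' s] shft_test[OF \<phi>'' s]
  have chain: "((\<lambda>x. f (t + \<sigma> * x)) has_real_derivative f' (t + \<sigma> * x) * \<sigma>) (at x)"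
    if "\<And>t. (f has_real_derivative f' t) (at t)" for f f' x
    by (rule DERIV_chain2[OF that]) (auto intro!: derivative_eq_intros)
  obtain K1 where K1: "\<And>t h. \<bar>h\<bar> \<le> 1 \<Longrightarrow> \<bar>be (shft \<phi> (s + h)) t - be (shft \<phi> s) t + h * be (shft (deriv \<phi>) s) t\<bar> \<le> K1 * h\<^sup>2"
    by (rule be_expansion[OF \<phi>]) blast
  obtain K2 where K2: "\<And>t h. \<bar>h\<bar> \<le> 1 \<Longrightarrow> \<bar>al (shft (deriv \<phi>) (s + h)) t - al (shft (deriv \<phi>) s) t + h * al (shft (deriv (deriv \<phi>)) s) t\<bar> \<le> K2 * h\<^sup>2"
    by (rule al_expansion[OF \<phi>']) blast
  define D where "D x = - \<sigma> * be (shft (deriv \<phi>) s) (t + \<sigma> * x) - al (shft (deriv (deriv \<phi>)) s) (t + \<sigma> * x)" for x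
  have abs\<sigma>: "\<bar>\<sigma>\<bar> = 1" using \<sigma> by (metis abs_mult_self_eq abs_one abs_square_eq_1 power2_eq_square)
  have "((\<lambda>x. char_pairing \<sigma> \<phi> t x x) has_real_derivative
      (\<sigma> * ((al (shft (deriv (deriv \<phi>)) s) (t + \<sigma> * s) + ga (shft \<phi> s) (t + \<sigma> * s)) * \<sigma>)
        + be (shft (deriv \<phi>) s) (t + \<sigma> * s) * \<sigma>) + D s) (at s)"
  proof (rule diagonal_derivative[where K = "K1 + K2" and D = D and H = "char_pairing \<sigma> \<phi> t"])
    show "isCont D s" unfolding D_def
      using chain[OF al_be_deriv(2)[OF ts(2)], of s, THEN DERIV_isCont] chain[OF al_be_deriv(1)[OF ts(3)], of s, THEN DERIV_isCont]
      by (intro continuous_intros)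
    show "((\<lambda>x. char_pairing \<sigma> \<phi> t x s) has_real_derivative
      \<sigma> * ((al (shft (deriv (deriv \<phi>)) s) (t + \<sigma> * s) + ga (shft \<phi> s) (t + \<sigma> * s)) * \<sigma>)
        + be (shft (deriv \<phi>) s) (t + \<sigma> * s) * \<sigma>) (at s)"
      unfolding char_pairing_def
      using chain[OF al_be_deriv(2)[OF ts(1)], of s] chain[OF al_be_deriv(1)[OF ts(2)], of s]
      by (intro DERIV_add DERIV_cmult) (simp_all add: shft_deriv)
    fix x h :: real assume h: "\<bar>h\<bar> \<le> 1"
    let ?e1 = "be (shft \<phi> (s + h)) (t + \<sigma> * x) - be (shft \<phi> s) (t + \<sigma> * x) + h * be (shft (deriv \<phi>) s) (t + \<sigma> * x)"
    let ?e2 = "al (shft (deriv \<phi>) (s + h)) (t + \<sigma> * x) - al (shft (deriv \<phi>) s) (t + \<sigma> * x) + h * al (shft (deriv (deriv \<phi>)) s) (t + \<sigma> * x)"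
    have "\<bar>char_pairing \<sigma> \<phi> t x (s + h) - char_pairing \<sigma> \<phi> t x s - h * D x\<bar> = \<bar>\<sigma> * ?e1 + ?e2\<bar>"
      unfolding char_pairing_def D_def by (simp add: algebra_simps)
    also have "\<dots> \<le> \<bar>?e1\<bar> + \<bar>?e2\<bar>"
      using abs_triangle_ineq[of "\<sigma> * ?e1" ?e2] by (simp add: abs_mult abs\<sigma>)
    also have "\<dots> \<le> (K1 + K2) * h\<^sup>2" unfolding distrib_right by (intro add_mono K1 K2 h)
    finally show "\<bar>char_pairing \<sigma> \<phi> t x (s + h) - char_pairing \<sigma> \<phi> t x s - h * D x\<bar> \<le> (K1 + K2) * h\<^sup>2" .
  qed
  moreover have "(\<sigma> * ((al (shft (deriv (deriv \<phi>)) s) (t + \<sigma> * s) + ga (shft \<phi> s) (t + \<sigma> * s)) * \<sigma>)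
        + be (shft (deriv \<phi>) s) (t + \<sigma> * s) * \<sigma>) + D s = ga (shft \<phi> s) (t + \<sigma> * s)"
  proof -
    have e: "\<sigma> * (X * \<sigma>) = X" for X using \<sigma> by algebra
    show ?thesis unfolding D_def e by simp
  qed
  ultimately show ?thesis by simp
qed

lemma char_integral:
  assumes \<phi>: "test_fun {1<..} \<phi>" and \<sigma>: "\<sigma> * \<sigma> = 1" and T: "0 \<le> T"
  shows "((\<lambda>s. ga (shft \<phi> s) (t + \<sigma> * s)) has_integral (char_pairing \<sigma> \<phi> t T T - char_pairing \<sigma> \<phi> t 0 0)) {0..T}"
  using char_deriv[OF \<phi> \<sigma>]
  by (intro fundamental_theorem_of_calculus[OF T])
    (auto simp: has_real_derivative_iff_has_vector_derivative[symmetric] intro: has_field_derivative_at_within)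

text \<open>The shifted test function lives on r > 1 + T, so only the energy beyond 1 + T enters;
  the other factor is translation invariant and hence independent of T and of time.\<close>

lemma char_bound:
  assumes \<phi>: "test_fun {1<..} \<phi>" and \<sigma>: "\<sigma> * \<sigma> = 1" and T: "0 \<le> T"
  shows "\<bar>char_pairing \<sigma> \<phi> t x T\<bar> \<le> sqrt (tail (t + \<sigma> * x) (1 + T)) *
     (2 * sqrt (LBINT r:{1<..}. (\<phi> r)\<^sup>2) + (LBINT r:{1<..}. \<bar>\<phi> r\<bar>))"
proof -
  define t' where "t' = t + \<sigma> * x"
  define \<psi> where "\<psi> = shft \<phi> T"
  have \<psi>: "test_fun {1<..} \<psi>" unfolding \<psi>_def by (rule shft_test[OF \<phi> T])
  obtain c where c: "\<And>x. c < x \<Longrightarrow> \<psi> x = 0" using test_fun_bound[OF \<psi>] by metis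
  obtain c' where c': "\<And>x. c' < x \<Longrightarrow> \<phi> x = 0" using test_fun_bound[OF \<phi>] by metis
  have cont: "continuous_on UNIV \<psi>" "continuous_on UNIV \<phi>"
    by (intro smooth_fun_continuous_on test_fun_smooth[OF \<psi>] test_fun_smooth[OF \<phi>])+
  have z: "\<psi> r = 0" if "r \<le> 1 + T" for r
    using \<phi> that unfolding test_fun_def \<psi>_def shft_def by fastforce
  have T1: "1 \<le> 1 + T" using T by simp
  have restrict: "(LBINT r:{1<..}. q r * \<psi> r) = (LBINT r:{1 + T<..}. q r * \<psi> r)" for q
    using z T by (intro set_integral_support) (auto simp: not_less)
  have L2: "(LBINT r:{1 + T<..}. (\<psi> r)\<^sup>2) = (LBINT r:{1<..}. (\<phi> r)\<^sup>2)"
    unfolding \<psi>_def shft_def using set_integral_translate(1)[of 1 T "\<lambda>r. (\<phi> r)\<^sup>2"] by simp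
  have L1: "(LBINT r:{1 + T<..}. \<bar>\<psi> r\<bar>) = (LBINT r:{1<..}. \<bar>\<phi> r\<bar>)"
    unfolding \<psi>_def shft_def using set_integral_translate(1)[of 1 T "\<lambda>r. \<bar>\<phi> r\<bar>"] by simp
  have nn: "0 \<le> (LBINT r:{1<..}. (\<phi> r)\<^sup>2)"
    by (simp add: set_lebesgue_integral_def integral_nonneg_AE)
  have le: "sqrt (rad_sq (1 + T) q) * sqrt (LBINT r:{1<..}. (\<phi> r)\<^sup>2) \<le> sqrt (tail t' (1 + T)) * sqrt (LBINT r:{1<..}. (\<phi> r)\<^sup>2)"
    if "rad_sq (1 + T) q \<le> tail t' (1 + T)" for q
    using that nn by (intro mult_right_mono real_sqrt_le_mono) auto
  have bd: "\<bar>LBINT r:{1 + T<..}. q r * r * \<psi> r\<bar> \<le> sqrt (rad_sq (1 + T) q) * sqrt (LBINT r:{1<..}. (\<phi> r)\<^sup>2)"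
    if q: "rad_L2 q" for q
    using moment_L2(2)[OF q cont(1) c T1] by (simp add: L2)
  have 1: "\<bar>be \<psi> t'\<bar> \<le> sqrt (tail t' (1 + T)) * sqrt (LBINT r:{1<..}. (\<phi> r)\<^sup>2)"
    unfolding be_def restrict
    by (rule order_trans[OF bd[OF radL2(2)] le]) (simp add: tail_def)
  have 2: "\<bar>LBINT r:{1<..}. ur t' r * r * \<psi> r\<bar> \<le> sqrt (tail t' (1 + T)) * sqrt (LBINT r:{1<..}. (\<phi> r)\<^sup>2)"
    unfolding restrict
    by (rule order_trans[OF bd[OF radL2(1)] le]) (simp add: tail_def)
  have 3: "\<bar>LBINT r:{1<..}. u t' r * \<psi> r\<bar> \<le> sqrt (tail t' (1 + T)) * (LBINT r:{1<..}. \<bar>\<phi> r\<bar>)"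
  proof -
    have a: "set_integrable lborel {1<..} (\<lambda>r. u t' r * \<psi> r)"
      using moment_u(1)[OF cont(1) c, where t = t' and k = 1] by simp
    have "continuous_on {1..} (\<lambda>r. \<bar>\<psi> r\<bar>)" by (intro continuous_intros continuous_on_subset[OF cont(1)]) auto
    then have b: "set_integrable lborel {1<..} (\<lambda>r. \<bar>\<psi> r\<bar>)" using c by (intro Ioi_integrable_compact[where b = c]) auto
    have "\<bar>LBINT r:{1 + T<..}. u t' r * \<psi> r\<bar> \<le> (LBINT r:{1 + T<..}. sqrt (tail t' (1 + T)) * \<bar>\<psi> r\<bar>)"
    proof (rule set_integral_norm_le)
      show "set_integrable lborel {1 + T<..} (\<lambda>r. sqrt (tail t' (1 + T)) * \<bar>\<psi> r\<bar>)"
        by (intro set_integrable_mult_right set_integrable_subset[OF b]) (use T in auto)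
      show "set_integrable lborel {1 + T<..} (\<lambda>r. u t' r * \<psi> r)"
        by (intro set_integrable_subset[OF a]) (use T in auto)
      fix r assume "r \<in> {1 + T<..}"
      then have r: "1 \<le> r" "1 + T \<le> r" using T by auto
      have "\<bar>u t' r\<bar> \<le> sqrt (tail t' r) / sqrt r" by (rule u_bound[OF r(1)])
      also have "\<dots> \<le> sqrt (tail t' r) / 1" using r tail_nonneg by (intro divide_left_mono) auto
      also have "\<dots> \<le> sqrt (tail t' (1 + T))" using tail_antimono[OF T1 r(2), of t'] by simp
      finally show "\<bar>u t' r * \<psi> r\<bar> \<le> sqrt (tail t' (1 + T)) * \<bar>\<psi> r\<bar>"
        by (simp add: abs_mult mult_right_mono)
    qed
    then show ?thesis unfolding restrict by (simp add: L1)
  qed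
  have abs\<sigma>: "\<bar>\<sigma>\<bar> = 1" using \<sigma> by (metis abs_mult_self_eq abs_one abs_square_eq_1 power2_eq_square)
  have "char_pairing \<sigma> \<phi> t x T = \<sigma> * be \<psi> t' - (LBINT r:{1<..}. ur t' r * r * \<psi> r) - (LBINT r:{1<..}. u t' r * \<psi> r)"
    unfolding char_pairing_def t'_def[symmetric] shft_deriv[symmetric] \<psi>_def[symmetric] al_deriv_eq[OF \<psi>] by simp
  moreover have "\<bar>\<sigma> * be \<psi> t'\<bar> = \<bar>be \<psi> t'\<bar>" by (simp add: abs_mult abs\<sigma>)
  ultimately have "\<bar>char_pairing \<sigma> \<phi> t x T\<bar> \<le> \<bar>be \<psi> t'\<bar> + \<bar>LBINT r:{1<..}. ur t' r * r * \<psi> r\<bar> + \<bar>LBINT r:{1<..}. u t' r * \<psi> r\<bar>"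
    by linarith
  also have "\<dots> \<le> sqrt (tail t' (1 + T)) * sqrt (LBINT r:{1<..}. (\<phi> r)\<^sup>2) + sqrt (tail t' (1 + T)) * sqrt (LBINT r:{1<..}. (\<phi> r)\<^sup>2)
     + sqrt (tail t' (1 + T)) * (LBINT r:{1<..}. \<bar>\<phi> r\<bar>)"
    by (intro add_mono 1 2 3)
  also have "\<dots> = sqrt (tail t' (1 + T)) * (2 * sqrt (LBINT r:{1<..}. (\<phi> r)\<^sup>2) + (LBINT r:{1<..}. \<bar>\<phi> r\<bar>))"
    by (simp add: algebra_simps)
  finally show ?thesis by (simp add: t'_def)
qed

text \<open>Time runs along with the radius, so the tails must be small uniformly in time; this is
  where \<open>tail_uniform\<close> acts.\<close>

lemma char_tendsto:
  assumes \<phi>: "test_fun {1<..} \<phi>" and \<sigma>: "\<sigma> * \<sigma> = 1"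
  shows "(\<lambda>n. char_pairing \<sigma> \<phi> t (real n) (real n)) \<longlonglongrightarrow> 0"
proof -
  define C where "C = 2 * sqrt (LBINT r:{1<..}. (\<phi> r)\<^sup>2) + (LBINT r:{1<..}. \<bar>\<phi> r\<bar>)"
  have "(\<lambda>n. sqrt (tail (t + \<sigma> * real n) (1 + real n))) \<longlonglongrightarrow> 0"
  proof (rule tendstoI)
    fix e :: real assume e: "0 < e"
    obtain R where R: "R \<ge> 1" "\<And>t r. R \<le> r \<Longrightarrow> tail t r \<le> (e / 2)\<^sup>2" using tail_uniform[of "(e / 2)\<^sup>2"] e by auto
    have "\<forall>\<^sub>F n in sequentially. R \<le> real n" using filterlim_real_sequentially unfolding filterlim_at_top by blast
    then show "\<forall>\<^sub>F n in sequentially. dist (sqrt (tail (t + \<sigma> * real n) (1 + real n))) 0 < e"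
    proof eventually_elim
      case (elim n)
      then have "sqrt (tail (t + \<sigma> * real n) (1 + real n)) \<le> e / 2" using R(2) e by (intro real_le_lsqrt) auto
      then show ?case using e tail_nonneg by (simp add: dist_real_def)
    qed
  qed
  then have "(\<lambda>n. sqrt (tail (t + \<sigma> * real n) (1 + real n)) * C) \<longlonglongrightarrow> 0" by (rule tendsto_mult_left_zero)
  then show ?thesis
    by (rule Lim_null_comparison[rotated]) (use char_bound[OF \<phi> \<sigma>] in \<open>simp add: C_def\<close>)
qed

end

subsection \<open>The Duhamel representation\<close>

lemma shifted_powr_tail:
  fixes r T p :: real
  assumes "0 < r + T" "1 < p"
  shows "set_integrable lborel {T<..} (\<lambda>s. (r + s) powr - p)"
    and "(LBINT s:{T<..}. (r + s) powr - p) = (r + T) powr (1 - p) / (p - 1)"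
  using powr_tail[OF assms] set_integral_translate[of "r + T" "- r" "\<lambda>x. x powr - p"]
  by (simp_all add: add.commute)

lemma powr_dominated:
  fixes g :: "real \<Rightarrow> real"
  assumes r: "0 < r + T" and p: "1 < p" and g: "continuous_on {T..} g"
    and bd: "\<And>s. T < s \<Longrightarrow> \<bar>g s\<bar> \<le> C * (r + s) powr - p"
  shows "set_integrable lborel {T<..} g"
    and "\<bar>LBINT s:{T<..}. g s\<bar> \<le> C * ((r + T) powr (1 - p) / (p - 1))"
proof -
  note i = set_integrable_mult_right[OF shifted_powr_tail(1)[OF r p], of C]
  show gi: "set_integrable lborel {T<..} g"
  proof (rule set_integrable_bound[OF i])
    show "set_borel_measurable lborel {T<..} g"
      unfolding set_borel_measurable_def
      using borel_measurable_continuous_on_indicator[OF _ continuous_on_subset[OF g, of "{T<..}"]]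
      by (simp add: subset_iff)
    show "AE s in lborel. s \<in> {T<..} \<longrightarrow> norm (g s) \<le> norm (C * (r + s) powr - p)"
      using bd by (intro AE_I2) (fastforce intro: order_trans abs_ge_self)
  qed
  have "\<bar>LBINT s:{T<..}. g s\<bar> \<le> (LBINT s:{T<..}. C * (r + s) powr - p)"
    by (rule set_integral_norm_le[OF i gi]) (use bd in auto)
  then show "\<bar>LBINT s:{T<..}. g s\<bar> \<le> C * ((r + T) powr (1 - p) / (p - 1))"
    by (simp only: set_integral_mult_right shifted_powr_tail(2)[OF r p])
qed

text \<open>The value at the left endpoint is the limit of the averages over shrinking intervals;
  this turns integrated bounds back into pointwise ones.\<close>

lemma abs_le_of_interval_integrals:
  fixes d :: "real \<Rightarrow> real"
  assumes ab: "a < b" and d: "continuous_on {a..b} d"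
    and bd: "\<And>x. a < x \<Longrightarrow> x < b \<Longrightarrow> \<bar>LBINT y:{a..x}. d y\<bar> \<le> L * (x - a)"
  shows "\<bar>d a\<bar> \<le> L"
proof -
  have "((\<lambda>x. integral {a..x} d) has_real_derivative d a) (at a within {a..b})"
    using d ab by (intro integral_has_real_derivative) auto
  then have "((\<lambda>x. (integral {a..x} d - integral {a..a} d) / (x - a)) \<longlongrightarrow> d a) (at a within {a..b})"
    by (simp add: has_field_derivative_iff)
  then have lim: "((\<lambda>x. \<bar>integral {a..x} d / (x - a)\<bar>) \<longlongrightarrow> \<bar>d a\<bar>) (at a within {a..b})"
    by (intro tendsto_rabs) simp
  have "\<forall>\<^sub>F x in at a within {a..b}. \<bar>integral {a..x} d / (x - a)\<bar> \<le> L"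
    unfolding eventually_at
  proof (intro exI[of _ "b - a"] conjI ballI impI)
    fix x assume x: "x \<in> {a..b}" "x \<noteq> a \<and> dist x a < b - a"
    then have x': "a < x" "x < b" by (auto simp: dist_real_def)
    have "set_integrable lborel {a..x} d"
      using x' by (intro borel_integrable_atLeastAtMost' continuous_on_subset[OF d]) auto
    then have "\<bar>integral {a..x} d\<bar> \<le> L * (x - a)"
      using bd[OF x'] set_borel_integral_eq_integral(2) by fastforce
    then show "\<bar>integral {a..x} d / (x - a)\<bar> \<le> L" using x' by (simp add: abs_divide divide_le_eq)
  qed (use ab in simp)
  moreover have "at a within {a..b} \<noteq> bot"
    unfolding at_within_Icc_at_right[OF ab] by simp
  ultimately show ?thesis by (rule tendsto_upperbound[OF lim])
qed

context compact_solution
begin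

section \<open>The nonlinearity along characteristic rays\<close>

definition F :: "real \<Rightarrow> real \<Rightarrow> real" where "F t r = (u t r) ^ 5 * r"

text \<open>Continuity in r at a fixed time is combined with continuity in t that is uniform in r
  (\<open>u_diff_dH\<close>).\<close>

lemma u_jointly_continuous: "continuous_on (UNIV \<times> {1..}) (\<lambda>(t, r). u t r)"
  unfolding continuous_on_iff
proof (intro ballI allI impI)
  fix p :: "real \<times> real" and e :: real assume p: "p \<in> UNIV \<times> {1..}" and e: "0 < e"
  obtain t r where tr: "p = (t, r)" "1 \<le> r" using p by auto
  have "\<forall>\<^sub>F s in at t. dH s t < e / 2" using order_tendstoD(2)[OF dH_tendsto, of "e / 2" t] e by simp
  then obtain d1 where d1: "d1 > 0" "\<And>s. s \<noteq> t \<Longrightarrow> dist s t < d1 \<Longrightarrow> dH s t < e / 2"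
    unfolding eventually_at by auto
  obtain d2 where d2: "d2 > 0" "\<And>x. 1 \<le> x \<Longrightarrow> dist x r < d2 \<Longrightarrow> dist (u t x) (u t r) < e / 2"
    using u_continuous[of t] tr(2) e unfolding continuous_on_iff by (metis atLeast_iff half_gt_zero)
  show "\<exists>d>0. \<forall>q\<in>UNIV \<times> {1..}. dist q p < d \<longrightarrow> dist (case q of (t, r) \<Rightarrow> u t r) (case p of (t, r) \<Rightarrow> u t r) < e"
  proof (intro exI[of _ "min d1 d2"] conjI ballI impI)
    fix q :: "real \<times> real" assume q: "q \<in> UNIV \<times> {1..}" "dist q p < min d1 d2"
    obtain s x where sx: "q = (s, x)" "1 \<le> x" using q by auto
    have ds: "dist s t < d1" "dist x r < d2"
      using dist_fst_le[of q p] dist_snd_le[of q p] q(2) by (auto simp: sx tr)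
    have "\<bar>u s x - u t x\<bar> \<le> e / 2"
    proof (cases "s = t")
      case False
      show ?thesis using u_diff_dH[OF sx(2), of s t] d1(2)[OF False ds(1)] by simp
    qed (use e in simp)
    moreover have "\<bar>u t x - u t r\<bar> < e / 2" using d2(2)[OF sx(2) ds(2)] by (simp add: dist_real_def)
    ultimately show "dist (case q of (t, r) \<Rightarrow> u t r) (case p of (t, r) \<Rightarrow> u t r) < e"
      unfolding sx tr dist_real_def prod.case by linarith
  qed (use d1 d2 in auto)
qed

lemma F_jointly_continuous:
  assumes "continuous_on A f" "continuous_on A g" "\<And>x. x \<in> A \<Longrightarrow> 1 \<le> g x"
  shows "continuous_on A (\<lambda>x. F (f x) (g x))"
proof -
  have "continuous_on A (\<lambda>x. (\<lambda>(t, r). u t r) (f x, g x))"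
    by (rule continuous_on_compose2[OF u_jointly_continuous]) (use assms in \<open>auto intro!: continuous_intros\<close>)
  then show ?thesis unfolding F_def by (intro continuous_intros assms) simp
qed

text \<open>Five factors r^(-1/2) against one factor r leave r^(-3/2), which is integrable along the
  rays.\<close>

lemma F_bound:
  assumes r: "1 \<le> r" and u: "\<bar>u t r\<bar> \<le> \<epsilon> / sqrt r"
  shows "\<bar>F t r\<bar> \<le> \<epsilon> ^ 5 * r powr - (3 / 2)"
proof -
  have "\<bar>F t r\<bar> = \<bar>u t r\<bar> ^ 5 * r" using r by (simp add: F_def abs_mult power_abs)
  also have "\<dots> \<le> (\<epsilon> / sqrt r) ^ 5 * r" using u r by (intro mult_right_mono power_mono) auto
  also have "\<dots> = \<epsilon> ^ 5 * (r / sqrt r ^ 5)" by (simp add: power_divide)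
  also have "r / sqrt r ^ 5 = r powr - (3 / 2)"
  proof -
    have "sqrt r ^ 5 = r powr (5 / 2)"
      using r by (simp add: powr_half_sqrt[symmetric] powr_realpow[symmetric] powr_powr)
    then have "r / sqrt r ^ 5 = r powr 1 / r powr (5 / 2)" using r by simp
    also have "\<dots> = r powr (1 - 5 / 2)" by (rule powr_diff[symmetric])
    finally show ?thesis by simp
  qed
  finally show ?thesis .
qed

text \<open>With v = r u, the Duhamel identities will say that
  \<open>(J 1 t r + J (-1) t r) / 2\<close> is v_r and that
  \<open>(J (-1) t r - J 1 t r) / 2\<close> is v_t.\<close>

definition J :: "real \<Rightarrow> real \<Rightarrow> real \<Rightarrow> real" where
  "J \<sigma> t r = (LBINT s:{0<..}. F (t + \<sigma> * s) (r + s))"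

lemma F_ray_continuous: "1 \<le> r \<Longrightarrow> A \<subseteq> {0..} \<Longrightarrow> continuous_on A (\<lambda>s. F (t + \<sigma> * s) (r + s))"
  by (intro F_jointly_continuous continuous_intros) auto

lemma J_tail_bound:
  assumes R: "1 \<le> R" and u: "\<And>t r. R \<le> r \<Longrightarrow> \<bar>u t r\<bar> \<le> \<epsilon> / sqrt r"
    and r: "R \<le> r" and T: "0 \<le> T"
  shows "set_integrable lborel {T<..} (\<lambda>s. F (t + \<sigma> * s) (r + s))"
    and "\<bar>LBINT s:{T<..}. F (t + \<sigma> * s) (r + s)\<bar> \<le> 2 * \<epsilon> ^ 5 * (r + T) powr - (1 / 2)"
proof -
  have bd: "\<bar>F (t + \<sigma> * s) (r + s)\<bar> \<le> \<epsilon> ^ 5 * (r + s) powr - (3 / 2)" if "T < s" for s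
    using that R r T by (intro F_bound u) auto
  have *: "0 < r + T" "(1 :: real) < 3 / 2" "continuous_on {T..} (\<lambda>s. F (t + \<sigma> * s) (r + s))"
    using R r T by (auto intro!: F_ray_continuous)
  show "set_integrable lborel {T<..} (\<lambda>s. F (t + \<sigma> * s) (r + s))"
    by (rule powr_dominated(1)[OF * bd])
  have "\<bar>LBINT s:{T<..}. F (t + \<sigma> * s) (r + s)\<bar> \<le> \<epsilon> ^ 5 * ((r + T) powr (1 - 3 / 2) / (3 / 2 - 1))"
    by (rule powr_dominated(2)[OF * bd])
  then show "\<bar>LBINT s:{T<..}. F (t + \<sigma> * s) (r + s)\<bar> \<le> 2 * \<epsilon> ^ 5 * (r + T) powr - (1 / 2)"
    by simp
qed

lemma J_bound:
  assumes "1 \<le> R" "\<And>t r. R \<le> r \<Longrightarrow> \<bar>u t r\<bar> \<le> \<epsilon> / sqrt r" "R \<le> r"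
  shows "\<bar>J \<sigma> t r\<bar> \<le> 2 * \<epsilon> ^ 5 * r powr - (1 / 2)"
  using J_tail_bound(2)[OF assms order_refl] by (simp add: J_def)

lemma J_split:
  assumes r: "1 \<le> r" and T: "0 \<le> T"
  shows "J \<sigma> t r = integral {0..T} (\<lambda>s. F (t + \<sigma> * s) (r + s)) + (LBINT s:{T<..}. F (t + \<sigma> * s) (r + s))"
proof -
  obtain C where C: "C > 0" "\<And>t r. 1 \<le> r \<Longrightarrow> \<bar>u t r\<bar> \<le> C / sqrt r" by (rule u_bounded) blast
  have i: "set_integrable lborel {T<..} (\<lambda>s. F (t + \<sigma> * s) (r + s))" if "0 \<le> T" for T
    by (rule J_tail_bound(1)[where R = 1 and \<epsilon> = C]) (use C r that in auto)
  have i0: "set_integrable lborel {0..T} (\<lambda>s. F (t + \<sigma> * s) (r + s))"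
    using r by (intro borel_integrable_atLeastAtMost' F_ray_continuous) auto
  have "{0<..} = {0<..T} \<union> {T<..}" using T by auto
  moreover have "(LBINT s:{0<..T} \<union> {T<..}. F (t + \<sigma> * s) (r + s)) = (LBINT s:{0<..T}. F (t + \<sigma> * s) (r + s)) + (LBINT s:{T<..}. F (t + \<sigma> * s) (r + s))"
    by (rule set_integral_Un) (auto intro!: i T intro: set_integrable_subset[OF i[OF order_refl]])
  ultimately have "J \<sigma> t r = (LBINT s:{0..T}. F (t + \<sigma> * s) (r + s)) + (LBINT s:{T<..}. F (t + \<sigma> * s) (r + s))"
    by (simp add: J_def set_integral_Icc_Ioc(1))
  then show ?thesis using set_borel_integral_eq_integral(2)[OF i0] by simp
qed

text \<open>The truncated ray integral is what \<open>char_integral\<close> produces. Its distance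
  to \<open>J\<close> is bounded uniformly in r, so both the continuity of \<open>J\<close> and the
  limit of infinite time go through it.\<close>

definition JT :: "real \<Rightarrow> real \<Rightarrow> real \<Rightarrow> real \<Rightarrow> real" where
  "JT T \<sigma> t r = integral {0..T} (\<lambda>s. F (t + \<sigma> * s) (r + s))"

lemma JT_continuous: "continuous_on {1..} (JT T \<sigma> t)"
proof -
  have "continuous_on ({1..} \<times> cbox 0 T) (\<lambda>(r, s). F (t + \<sigma> * s) (r + s))"
    unfolding case_prod_beta by (intro F_jointly_continuous continuous_intros) auto
  from integral_continuous_on_param[OF this] show ?thesis
    unfolding JT_def[abs_def] by simp
qed

lemma JT_approx:
  obtains C where "0 \<le> C" "\<And>n r. 1 \<le> r \<Longrightarrow> \<bar>J \<sigma> t r - JT (real n) \<sigma> t r\<bar> \<le> C * (1 + real n) powr - (1 / 2)"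
proof -
  obtain C where C: "C > 0" "\<And>t r. 1 \<le> r \<Longrightarrow> \<bar>u t r\<bar> \<le> C / sqrt r" by (rule u_bounded) blast
  show ?thesis
  proof (rule that)
    fix n :: nat and r :: real assume r: "1 \<le> r"
    have "\<bar>J \<sigma> t r - JT (real n) \<sigma> t r\<bar> \<le> 2 * C ^ 5 * (r + real n) powr - (1 / 2)"
      using J_tail_bound(2)[OF order_refl C(2) r, of "real n" t \<sigma>] J_split[OF r, of "real n" \<sigma> t]
      by (simp add: JT_def)
    also have "\<dots> \<le> 2 * C ^ 5 * (1 + real n) powr - (1 / 2)"
      using r C(1) by (intro mult_left_mono powr_mono2') auto
    finally show "\<bar>J \<sigma> t r - JT (real n) \<sigma> t r\<bar> \<le> 2 * C ^ 5 * (1 + real n) powr - (1 / 2)" .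
  qed (use C in simp)
qed

lemma powr_minus_half_tendsto: "(\<lambda>n. (1 + real n) powr - (1 / 2)) \<longlonglongrightarrow> 0"
  by (intro tendsto_neg_powr filterlim_tendsto_add_at_top[OF tendsto_const] filterlim_real_sequentially) simp

lemma J_continuous: "continuous_on {1..} (J \<sigma> t)"
proof -
  obtain C where C: "0 \<le> C" "\<And>n r. 1 \<le> r \<Longrightarrow> \<bar>J \<sigma> t r - JT (real n) \<sigma> t r\<bar> \<le> C * (1 + real n) powr - (1 / 2)"
    by (rule JT_approx[of \<sigma> t]) blast
  have lim: "(\<lambda>n. C * (1 + real n) powr - (1 / 2)) \<longlonglongrightarrow> 0"
    using tendsto_mult_right_zero[OF powr_minus_half_tendsto] .
  have "uniform_limit {1..} (\<lambda>n. JT (real n) \<sigma> t) (J \<sigma> t) sequentially"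
  proof (rule uniform_limitI)
    fix e :: real assume "0 < e"
    then have "\<forall>\<^sub>F n in sequentially. C * (1 + real n) powr - (1 / 2) < e" by (rule order_tendstoD(2)[OF lim])
    then show "\<forall>\<^sub>F n in sequentially. \<forall>r\<in>{1..}. dist (JT (real n) \<sigma> t r) (J \<sigma> t r) < e"
    proof eventually_elim
      case (elim n)
      show ?case
      proof
        fix r :: real assume "r \<in> {1..}"
        then show "dist (JT (real n) \<sigma> t r) (J \<sigma> t r) < e"
          using C(2)[of r n] elim by (simp add: dist_real_def abs_minus_commute)
      qed
    qed
  qed
  then show ?thesis by (intro uniform_limit_theorem[OF always_eventually]) (auto intro: JT_continuous)
qed

lemma Ioi_integrable_mult_test:
  assumes f: "continuous_on {1..} f" and \<phi>: "test_fun {1<..} \<phi>"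
  shows "set_integrable lborel {1<..} (\<lambda>r. f r * \<phi> r)"
proof -
  obtain c where c: "\<And>x. c < x \<Longrightarrow> \<phi> x = 0" using test_fun_bound[OF \<phi>] by metis
  then show ?thesis
    by (intro Ioi_integrable_compact[where b = c] continuous_intros f smooth_fun_continuous_on test_fun_smooth[OF \<phi>]) auto
qed

text \<open>Translating by s puts the support of the integrand into a fixed interval, so that the s
  and r integrals in \<open>char_JT\<close> run over a rectangle and can be exchanged.\<close>

lemma ga_shft:
  assumes \<phi>: "test_fun {1<..} \<phi>" and ab: "1 < a" "\<And>x. x \<notin> {a<..<b} \<Longrightarrow> \<phi> x = 0" and s: "0 \<le> s"
  shows "ga (shft \<phi> s) t = integral {a..b} (\<lambda>r. F t (r + s) * \<phi> r)"
proof -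
  have "ga (shft \<phi> s) t = (LBINT r:{1 + s<..}. F t (r - s + s) * \<phi> (r - s))"
    unfolding ga_def shft_def F_def
    using ab s by (subst set_integral_support(1)[of "{1 + s<..}" "{1<..}"]) (auto simp: not_less)
  also have "\<dots> = (LBINT r:{1<..}. F t (r + s) * \<phi> r)"
    by (rule set_integral_translate(1))
  also have "\<dots> = (LBINT r:{a..b}. F t (r + s) * \<phi> r)"
    using ab by (intro set_integral_support(1)) auto
  also have "\<dots> = integral {a..b} (\<lambda>r. F t (r + s) * \<phi> r)"
    using ab(1) s
    by (intro set_borel_integral_eq_integral(2) borel_integrable_atLeastAtMost' continuous_intros
        F_jointly_continuous smooth_fun_continuous_on test_fun_smooth[OF \<phi>]) auto
  finally show ?thesis .
qed

lemma char_JT: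
  assumes \<phi>: "test_fun {1<..} \<phi>" and \<sigma>: "\<sigma> * \<sigma> = 1"
  shows "char_pairing \<sigma> \<phi> t (real n) (real n) - char_pairing \<sigma> \<phi> t 0 0 = (LBINT r:{1<..}. JT (real n) \<sigma> t r * \<phi> r)"
proof -
  obtain a b where ab: "a < b" "{a..b} \<subseteq> {1<..}" "\<And>x. x \<notin> {a<..<b} \<Longrightarrow> \<phi> x = 0"
    using test_fun_support[OF \<phi> Ioi_interval] by metis
  have a: "1 < a" using ab by (auto simp: Icc_subset_Ioi)
  have "char_pairing \<sigma> \<phi> t (real n) (real n) - char_pairing \<sigma> \<phi> t 0 0 = integral {0..real n} (\<lambda>s. ga (shft \<phi> s) (t + \<sigma> * s))"
    using char_integral[OF \<phi> \<sigma>, of "real n" t] by (simp add: integral_unique)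
  also have "\<dots> = integral {0..real n} (\<lambda>s. integral {a..b} (\<lambda>r. F (t + \<sigma> * s) (r + s) * \<phi> r))"
    by (intro integral_cong ga_shft[OF \<phi> a ab(3)]) auto
  also have "\<dots> = integral {a..b} (\<lambda>r. integral {0..real n} (\<lambda>s. F (t + \<sigma> * s) (r + s) * \<phi> r))"
  proof -
    have "continuous_on (cbox (0, a) (real n, b)) (\<lambda>p. F (t + \<sigma> * fst p) (snd p + fst p) * \<phi> (snd p))"
      using a by (intro continuous_intros F_jointly_continuous
          continuous_on_compose2[OF smooth_fun_continuous_on[OF test_fun_smooth[OF \<phi>], of UNIV]])
        (auto simp: cbox_Pair_eq)
    then have "continuous_on (cbox (0, a) (real n, b)) (\<lambda>(s, r). F (t + \<sigma> * s) (r + s) * \<phi> r)"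
      by (simp add: case_prod_beta)
    from integral_swap_continuous[OF this] show ?thesis by simp
  qed
  also have "\<dots> = integral {a..b} (\<lambda>r. JT (real n) \<sigma> t r * \<phi> r)"
    by (simp add: JT_def)
  also have "\<dots> = (LBINT r:{a..b}. JT (real n) \<sigma> t r * \<phi> r)"
    using a by (intro set_borel_integral_eq_integral(2)[symmetric] borel_integrable_atLeastAtMost' continuous_intros
        continuous_on_subset[OF JT_continuous] smooth_fun_continuous_on test_fun_smooth[OF \<phi>]) auto
  also have "\<dots> = (LBINT r:{1<..}. JT (real n) \<sigma> t r * \<phi> r)"
    using ab by (intro set_integral_support(1)[symmetric]) auto
  finally show ?thesis .
qed

text \<open>Precompactness removes the boundary term at infinity, so the field is entirely
  radiated by its own nonlinearity.\<close>

lemma Duhamel: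
  assumes \<phi>: "test_fun {1<..} \<phi>" and \<sigma>: "\<sigma> * \<sigma> = 1"
  shows "\<sigma> * be \<phi> t + al (deriv \<phi>) t = - (LBINT r:{1<..}. J \<sigma> t r * \<phi> r)"
proof -
  obtain C where C: "0 \<le> C" "\<And>n r. 1 \<le> r \<Longrightarrow> \<bar>J \<sigma> t r - JT (real n) \<sigma> t r\<bar> \<le> C * (1 + real n) powr - (1 / 2)"
    by (rule JT_approx[of \<sigma> t]) blast
  have i\<phi>: "set_integrable lborel {1<..} (\<lambda>r. \<bar>\<phi> r\<bar>)"
    using set_integrable_abs[OF Ioi_integrable_mult_test[of "\<lambda>r. 1", OF _ \<phi>]] by simp
  note iJ = Ioi_integrable_mult_test[OF J_continuous \<phi>]
  note iT = Ioi_integrable_mult_test[OF JT_continuous \<phi>]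
  have "(\<lambda>n. LBINT r:{1<..}. JT (real n) \<sigma> t r * \<phi> r) \<longlonglongrightarrow> (LBINT r:{1<..}. J \<sigma> t r * \<phi> r)"
  proof -
    have "\<bar>(LBINT r:{1<..}. J \<sigma> t r * \<phi> r) - (LBINT r:{1<..}. JT (real n) \<sigma> t r * \<phi> r)\<bar>
       \<le> C * (1 + real n) powr - (1 / 2) * (LBINT r:{1<..}. \<bar>\<phi> r\<bar>)" for n
    proof -
      have "\<bar>LBINT r:{1<..}. J \<sigma> t r * \<phi> r - JT (real n) \<sigma> t r * \<phi> r\<bar>
         \<le> (LBINT r:{1<..}. C * (1 + real n) powr - (1 / 2) * \<bar>\<phi> r\<bar>)"
      proof (rule set_integral_norm_le)
        fix r :: real assume "r \<in> {1<..}"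
        then show "\<bar>J \<sigma> t r * \<phi> r - JT (real n) \<sigma> t r * \<phi> r\<bar> \<le> C * (1 + real n) powr - (1 / 2) * \<bar>\<phi> r\<bar>"
          unfolding left_diff_distrib[symmetric] abs_mult by (intro mult_right_mono C(2)) auto
      qed (intro set_integrable_mult_right i\<phi> set_integral_diff(1) iJ iT)+
      also have "\<dots> = C * (1 + real n) powr - (1 / 2) * (LBINT r:{1<..}. \<bar>\<phi> r\<bar>)"
        by (rule set_integral_mult_right)
      finally show ?thesis unfolding set_integral_diff(2)[OF iJ iT] .
    qed
    then have "(\<lambda>n. (LBINT r:{1<..}. J \<sigma> t r * \<phi> r) - (LBINT r:{1<..}. JT (real n) \<sigma> t r * \<phi> r)) \<longlonglongrightarrow> 0"
      by (intro Lim_null_comparison[OF _ tendsto_mult_left_zero[OF tendsto_mult_right_zero[OF powr_minus_half_tendsto, of C],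
            of "LBINT r:{1<..}. \<bar>\<phi> r\<bar>"]]) simp
    from tendsto_diff[OF tendsto_const this, of "LBINT r:{1<..}. J \<sigma> t r * \<phi> r"] show ?thesis by simp
  qed
  moreover have "(\<lambda>n. LBINT r:{1<..}. JT (real n) \<sigma> t r * \<phi> r) \<longlonglongrightarrow> 0 - char_pairing \<sigma> \<phi> t 0 0"
    unfolding char_JT[OF \<phi> \<sigma>, symmetric] by (intro tendsto_diff char_tendsto[OF \<phi> \<sigma>] tendsto_const)
  ultimately have "(LBINT r:{1<..}. J \<sigma> t r * \<phi> r) = 0 - char_pairing \<sigma> \<phi> t 0 0" by (rule LIMSEQ_unique)
  then show ?thesis by (simp add: char_pairing_def shft_def)
qed

text \<open>In the sum of the Duhamel identities for \<sigma> = 1 and \<sigma> = -1 the velocity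
  cancels; as the right-hand side is continuous in r, the weak derivative of v is classical.\<close>

lemma v_deriv:
  assumes r: "1 < r"
  shows "((\<lambda>r. u t r * r) has_real_derivative (J 1 t r + J (-1) t r) / 2) (at r)"
proof (rule weak_derivative_classical[OF Ioi_interval(1,3)])
  show "r \<in> {1<..}" using r by simp
  show "continuous_on {1<..} (\<lambda>r. u t r * r)"
    by (intro continuous_intros continuous_on_subset[OF u_continuous]) auto
  show "continuous_on {1<..} (\<lambda>r. (J 1 t r + J (-1) t r) / 2)"
    by (intro continuous_intros continuous_on_subset[OF J_continuous]) auto
  fix \<phi> assume \<phi>: "test_fun {1<..} \<phi>"
  note iJ = Ioi_integrable_mult_test[OF J_continuous \<phi>]
  have "(LBINT x:{1<..}. (J 1 t x + J (-1) t x) / 2 * \<phi> x)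
     = (LBINT x:{1<..}. (1 / 2) * (J 1 t x * \<phi> x + J (-1) t x * \<phi> x))"
  proof -
    have "(x + y) / 2 * z = (1 / 2) * (x * z + y * z)" for x y z :: real by (simp add: field_simps)
    then show ?thesis by (simp only:)
  qed
  also have "\<dots> = (1 / 2) * ((LBINT x:{1<..}. J 1 t x * \<phi> x) + (LBINT x:{1<..}. J (-1) t x * \<phi> x))"
    unfolding set_integral_mult_right set_integral_add(2)[OF iJ iJ] ..
  also have "\<dots> = - al (deriv \<phi>) t"
    using Duhamel[OF \<phi>, of 1 t] Duhamel[OF \<phi>, of "-1" t] by simp
  finally show "(LBINT x:{1<..}. u t x * x * deriv \<phi> x) = - (LBINT x:{1<..}. (J 1 t x + J (-1) t x) / 2 * \<phi> x)"
    by (simp add: al_def)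
qed

text \<open>In the difference of the two Duhamel identities v_r cancels, leaving v_t as a bounded
  ray integral. As \<open>U1\<close> is only an L^2 function, the bound is put on its pairing with
  cutoffs, carried over to increments of \<open>al\<close> by the mean value inequality, and made
  pointwise by letting the cutoffs fill an interval and then shrinking the interval.\<close>

lemma time_lipschitz:
  obtains C where "0 \<le> C" "\<And>t h r. 1 < r \<Longrightarrow> \<bar>(u (t + h) r - u t r) * r\<bar> \<le> \<bar>h\<bar> * C * r powr - (1 / 2)"
proof -
  obtain C where C: "C > 0" "\<And>t r. 1 \<le> r \<Longrightarrow> \<bar>u t r\<bar> \<le> C / sqrt r" by (rule u_bounded) blast
  define B where "B = 2 * C ^ 5"
  have B0: "0 \<le> B" using C by (simp add: B_def)
  have beb: "\<bar>be (cutoff a b n) t\<bar> \<le> B * a powr - (1 / 2) * (b - a)" if ab: "1 < a" "a < b" for a b n t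
  proof -
    have \<phi>: "test_fun {1<..} (cutoff a b n)" using ab by (intro cutoff_test_fun) auto
    have le: "\<bar>LBINT r:{1<..}. J \<sigma> t r * cutoff a b n r\<bar> \<le> B * a powr - (1 / 2) * (b - a)" for \<sigma>
    proof -
      have "(LBINT r:{1<..}. J \<sigma> t r * cutoff a b n r) = (LBINT r:{a..b}. J \<sigma> t r * cutoff a b n r)"
        using ab by (intro set_integral_support(1)) (auto simp: cutoff_outside)
      also have "\<bar>LBINT r:{a..b}. J \<sigma> t r * cutoff a b n r\<bar> \<le> (LBINT r:{a..b}. B * a powr - (1 / 2))"
      proof (rule set_integral_norm_le)
        show "set_integrable lborel {a..b} (\<lambda>r. J \<sigma> t r * cutoff a b n r)"
          by (rule set_integrable_subset[OF Ioi_integrable_mult_test[OF J_continuous \<phi>]]) (use ab in auto)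
        fix r assume r: "r \<in> {a..b}"
        have "\<bar>J \<sigma> t r\<bar> \<le> B * r powr - (1 / 2)"
          unfolding B_def by (rule J_bound[OF order_refl C(2)]) (use r ab in auto)
        also have "\<dots> \<le> B * a powr - (1 / 2)" using r ab B0 by (intro mult_left_mono powr_mono2') auto
        finally have "\<bar>J \<sigma> t r\<bar> * \<bar>cutoff a b n r\<bar> \<le> (B * a powr - (1 / 2)) * 1"
          using cutoff_bounds[of a b n r] B0 by (intro mult_mono) auto
        then show "\<bar>J \<sigma> t r * cutoff a b n r\<bar> \<le> B * a powr - (1 / 2)" by (simp add: abs_mult)
      qed (rule set_integrable_continuous, simp)
      also have "\<dots> = B * a powr - (1 / 2) * (b - a)"
        using ab by (simp add: set_integral_const)
      finally show ?thesis .
    qed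
    have "2 * be (cutoff a b n) t = (LBINT r:{1<..}. J (-1) t r * cutoff a b n r) - (LBINT r:{1<..}. J 1 t r * cutoff a b n r)"
      using Duhamel[OF \<phi>, of 1 t] Duhamel[OF \<phi>, of "-1" t] by simp
    then show ?thesis using le[of 1] le[of "-1"] by linarith
  qed
  have int: "\<bar>LBINT r:{a..b}. (u (t + h) r - u t r) * r\<bar> \<le> (\<bar>h\<bar> * B * a powr - (1 / 2)) * (b - a)"
    if ab: "1 < a" "a < b" for a b t h
  proof -
    have \<phi>: "test_fun {1<..} (cutoff a b n)" for n using ab by (intro cutoff_test_fun) auto
    have cu: "continuous_on {1..} (\<lambda>r. u t r * r)" for t
      by (intro continuous_intros u_continuous)
    have di: "set_integrable lborel {a..b} (\<lambda>r. (u (t + h) r - u t r) * r)"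
      using ab by (intro borel_integrable_atLeastAtMost' continuous_intros continuous_on_subset[OF u_continuous]) auto
    have "(\<lambda>n. \<bar>LBINT r:{1<..}. ((u (t + h) r - u t r) * r) * cutoff a b n r\<bar>) \<longlonglongrightarrow> \<bar>LBINT r:{a..b}. (u (t + h) r - u t r) * r\<bar>"
      using ab by (intro tendsto_rabs cutoff_integral_tendsto di) auto
    then show ?thesis
    proof (rule tendsto_upperbound)
      have "\<bar>LBINT r:{1<..}. ((u (t + h) r - u t r) * r) * cutoff a b n r\<bar> \<le> (\<bar>h\<bar> * B * a powr - (1 / 2)) * (b - a)" for n
      proof -
        have "(LBINT r:{1<..}. ((u (t + h) r - u t r) * r) * cutoff a b n r)
           = (LBINT r:{1<..}. u (t + h) r * r * cutoff a b n r - u t r * r * cutoff a b n r)"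
          by (simp add: algebra_simps)
        also have "\<dots> = al (cutoff a b n) (t + h) - al (cutoff a b n) t"
          unfolding al_def by (rule set_integral_diff(2)[OF Ioi_integrable_mult_test[OF cu \<phi>] Ioi_integrable_mult_test[OF cu \<phi>]])
        finally have eq: "(LBINT r:{1<..}. ((u (t + h) r - u t r) * r) * cutoff a b n r) = al (cutoff a b n) (t + h) - al (cutoff a b n) t" .
        have "norm (al (cutoff a b n) (t + h) - al (cutoff a b n) t) \<le> (B * a powr - (1 / 2) * (b - a)) * norm (t + h - t)"
          by (rule field_differentiable_bound[of UNIV _ "be (cutoff a b n)"])
            (use beb[OF ab] al_be_deriv(1)[OF \<phi>] in auto)
        then show ?thesis unfolding eq by (simp add: mult_ac)
      qed
      then show "\<forall>\<^sub>F n in sequentially. \<bar>LBINT r:{1<..}. ((u (t + h) r - u t r) * r) * cutoff a b n r\<bar> \<le> (\<bar>h\<bar> * B * a powr - (1 / 2)) * (b - a)"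
        by simp
    qed simp
  qed
  show ?thesis
  proof (rule that[OF B0])
    fix t h r :: real assume r: "1 < r"
    show "\<bar>(u (t + h) r - u t r) * r\<bar> \<le> \<bar>h\<bar> * B * r powr - (1 / 2)"
    proof (rule abs_le_of_interval_integrals[of r "r + 1" "\<lambda>r. (u (t + h) r - u t r) * r"])
      show "continuous_on {r..r + 1} (\<lambda>r. (u (t + h) r - u t r) * r)"
        using r by (intro continuous_intros continuous_on_subset[OF u_continuous]) auto
    qed (use int r in auto)
  qed
qed

subsection \<open>Stationarity\<close>

text \<open>The Lipschitz factor 5 (\<epsilon> / r^(1/2))^4 of the fifth power turns r^(-k) into
  r^(-k-2); the ray integral gives one power back with 1/(k + 1), and integrating v_r from infinity
  gives back another with 1/k. The bound is assumed at all times because the rays meet all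
  times.\<close>

lemma difference_halves:
  fixes k A \<epsilon> R h :: real
  assumes k: "0 < k" and A: "0 \<le> A" and \<epsilon>: "0 \<le> \<epsilon>" "5 * \<epsilon> ^ 4 / (k * (k + 1)) \<le> 1 / 2" and R: "1 \<le> R"
    and u: "\<And>t r. R \<le> r \<Longrightarrow> \<bar>u t r\<bar> \<le> \<epsilon> / sqrt r"
    and d: "\<And>t r. R \<le> r \<Longrightarrow> 1 < r \<Longrightarrow> \<bar>(u (t + h) r - u t r) * r\<bar> \<le> A * r powr - k"
    and r: "R \<le> r" "1 < r"
  shows "\<bar>(u (t + h) r - u t r) * r\<bar> \<le> (A / 2) * r powr - k"
proof -
  define B where "B = 5 * \<epsilon> ^ 4 * A"
  have B: "0 \<le> B" using A by (simp add: B_def)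
  have Fd: "\<bar>F (t + h) \<rho> - F t \<rho>\<bar> \<le> B * \<rho> powr - (k + 2)" if \<rho>: "R \<le> \<rho>" "1 < \<rho>" for t \<rho>
  proof -
    have "\<bar>F (t + h) \<rho> - F t \<rho>\<bar> = \<bar>u (t + h) \<rho> ^ 5 - u t \<rho> ^ 5\<bar> * \<rho>"
      using \<rho> by (simp add: F_def abs_mult flip: left_diff_distrib)
    also have "\<dots> \<le> 5 * (\<epsilon> / sqrt \<rho>) ^ 4 * \<bar>u (t + h) \<rho> - u t \<rho>\<bar> * \<rho>"
      using \<rho> by (intro mult_right_mono abs_power5_diff u) auto
    also have "\<dots> = 5 * (\<epsilon> / sqrt \<rho>) ^ 4 * \<bar>(u (t + h) \<rho> - u t \<rho>) * \<rho>\<bar>"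
      using \<rho> by (simp add: abs_mult)
    also have "\<dots> \<le> 5 * (\<epsilon> / sqrt \<rho>) ^ 4 * (A * \<rho> powr - k)"
      using \<rho> d \<epsilon> by (intro mult_left_mono) auto
    also have "\<dots> = B * (\<rho> powr - k / sqrt \<rho> ^ 4)" by (simp add: B_def power_divide)
    also have "\<rho> powr - k / sqrt \<rho> ^ 4 = \<rho> powr - (k + 2)"
    proof -
      have "sqrt \<rho> ^ 4 = (sqrt \<rho> ^ 2) ^ 2" by simp
      also have "\<dots> = \<rho> powr 2" using \<rho> by (simp add: powr_numeral)
      finally have "\<rho> powr - k / sqrt \<rho> ^ 4 = \<rho> powr - k / \<rho> powr 2" by simp
      also have "\<dots> = \<rho> powr (- k - 2)" by (rule powr_diff[symmetric])
      finally show ?thesis by simp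
    qed
    finally show ?thesis .
  qed
  have Jd: "\<bar>J \<sigma> (t + h) x - J \<sigma> t x\<bar> \<le> B * (x powr - (k + 1) / (k + 1))" if x: "R \<le> x" "1 < x" for \<sigma> x
  proof -
    have i: "set_integrable lborel {0<..} (\<lambda>s. F (t + \<sigma> * s) (x + s))" for t
      by (rule J_tail_bound(1)[OF R u x(1) order_refl])
    have "J \<sigma> (t + h) x - J \<sigma> t x = (LBINT s:{0<..}. F (t + h + \<sigma> * s) (x + s) - F (t + \<sigma> * s) (x + s))"
      unfolding J_def by (rule set_integral_diff(2)[symmetric, OF i i])
    moreover have "\<bar>LBINT s:{0<..}. F (t + h + \<sigma> * s) (x + s) - F (t + \<sigma> * s) (x + s)\<bar>
        \<le> B * ((x + 0) powr (1 - (k + 2)) / ((k + 2) - 1))"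
    proof (rule powr_dominated(2))
      show "continuous_on {0..} (\<lambda>s. F (t + h + \<sigma> * s) (x + s) - F (t + \<sigma> * s) (x + s))"
        using x by (intro continuous_intros F_ray_continuous) auto
      show "\<bar>F (t + h + \<sigma> * s) (x + s) - F (t + \<sigma> * s) (x + s)\<bar> \<le> B * (x + s) powr - (k + 2)" if "0 < s" for s
        using Fd[of "x + s" "t + \<sigma> * s"] that x by (simp add: add_ac)
    qed (use x k in auto)
    moreover have "1 - (k + 2) = - (k + 1)" "k + 2 - 1 = k + 1" by simp_all
    ultimately show ?thesis by simp
  qed
  \<comment> \<open>c x^(-k) is the integral from x to infinity of the bound B x^(-k-1) / (k + 1) on
    the derivative of \<open>g\<close>.\<close>
  define c where "c = B / (k * (k + 1))"
  have c: "0 \<le> c" "c \<le> A / 2"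
  proof -
    show "0 \<le> c" using B k by (simp add: c_def)
    have "c = (5 * \<epsilon> ^ 4 / (k * (k + 1))) * A" by (simp add: c_def B_def)
    also have "\<dots> \<le> (1 / 2) * A" by (intro mult_right_mono \<epsilon> A)
    finally show "c \<le> A / 2" by simp
  qed
  define g where "g x = (u (t + h) x - u t x) * x" for x
  have gd: "(g has_real_derivative (J 1 (t + h) x + J (-1) (t + h) x) / 2 - (J 1 t x + J (-1) t x) / 2) (at x)" if "1 < x" for x
    unfolding g_def left_diff_distrib by (intro DERIV_diff v_deriv that)
  have pd: "((\<lambda>x. c * x powr - k) has_real_derivative - (B * (x powr - (k + 1) / (k + 1)))) (at x)" if "1 < x" for x
  proof -
    have "((\<lambda>x. c * x powr - k) has_real_derivative c * (- k * x powr (- k - 1))) (at x)"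
      using that by (auto intro!: derivative_eq_intros)
    moreover have "c * (- k * x powr (- k - 1)) = - (B * (x powr - (k + 1) / (k + 1)))"
    proof -
      have "- k - 1 = - (k + 1)" by simp
      then show ?thesis using k by (simp add: c_def)
    qed
    ultimately show ?thesis by simp
  qed
  have gJ: "\<bar>(J 1 (t + h) x + J (-1) (t + h) x) / 2 - (J 1 t x + J (-1) t x) / 2\<bar> \<le> B * (x powr - (k + 1) / (k + 1))"
    if "R \<le> x" "1 < x" for x
  proof -
    have avg: "\<bar>(a' + b') / 2 - (a + b) / 2\<bar> \<le> X" if "\<bar>a' - a\<bar> \<le> X" "\<bar>b' - b\<bar> \<le> X" for a a' b b' X :: real
      using that by argo
    show ?thesis by (rule avg[OF Jd[OF that] Jd[OF that]])
  qed
  have lim0: "((\<lambda>x. g x) \<longlongrightarrow> 0) at_top"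
  proof (rule Lim_null_comparison)
    show "\<forall>\<^sub>F x in at_top. norm (g x) \<le> A * x powr - k"
      using eventually_ge_at_top[of R] eventually_gt_at_top[of 1]
      by eventually_elim (use d in \<open>simp add: g_def\<close>)
    show "((\<lambda>x. A * x powr - k) \<longlongrightarrow> 0) at_top"
      using k by (intro tendsto_mult_right_zero tendsto_neg_powr filterlim_ident) auto
  qed
  have limc: "((\<lambda>x. c * x powr - k) \<longlongrightarrow> 0) at_top"
    using k by (intro tendsto_mult_right_zero tendsto_neg_powr filterlim_ident) auto
  \<comment> \<open>For either sign s, s g + c x^(-k) is nonincreasing and tends to 0 at infinity,
    hence is nonnegative; \<open>g\<close> itself tends to 0 by the assumed power bound.\<close>
  have main: "s * g r \<ge> - (c * r powr - k)" if s: "s = 1 \<or> s = -1" for s :: real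
  proof -
    have "((\<lambda>x. s * g x + c * x powr - k) \<longlongrightarrow> s * 0 + 0) at_top"
      by (intro tendsto_intros lim0 limc)
    moreover have "\<forall>\<^sub>F x in at_top. s * g x + c * x powr - k \<le> s * g r + c * r powr - k"
      using eventually_ge_at_top[of r]
    proof eventually_elim
      case (elim x)
      show ?case
      proof (rule DERIV_nonpos_imp_nonincreasing[OF elim])
        fix y assume y: "r \<le> y" "y \<le> x"
        then have y': "R \<le> y" "1 < y" using r by auto
        have "((\<lambda>x. s * g x + c * x powr - k) has_real_derivative
           s * ((J 1 (t + h) y + J (-1) (t + h) y) / 2 - (J 1 t y + J (-1) t y) / 2) + - (B * (y powr - (k + 1) / (k + 1)))) (at y)"
          by (intro DERIV_add DERIV_cmult gd pd y')
        moreover have "s * ((J 1 (t + h) y + J (-1) (t + h) y) / 2 - (J 1 t y + J (-1) t y) / 2) + - (B * (y powr - (k + 1) / (k + 1))) \<le> 0"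
          using gJ[OF y'] s by auto
        ultimately show "\<exists>z. ((\<lambda>x. s * g x + c * x powr - k) has_real_derivative z) (at y) \<and> z \<le> 0" by blast
      qed
    qed
    ultimately have "s * 0 + 0 \<le> s * g r + c * r powr - k"
      by (intro tendsto_upperbound) auto
    then show ?thesis by simp
  qed
  have "\<bar>g r\<bar> \<le> c * r powr - k" using main[of 1] main[of "-1"] by auto
  also have "\<dots> \<le> (A / 2) * r powr - k" using c by (intro mult_right_mono) auto
  finally show ?thesis by (simp add: g_def)
qed

lemma difference_vanishes:
  fixes k A \<epsilon> R h :: real
  assumes k: "0 < k" and A: "0 \<le> A" and \<epsilon>: "0 \<le> \<epsilon>" "5 * \<epsilon> ^ 4 / (k * (k + 1)) \<le> 1 / 2" and R: "1 \<le> R"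
    and u: "\<And>t r. R \<le> r \<Longrightarrow> \<bar>u t r\<bar> \<le> \<epsilon> / sqrt r"
    and d: "\<And>t r. R \<le> r \<Longrightarrow> 1 < r \<Longrightarrow> \<bar>(u (t + h) r - u t r) * r\<bar> \<le> A * r powr - k"
    and r: "R \<le> r" "1 < r"
  shows "u (t + h) r = u t r"
proof -
  have "\<forall>t r. R \<le> r \<longrightarrow> 1 < r \<longrightarrow> \<bar>(u (t + h) r - u t r) * r\<bar> \<le> (A / 2 ^ n) * r powr - k" for n
  proof (induction n)
    case (Suc n)
    show ?case
    proof (intro allI impI)
      fix t r :: real assume "R \<le> r" "1 < r"
      then have "\<bar>(u (t + h) r - u t r) * r\<bar> \<le> ((A / 2 ^ n) / 2) * r powr - k"
        using Suc A by (intro difference_halves[OF k _ \<epsilon> R u]) auto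
      then show "\<bar>(u (t + h) r - u t r) * r\<bar> \<le> (A / 2 ^ Suc n) * r powr - k" by simp
    qed
  qed (use d in auto)
  then have le: "\<bar>(u (t + h) r - u t r) * r\<bar> \<le> (A * r powr - k) * (1 / 2) ^ n" for n
    using r by (simp add: power_one_over)
  have "(\<lambda>n. (A * r powr - k) * (1 / 2) ^ n) \<longlonglongrightarrow> (A * r powr - k) * 0"
    by (intro tendsto_mult tendsto_const LIMSEQ_realpow_zero) auto
  then have "\<bar>(u (t + h) r - u t r) * r\<bar> \<le> 0"
    using le by (intro LIMSEQ_le_const) auto
  then show ?thesis using r by simp
qed

lemma stationary:
  assumes r: "1 < r" shows "u (t + h) r = u t r"
proof -
  obtain L where L: "0 \<le> L" "\<And>t h r. 1 < r \<Longrightarrow> \<bar>(u (t + h) r - u t r) * r\<bar> \<le> \<bar>h\<bar> * L * r powr - (1 / 2)"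
    by (rule time_lipschitz) blast
  \<comment> \<open>The power k = 1/2 is the one that \<open>time_lipschitz\<close> offers; with
    \<epsilon> = 1/4 the factor 5 \<epsilon>^4 / (k (k + 1)) is 5/192, well below 1/2.\<close>
  obtain R where R: "1 \<le> R" "\<And>t r. R \<le> r \<Longrightarrow> \<bar>u t r\<bar> \<le> (1 / 4) / sqrt r"
    by (rule u_small[of "1 / 4"]) auto
  have far: "u (t + h) r = u t r" if "R \<le> r" "1 < r" for t r
    by (rule difference_vanishes[where k = "1 / 2" and \<epsilon> = "1 / 4" and R = R and A = "\<bar>h\<bar> * L"])
      (use that L R in \<open>auto simp: power_divide\<close>)
  obtain C where C: "C > 0" "\<And>t r. 1 \<le> r \<Longrightarrow> \<bar>u t r\<bar> \<le> C / sqrt r" by (rule u_bounded) blast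
  \<comment> \<open>Large enough that k (k + 1) >= 10 C^4, so that the global bound C, which is not
    small, is compensated by the power.\<close>
  define k where "k = 10 * C ^ 4 + 1"
  have k: "0 < k" "1 \<le> k" "10 * C ^ 4 \<le> k" using C by (auto simp: k_def intro: add_nonneg_pos)
  \<comment> \<open>Up to R the factor (R / r)^k is at least 1, so |h| L is at most A r^(-k); beyond
    R the difference is already 0, and the large power is free of charge.\<close>
  define A where "A = \<bar>h\<bar> * L * R powr k"
  have A: "0 \<le> A" using L by (simp add: A_def)
  show ?thesis
  proof (rule difference_vanishes[where k = k and \<epsilon> = C and R = 1 and A = A])
    have "10 * C ^ 4 \<le> k * (k + 1)"
      using k by (simp add: algebra_simps) (smt (verit) zero_le_square)
    then show "5 * C ^ 4 / (k * (k + 1)) \<le> 1 / 2"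
      using k by (simp add: divide_le_eq)
    fix t r :: real assume r: "1 < r"
    show "\<bar>(u (t + h) r - u t r) * r\<bar> \<le> A * r powr - k"
    proof (cases "R \<le> r")
      case True
      then show ?thesis using far[OF True r] A by simp
    next
      case False
      have "\<bar>(u (t + h) r - u t r) * r\<bar> \<le> \<bar>h\<bar> * L * r powr - (1 / 2)" by (rule L(2)[OF r])
      also have "\<dots> \<le> \<bar>h\<bar> * L * 1"
        using r L powr_mono[of "- (1 / 2)" 0 r] by (intro mult_left_mono) auto
      also have "\<dots> \<le> \<bar>h\<bar> * L * (R powr k * r powr - k)"
      proof (intro mult_left_mono)
        have "r powr k \<le> R powr k" using False r k by (intro powr_mono2) auto
        then show "1 \<le> R powr k * r powr - k" using r by (simp add: powr_minus_divide)
      qed (use L in simp)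
      finally show ?thesis by (simp add: A_def mult.assoc)
    qed
  qed (use k A C r in auto)
qed

subsection \<open>The stationary profile\<close>

text \<open>The profile of v = r u at time 0. By stationarity its derivative is \<open>J 1 0\<close>
  and its second derivative is \<open>- F 0\<close>.\<close>

definition z :: "real \<Rightarrow> real" where "z r = u 0 r * r"

lemma F_stationary: "1 < r \<Longrightarrow> F t r = F 0 r"
  using stationary[of r 0 t] by (simp add: F_def)

text \<open>Past their starting point the rays run inside r > 1, where stationarity is known, so the
  starting radius r = 1 is covered too.\<close>

lemma J_stationary:
  assumes "1 \<le> r" shows "J \<sigma> t r = J 1 0 r"
  unfolding J_def
proof (intro set_lebesgue_integral_cong allI impI)
  fix s :: real assume "s \<in> {0<..}"
  then show "F (t + \<sigma> * s) (r + s) = F (0 + 1 * s) (r + s)"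
    using F_stationary[of "r + s" "t + \<sigma> * s"] F_stationary[of "r + s" s] assms by simp
qed simp

lemma z_deriv: "1 < r \<Longrightarrow> (z has_real_derivative J 1 0 r) (at r)"
  using v_deriv[of r 0] J_stationary[of r "-1" 0] by (simp add: z_def[abs_def])

lemma z_continuous: "continuous_on {1..} z"
  unfolding z_def[abs_def] by (intro continuous_intros u_continuous)

text \<open>Once F is independent of time, the ray integral is the integral of F over (r, infinity);
  measured from r = 1 it can be differentiated in r.\<close>

lemma J_as_integral:
  assumes r: "1 \<le> r" shows "J 1 0 r = J 1 0 1 - integral {1..r} (F 0)"
proof -
  obtain C where C: "C > 0" "\<And>t r. 1 \<le> r \<Longrightarrow> \<bar>u t r\<bar> \<le> C / sqrt r" by (rule u_bounded) blast
  have eq: "J 1 0 x = (LBINT \<rho>:{x<..}. F 0 \<rho>)" if x: "1 \<le> x" for x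
  proof -
    have "J 1 0 x = (LBINT s:{0<..}. F 0 (x + s))"
      unfolding J_def using x by (intro set_lebesgue_integral_cong) (auto intro!: F_stationary)
    also have "\<dots> = (LBINT \<rho>:{x<..}. F 0 \<rho>)"
      using set_integral_translate(1)[of x "- x" "F 0"] by (simp add: add.commute)
    finally show ?thesis .
  qed
  have Fc: "continuous_on {1..} (F 0)"
    using F_jointly_continuous[of "{1..}" "\<lambda>x. 0" "\<lambda>x. x"] by simp
  have i1: "set_integrable lborel {1<..} (F 0)"
    by (rule powr_dominated(1)[where r = 0 and T = 1 and p = "3 / 2" and C = "C ^ 5"])
      (use C Fc in \<open>auto intro!: F_bound\<close>)
  have "{1<..} = {1<..r} \<union> {r<..}" using r by auto
  moreover have "(LBINT \<rho>:{1<..r} \<union> {r<..}. F 0 \<rho>) = (LBINT \<rho>:{1<..r}. F 0 \<rho>) + (LBINT \<rho>:{r<..}. F 0 \<rho>)"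
    by (rule set_integral_Un) (use r in \<open>auto intro: set_integrable_subset[OF i1]\<close>)
  ultimately have "J 1 0 1 = (LBINT \<rho>:{1..r}. F 0 \<rho>) + J 1 0 r"
    using eq[OF r] eq[of 1] by (simp add: set_integral_Icc_Ioc(1))
  moreover have "(LBINT \<rho>:{1..r}. F 0 \<rho>) = integral {1..r} (F 0)"
    by (intro set_borel_integral_eq_integral(2) borel_integrable_atLeastAtMost' continuous_on_subset[OF Fc]) auto
  ultimately show ?thesis by simp
qed

lemma J_deriv:
  assumes r: "1 < r" shows "(J 1 0 has_real_derivative - F 0 r) (at r)"
proof -
  have Fc: "continuous_on {1..r + 1} (F 0)"
    using F_jointly_continuous[of "{1..r + 1}" "\<lambda>x. 0" "\<lambda>x. x"] by simp
  have "((\<lambda>x. integral {1..x} (F 0)) has_real_derivative F 0 r) (at r within {1..r + 1})"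
    using Fc r by (intro integral_has_real_derivative) auto
  then have "((\<lambda>x. integral {1..x} (F 0)) has_real_derivative F 0 r) (at r)"
    using r at_within_Icc_at[of 1 r "r + 1"] by simp
  then have "((\<lambda>x. J 1 0 1 - integral {1..x} (F 0)) has_real_derivative - F 0 r) (at r)"
    by (auto intro!: derivative_eq_intros)
  moreover have "\<forall>\<^sub>F x in nhds r. J 1 0 x = J 1 0 1 - integral {1..x} (F 0)"
    unfolding eventually_nhds
    by (intro exI[of _ "{1<..}"]) (use r in \<open>auto intro!: J_as_integral\<close>)
  ultimately show ?thesis by (subst DERIV_cong_ev[OF refl _ refl]) auto
qed

text \<open>The Pohozaev identity: with $u = r^{-1/2} y(\log r)$ the profile equation becomes the
  autonomous $y'' = y/4 - y^5$, and this is its energy.\<close>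

definition P :: "real \<Rightarrow> real" where
  "P r = r * (J 1 0 r)\<^sup>2 / 2 - z r * J 1 0 r / 2 + u 0 r ^ 6 * r ^ 3 / 6"

lemma u_deriv: "1 < r \<Longrightarrow> (u 0 has_real_derivative (r * J 1 0 r - z r) / r\<^sup>2) (at r)"
proof -
  assume r: "1 < r"
  have "((\<lambda>x. z x / x) has_real_derivative (J 1 0 r * r - z r * 1) / (r * r)) (at r)"
    using r by (intro DERIV_divide z_deriv DERIV_ident) auto
  moreover have "\<forall>\<^sub>F x in nhds r. u 0 x = z x / x"
    using r by (auto simp: eventually_nhds z_def intro!: exI[of _ "{1<..}"])
  ultimately show ?thesis
    by (subst DERIV_cong_ev[OF refl _ refl]) (auto simp: power2_eq_square mult.commute)
qed

lemma P_deriv: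
  assumes r: "1 < r" shows "(P has_real_derivative 0) (at r)"
proof -
  \<comment> \<open>Naming u' and clearing its denominator reduces the claim to a polynomial
    identity.\<close>
  define D where "D = (r * J 1 0 r - z r) / r\<^sup>2"
  have "D * r ^ 2 = r * J 1 0 r - u 0 r * r" using r by (simp add: D_def z_def)
  then have poly: "3 * (J 1 0 r ^ 2 + 2 * r * J 1 0 r * - F 0 r) - 3 * (J 1 0 r * J 1 0 r + z r * - F 0 r)
      + 6 * u 0 r ^ 5 * D * r ^ 3 + u 0 r ^ 6 * 3 * r ^ 2 = 0"
    unfolding F_def z_def by algebra
  have "((\<lambda>r. r * (J 1 0 r)\<^sup>2 / 2) has_real_derivative (J 1 0 r ^ 2 + 2 * r * J 1 0 r * - F 0 r) / 2) (at r)"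
    by (rule derivative_eq_intros J_deriv[OF r] | simp)+
  moreover have "((\<lambda>r. z r * J 1 0 r / 2) has_real_derivative (J 1 0 r * J 1 0 r + z r * - F 0 r) / 2) (at r)"
    by (rule derivative_eq_intros z_deriv[OF r] J_deriv[OF r] | simp)+
  moreover have "((\<lambda>r. u 0 r ^ 6 * r ^ 3 / 6) has_real_derivative (6 * u 0 r ^ 5 * D * r ^ 3 + u 0 r ^ 6 * 3 * r ^ 2) / 6) (at r)"
    unfolding D_def by (rule derivative_eq_intros u_deriv[OF r] | simp)+
  ultimately have "(P has_real_derivative (J 1 0 r ^ 2 + 2 * r * J 1 0 r * - F 0 r) / 2
      - (J 1 0 r * J 1 0 r + z r * - F 0 r) / 2 + (6 * u 0 r ^ 5 * D * r ^ 3 + u 0 r ^ 6 * 3 * r ^ 2) / 6) (at r)"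
    unfolding P_def[abs_def] by (intro DERIV_add DERIV_diff)
  moreover have "(J 1 0 r ^ 2 + 2 * r * J 1 0 r * - F 0 r) / 2
      - (J 1 0 r * J 1 0 r + z r * - F 0 r) / 2 + (6 * u 0 r ^ 5 * D * r ^ 3 + u 0 r ^ 6 * 3 * r ^ 2) / 6 = 0"
    using poly by argo
  ultimately show ?thesis by simp
qed

text \<open>In the variables y = r^(1/2) u and j = r^(1/2) z' the energy is j^2/2 - y j/2 + y^6/6,
  with no r left. Both variables tend to 0 at infinity: y by the uniform decay of the trajectory, j
  by the ray bound that follows from it.\<close>

lemma P_zero: "P 1 = 0"
proof -
  have cont: "continuous_on {1..} P"
    unfolding P_def[abs_def] by (intro continuous_intros J_continuous z_continuous u_continuous) auto
  have const: "P r = P 1" if "1 < r" for r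
    by (rule DERIV_isconst2[of 1 r]) (use that P_deriv in \<open>auto intro: continuous_on_subset[OF cont]\<close>)
  have "\<bar>P 1\<bar> \<le> e" if e: "0 < e" for e
  proof -
    \<comment> \<open>With |y| <= \<epsilon>, |j| <= 2 \<epsilon> and \<epsilon> <= 1 the three
      terms add up to at most 2 \<epsilon> + \<epsilon> + \<epsilon>/6, which is below 4
      \<epsilon>.\<close>
    define \<epsilon> where "\<epsilon> = min 1 (e / 4)"
    have \<epsilon>: "0 < \<epsilon>" "\<epsilon> \<le> 1" "4 * \<epsilon> \<le> e" using e by (auto simp: \<epsilon>_def)
    obtain R where R: "1 \<le> R" "\<And>t r. R \<le> r \<Longrightarrow> \<bar>u t r\<bar> \<le> \<epsilon> / sqrt r"
      by (rule u_small[OF \<epsilon>(1)]) blast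
    define r where "r = R + 1"
    have r: "1 < r" "R \<le> r" using R by (auto simp: r_def)
    define j where "j = J 1 0 r * sqrt r"
    define y where "y = u 0 r * sqrt r"
    have sr: "sqrt r * sqrt r = r" "0 < sqrt r" using r by auto
    have y: "\<bar>y\<bar> \<le> \<epsilon>" using R(2)[OF r(2), of 0] sr by (simp add: y_def abs_mult pos_le_divide_eq)
    have j: "\<bar>j\<bar> \<le> 2 * \<epsilon>"
    proof -
      have "\<bar>J 1 0 r\<bar> \<le> 2 * \<epsilon> ^ 5 * r powr - (1 / 2)" by (rule J_bound[OF R r(2)])
      also have "\<dots> = 2 * \<epsilon> ^ 5 / sqrt r" using r by (simp add: powr_minus_divide powr_half_sqrt)
      also have "\<dots> \<le> 2 * \<epsilon> / sqrt r"
        using \<epsilon> sr power_decreasing[of 1 5 \<epsilon>] by (intro divide_right_mono) auto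
      finally show ?thesis using sr by (simp add: j_def abs_mult pos_le_divide_eq)
    qed
    have "r ^ 3 = sqrt r ^ 6"
    proof -
      have "sqrt r ^ 6 = (sqrt r * sqrt r) ^ 3" by (simp add: eval_nat_numeral mult.assoc del: real_sqrt_mult_self)
      then show ?thesis using sr by simp
    qed
    then have y6: "u 0 r ^ 6 * r ^ 3 = y ^ 6" by (simp add: y_def power_mult_distrib)
    have j2: "r * (J 1 0 r)\<^sup>2 = j\<^sup>2" using r by (simp add: j_def power_mult_distrib)
    have yj: "z r * J 1 0 r = y * j"
    proof -
      have "y * j = (sqrt r * sqrt r) * (u 0 r * J 1 0 r)" unfolding y_def j_def by algebra
      then show ?thesis unfolding sr(1) z_def by algebra
    qed
    have "P r = j\<^sup>2 / 2 - y * j / 2 + y ^ 6 / 6" unfolding P_def j2 yj y6 ..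
    moreover have "j\<^sup>2 \<le> 4 * (\<epsilon> * \<epsilon>)"
    proof -
      have "j\<^sup>2 \<le> (2 * \<epsilon>)\<^sup>2" using j \<epsilon> by (intro abs_le_square_iff[THEN iffD1]) auto
      then show ?thesis by (simp add: power2_eq_square)
    qed
    moreover have "\<bar>y * j\<bar> \<le> 2 * (\<epsilon> * \<epsilon>)"
    proof -
      have "\<bar>y\<bar> * \<bar>j\<bar> \<le> \<epsilon> * (2 * \<epsilon>)" using y j \<epsilon> by (intro mult_mono) auto
      then show ?thesis by (simp add: abs_mult)
    qed
    moreover have "0 \<le> y ^ 6" "y ^ 6 \<le> \<epsilon> ^ 6"
      using power_mono[OF y, of 6] by (auto simp: power_even_abs)
    moreover have "\<epsilon> ^ 6 \<le> \<epsilon>" "\<epsilon> * \<epsilon> \<le> \<epsilon>"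
      using \<epsilon> power_decreasing[of 1 6 \<epsilon>] mult_left_le[of \<epsilon> \<epsilon>] by auto
    ultimately have "\<bar>P r\<bar> \<le> 4 * \<epsilon>"
      using zero_le_power2[of j] by argo
    then show ?thesis using const[OF r(1)] \<epsilon>(3) by simp
  qed
  then show ?thesis by (metis abs_le_zero_iff dense_ge)
qed

text \<open>As z = r u, the claim z'(1) = z(1) says u'(1) = 0. Functions supported in r > 1 cannot
  see this, so the equation is tested with a \<open>b\<close> positive at r = 1: stationarity makes
  \<open>mA b\<close> constant, hence \<open>mB b\<close> and then \<open>mN b 0\<close> vanish,
  while integration by parts reduces \<open>mN b 0\<close> to the boundary term (z'(1) - z(1))
  b(1).\<close>

lemma Neumann: "J 1 0 1 = z 1"
proof -
  define b where "b = cutoff 0 2 0"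
  have bt: "test_fun UNIV b" unfolding b_def by (rule cutoff_test_fun) simp
  note sm = test_fun_smooth[OF bt] test_fun_smooth[OF test_fun_deriv[OF bt]]
  have b1: "b 1 > 0" unfolding b_def by (rule cutoff_pos) simp
  have bz: "b r = 0" if "2 \<le> r" for r using that by (simp add: b_def cutoff_outside)
  have dbz: "deriv b r = 0" if "2 < r" for r
    by (rule DERIV_imp_deriv, rule DERIV_zero_on_open[of "{2<..}"]) (use that bz in auto)
  have Aconst: "mA b t = mA b 0" for t
    unfolding moments_eq(1)[OF bt]
    using stationary[of _ 0 t] by (intro set_lebesgue_integral_cong) auto
  have "mB b t = 0" for t
  proof -
    have "((\<lambda>t. mA b 0) has_real_derivative mB b t) (at t)"
      using moments_deriv(1)[OF bt, of t] Aconst by (subst (asm) DERIV_cong_ev[OF refl _ refl]) auto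
    then show ?thesis using DERIV_unique DERIV_const by blast
  qed
  then have "((\<lambda>t. 0) has_real_derivative mN b 0) (at 0)"
    using moments_deriv(2)[OF bt, of 0] by (subst (asm) DERIV_cong_ev[OF refl _ refl]) auto
  then have N0: "mN b 0 = 0" using DERIV_unique DERIV_const by blast
  \<comment> \<open>r^2 b' is the weight that multiplies u_r in \<open>mN\<close>.\<close>
  define \<zeta> where "\<zeta> r = r * r * deriv b r" for r
  have \<zeta>s: "smooth_fun \<zeta>" unfolding \<zeta>_def by (intro smooth_fun_mult smooth_fun_id sm)
  \<comment> \<open>The point 3 lies beyond the support of \<open>b\<close>, so every term at the
    right end vanishes.\<close>
  have \<zeta>z: "\<zeta> 3 = 0" using dbz[of 3] by (simp add: \<zeta>_def)
  have uri: "set_integrable lborel {1..3} (ur 0)" by (rule rad_L2_interval[OF radL2(1)]) simp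
  note parts = integral_primitive_by_parts[OF uri \<zeta>s \<zeta>z]
  have uW: "u 0 r = u 0 1 + (LBINT x:{1..r}. ur 0 x)" if "1 \<le> r" for r
    unfolding u_def by (rule prof_split[OF radL2(1) order_refl that])
  have c13: "continuous_on {1..3} (u 0)" "continuous_on {1..3} (F 0)" "continuous_on {1..3} (J 1 0)" "continuous_on {1..3} z"
    using F_jointly_continuous[of "{1..3}" "\<lambda>x. 0" "\<lambda>x. x"]
    by (auto intro: continuous_on_subset[OF u_continuous] continuous_on_subset[OF J_continuous] continuous_on_subset[OF z_continuous])
  have i\<zeta>: "set_integrable lborel {1..3} (deriv \<zeta>)"
    by (intro set_integrable_continuous smooth_fun_continuous_on smooth_fun_deriv \<zeta>s)
  have iF: "set_integrable lborel {1..3} (\<lambda>r. r * F 0 r * b r)"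
    by (intro borel_integrable_atLeastAtMost' continuous_intros c13 smooth_fun_continuous_on sm)
  have iu: "set_integrable lborel {1..3} (\<lambda>r. u 0 r * deriv \<zeta> r)"
    by (intro borel_integrable_atLeastAtMost' continuous_intros c13 smooth_fun_continuous_on smooth_fun_deriv \<zeta>s)
  have e1: "- (LBINT r:{1<..}. ur 0 r * r * (deriv b r * r)) = (LBINT r:{1..3}. u 0 r * deriv \<zeta> r) + u 0 1 * \<zeta> 1"
  proof -
    have "(LBINT r:{1<..}. ur 0 r * r * (deriv b r * r)) = (LBINT r:{1<..3}. ur 0 r * r * (deriv b r * r))"
      using dbz by (intro set_integral_support(1)) auto
    also have "\<dots> = (LBINT r:{1..3}. ur 0 r * \<zeta> r)"
      by (simp add: set_integral_Icc_Ioc(1) \<zeta>_def mult_ac)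
    also have "\<dots> = - (LBINT r:{1..3}. (LBINT x:{1..r}. ur 0 x) * deriv \<zeta> r)"
      using parts(2) by simp
    also have "(LBINT r:{1..3}. (LBINT x:{1..r}. ur 0 x) * deriv \<zeta> r) = (LBINT r:{1..3}. u 0 r * deriv \<zeta> r - u 0 1 * deriv \<zeta> r)"
    proof (intro set_lebesgue_integral_cong allI impI)
      fix r :: real assume "r \<in> {1..3}"
      then have "u 0 r = u 0 1 + (LBINT x:{1..r}. ur 0 x)" by (intro uW) auto
      then show "(LBINT x:{1..r}. ur 0 x) * deriv \<zeta> r = u 0 r * deriv \<zeta> r - u 0 1 * deriv \<zeta> r"
        by (simp add: distrib_right)
    qed simp
    also have "\<dots> = (LBINT r:{1..3}. u 0 r * deriv \<zeta> r) - u 0 1 * (\<zeta> 3 - \<zeta> 1)"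
      unfolding set_integral_diff(2)[OF iu set_integrable_mult_right[OF i\<zeta>]] set_integral_mult_right
      by (subst set_integral_deriv[OF \<zeta>s]) simp_all
    finally show ?thesis by (simp add: \<zeta>z)
  qed
  have e2: "(LBINT r:{1<..}. u 0 r ^ 5 * (b r * r\<^sup>2)) = (LBINT r:{1..3}. r * F 0 r * b r)"
  proof -
    have "(LBINT r:{1<..}. u 0 r ^ 5 * (b r * r\<^sup>2)) = (LBINT r:{1<..3}. u 0 r ^ 5 * (b r * r\<^sup>2))"
      using bz by (intro set_integral_support(1)) auto
    then show ?thesis by (simp add: set_integral_Icc_Ioc(1) F_def power2_eq_square mult_ac)
  qed
  \<comment> \<open>The antiderivative is u \<zeta> - (r z' - z) b. Here r z' - z = r^2 u', so u'
    \<zeta> cancels r^2 u' b', and the derivative of r z' - z is r z'' = - r F. Differentiability is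
    known only for r > 1, whence the version of the theorem for interior points with continuity up
    to r = 1.\<close>
  have "((\<lambda>r. u 0 r * deriv \<zeta> r + r * F 0 r * b r) has_integral
     (u 0 3 * \<zeta> 3 - (3 * J 1 0 3 - z 3) * b 3) - (u 0 1 * \<zeta> 1 - (1 * J 1 0 1 - z 1) * b 1)) {1..3}"
  proof (rule fundamental_theorem_of_calculus_interior)
    show "continuous_on {1..3} (\<lambda>r. u 0 r * \<zeta> r - (r * J 1 0 r - z r) * b r)"
      by (intro continuous_intros c13 smooth_fun_continuous_on sm \<zeta>s)
    fix r :: real assume "r \<in> {1<..<3}"
    then have r: "1 < r" by simp
    have "((\<lambda>r. u 0 r * \<zeta> r - (r * J 1 0 r - z r) * b r) has_real_derivative
       ((r * J 1 0 r - z r) / r\<^sup>2 * \<zeta> r + u 0 r * deriv \<zeta> r)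
        - ((1 * J 1 0 r + r * - F 0 r - J 1 0 r) * b r + (r * J 1 0 r - z r) * deriv b r)) (at r)"
      by (rule derivative_eq_intros refl z_deriv[OF r] J_deriv[OF r] u_deriv[OF r] smooth_fun_DERIV[OF \<zeta>s] smooth_fun_DERIV[OF sm(1)] | simp)+
    moreover have "((r * J 1 0 r - z r) / r\<^sup>2 * \<zeta> r + u 0 r * deriv \<zeta> r)
        - ((1 * J 1 0 r + r * - F 0 r - J 1 0 r) * b r + (r * J 1 0 r - z r) * deriv b r) = u 0 r * deriv \<zeta> r + r * F 0 r * b r"
      using r by (simp add: \<zeta>_def power2_eq_square)
    ultimately show "((\<lambda>r. u 0 r * \<zeta> r - (r * J 1 0 r - z r) * b r) has_vector_derivative u 0 r * deriv \<zeta> r + r * F 0 r * b r) (at r)"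
      by (simp add: has_real_derivative_iff_has_vector_derivative)
  qed simp
  then have "integral {1..3} (\<lambda>r. u 0 r * deriv \<zeta> r + r * F 0 r * b r) = (J 1 0 1 - z 1) * b 1 - u 0 1 * \<zeta> 1"
    using bz[of 3] by (simp add: integral_unique \<zeta>z)
  moreover have "integral {1..3} (\<lambda>r. u 0 r * deriv \<zeta> r + r * F 0 r * b r)
     = (LBINT r:{1..3}. u 0 r * deriv \<zeta> r) + (LBINT r:{1..3}. r * F 0 r * b r)"
    unfolding set_integral_add(2)[OF iu iF, symmetric]
    by (rule set_borel_integral_eq_integral(2)[OF set_integral_add(1)[OF iu iF], symmetric])
  ultimately have "mN b 0 = (J 1 0 1 - z 1) * b 1"
    unfolding moments_eq(3)[OF bt] e1 e2 by simp
  then show ?thesis using N0 b1 by simp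
qed

text \<open>z'' = - u^4 z is a linear equation with bounded coefficient and zero Cauchy data at r =
  1, so a Gronwall argument applies: the weighted sum of squares \<open>g\<close> is nonnegative,
  nonincreasing and 0 at r = 1.\<close>

lemma z_zero:
  assumes r: "1 \<le> r" shows "z r = 0"
proof -
  \<comment> \<open>With z' = z at r = 1 the quadratic terms of the energy cancel.\<close>
  have "P 1 = z 1 ^ 6 / 6" by (simp add: P_def Neumann z_def power2_eq_square)
  then have z1: "z 1 = 0" "J 1 0 1 = 0" using P_zero Neumann by auto
  obtain C where C: "C > 0" "\<And>t r. 1 \<le> r \<Longrightarrow> \<bar>u t r\<bar> \<le> C / sqrt r" by (rule u_bounded) blast
  \<comment> \<open>K bounds |1 - u^4|, the coefficient in (z^2 + z'^2)' = (1 - u^4) 2 z z'.\<close>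
  define K where "K = 1 + C ^ 4"
  define g where "g x = ((z x)\<^sup>2 + (J 1 0 x)\<^sup>2) * exp (- K * x)" for x
  have "g 1 \<ge> g r"
  proof (rule DERIV_nonpos_imp_decreasing_open[OF r])
    show "continuous_on {1..r} g"
      unfolding g_def by (intro continuous_intros continuous_on_subset[OF z_continuous] continuous_on_subset[OF J_continuous]) auto
    fix x assume "1 < x" "x < r"
    then have x: "1 < x" by simp
    let ?y = "(2 * z x * J 1 0 x + 2 * J 1 0 x * - F 0 x) * exp (- K * x) + ((z x)\<^sup>2 + (J 1 0 x)\<^sup>2) * (exp (- K * x) * - K)"
    have "(g has_real_derivative ?y) (at x)"
      unfolding g_def[abs_def]
      by (rule derivative_eq_intros refl z_deriv[OF x] J_deriv[OF x] | simp)+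
    moreover have "?y \<le> 0"
    proof -
      have "C / sqrt x \<le> C / 1" using C x by (intro divide_left_mono) auto
      then have "\<bar>u 0 x\<bar> \<le> C" using C(2)[of x 0] x by simp
      then have u4: "u 0 x ^ 4 \<le> C ^ 4" using power_mono[of "\<bar>u 0 x\<bar>" C 4] by (simp add: power_even_abs)
      have Fz: "F 0 x = u 0 x ^ 4 * z x" by (simp add: F_def z_def eval_nat_numeral)
      have "2 * z x * J 1 0 x + 2 * J 1 0 x * - F 0 x = (1 - u 0 x ^ 4) * (2 * z x * J 1 0 x)"
        by (simp add: Fz algebra_simps)
      also have "\<dots> \<le> \<bar>1 - u 0 x ^ 4\<bar> * \<bar>2 * z x * J 1 0 x\<bar>"
        unfolding abs_mult[symmetric] by (rule abs_ge_self)
      also have "\<dots> \<le> K * ((z x)\<^sup>2 + (J 1 0 x)\<^sup>2)"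
      proof (intro mult_mono)
        have "0 \<le> u 0 x ^ 4" by simp
        then show "\<bar>1 - u 0 x ^ 4\<bar> \<le> K" using u4 unfolding K_def by linarith
        show "\<bar>2 * z x * J 1 0 x\<bar> \<le> (z x)\<^sup>2 + (J 1 0 x)\<^sup>2"
          using zero_le_power2[of "\<bar>z x\<bar> - \<bar>J 1 0 x\<bar>"] by (simp add: power2_diff abs_mult)
      qed (use C in \<open>auto simp: K_def\<close>)
      finally have "(2 * z x * J 1 0 x + 2 * J 1 0 x * - F 0 x) * exp (- K * x) \<le> (K * ((z x)\<^sup>2 + (J 1 0 x)\<^sup>2)) * exp (- K * x)"
        by (intro mult_right_mono) auto
      then show ?thesis by (simp add: mult_ac)
    qed
    ultimately show "\<exists>y. (g has_real_derivative y) (at x) \<and> y \<le> 0" by blast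
  qed
  then have "((z r)\<^sup>2 + (J 1 0 r)\<^sup>2) * exp (- K * r) \<le> 0" by (simp add: g_def z1)
  then have "(z r)\<^sup>2 + (J 1 0 r)\<^sup>2 \<le> 0" by (simp add: mult_le_0_iff)
  then show ?thesis by (metis add_nonneg_eq_0_iff order_antisym power2_eq_square sum_squares_ge_zero zero_eq_power2 zero_le_power2)
qed

lemma U0_zero: "AE r in lborel. r \<in> {1<..} \<longrightarrow> U0 t r = 0"
  using u_AE[of t]
proof eventually_elim
  case (elim r)
  show ?case
  proof
    assume r: "r \<in> {1<..}"
    then have "u t r = u 0 r" using stationary[of r 0 t] by simp
    then show "U0 t r = 0" using elim z_zero[of r] r by (simp add: z_def)
  qed
qed

end

theorem theorem7p2:
  fixes u0 u1 :: "real \<Rightarrow> real" and U0 U1 :: "real \<Rightarrow> real \<Rightarrow> real"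
  assumes "in_H u0 u1"
    and "global_solution u0 u1 U0 U1"
    and "precompact_traj U0 U1"
  shows "\<forall>t. AE r in lborel. r \<in> {1<..} \<longrightarrow> U0 t r = 0"
proof
  fix t
  interpret compact_solution u0 u1 U0 U1
    by unfold_locales (fact assms(2), fact assms(3))
  show "AE r in lborel. r \<in> {1<..} \<longrightarrow> U0 t r = 0"
    by (rule U0_zero)
qed

end
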